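(* Let $G\colon\mathbb{R}^{2n}\to[0,\infty)$ be a differentiable and strictly convex symplectic G-function satisfying the $\Delta_2$-condition. Then $$C_G=\sup\ \frac1{T_u}\,\frac{\displaystyle\int_0^{T_u}\langle\nabla G(u),u\rangle\,dt}{\displaystyle\int_0^{T_u}G^\star(\nabla G(u))\,dt},$$ where the supremum is taken over all nonconstant periodic solutions $u\colon\mathbb{R}\to\mathbb{R}^{2n}$ of the Hamiltonian system $J\dot u(t)=-\nabla G(u(t))$, and $T_u>0$ denotes a period of $u$.
   Context: $J=\begin{pmatrix}0&I_n\\-I_n&0\end{pmatrix}$. The convex conjugate of $G$ is $G^\star(v)=\sup_u\{\langle u,v\rangle-G(u)\}$. A G-function is a convex function $G\colon\mathbb{R}^m\to[0,\infty)$ with $G(u)=0\iff u=0$, $G(-u)=G(u)$, and $\lim_{|u|\to\infty}G(u)/|u|=\infty$. $G$ on $\mathbb{R}^{2n}$ is symplectic if $G^\star(Ju)=G(u)$ for all $u$. The $\Delta_2$-condition: there is $C>0$ with $G(2u)\le CG(u)+1$ for all $u$. $\mathbf{L}^G([0,1],\mathbb{R}^{2n})$ is the set of measurable $u\colon[0,1]\to\mathbb{R}^{2n}$ with $\int_0^1G(\lambda u)\,dt<\infty$ for some $\lambda>0$. $\mathbf{W}^1_T\mathbf{L}^G([0,1],\mathbb{R}^{2n})$ is the space of absolutely continuous $u\in\mathbf{L}^G$ with $\dot u\in\mathbf{L}^G$ and $u(0)=u(1)$. The constant is $$C_G=-\inf\left\{\frac{\int_0^1\langle J\dot u,u\rangle\,dt}{\int_0^1G(\dot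 u)\,dt}:\ u\in\mathbf{W}^1_T\mathbf{L}^G([0,1],\mathbb{R}^{2n}),\ u\text{ nonconstant}\right\}.$$ *)

theory Defs
  imports "HOL-Analysis.Analysis"
begin

text \<open>\<open>\<real>\<^sup>2\<^sup>n\<close> is rendered as \<open>(real^'n) \<times> (real^'n)\<close> with \<open>n = CARD('n)\<close>; the product inner product
  and norm are the Euclidean ones. The map below is multiplication by the block matrix
  with rows \<open>(0, I)\<close> and \<open>(-I, 0)\<close>.\<close>

definition symp_J :: "(real^'n) \<times> (real^'n) \<Rightarrow> (real^'n) \<times> (real^'n)" where
  "symp_J z = (snd z, - fst z)"

definition convex_conjugate :: "('a::euclidean_space \<Rightarrow> real) \<Rightarrow> 'a \<Rightarrow> ereal" where
  "convex_conjugate G v = (SUP u. ereal (u \<bullet> v - G u))"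

definition G_function :: "('a::euclidean_space \<Rightarrow> real) \<Rightarrow> bool" where
  "G_function G \<longleftrightarrow>
     convex_on UNIV G \<and> (\<forall>u. 0 \<le> G u) \<and> (\<forall>u. G u = 0 \<longleftrightarrow> u = 0) \<and> (\<forall>u. G (- u) = G u) \<and>
     filterlim (\<lambda>u. G u / norm u) at_top at_infinity"

definition symplectic :: "((real^'n) \<times> (real^'n) \<Rightarrow> real) \<Rightarrow> bool" where
  "symplectic G \<longleftrightarrow> (\<forall>u. convex_conjugate G (symp_J u) = ereal (G u))"

definition Delta2 :: "('a::euclidean_space \<Rightarrow> real) \<Rightarrow> bool" where
  "Delta2 G \<longleftrightarrow> (\<exists>C>0. \<forall>u. G (2 *\<^sub>R u) \<le> C * G u + 1)"

definition strictly_convex :: "('a::real_vector \<Rightarrow> real) \<Rightarrow> bool" where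
  "strictly_convex G \<longleftrightarrow>
     (\<forall>x y t. x \<noteq> y \<longrightarrow> 0 < t \<longrightarrow> t < 1 \<longrightarrow>
        G ((1 - t) *\<^sub>R x + t *\<^sub>R y) < (1 - t) * G x + t * G y)"

definition gradient :: "('a::euclidean_space \<Rightarrow> real) \<Rightarrow> 'a \<Rightarrow> 'a" where
  "gradient G x = (THE D. GDERIV G x :> D)"

text \<open>Functions on \<open>[0,1]\<close> are total functions on \<open>real\<close> of which only the values on \<open>{0..1}\<close>
  are used; measurability and integrals are Lebesgue.\<close>

definition Orlicz_space :: "('a::euclidean_space \<Rightarrow> real) \<Rightarrow> (real \<Rightarrow> 'a) set" where
  "Orlicz_space G =
     {u. u \<in> borel_measurable (lebesgue_on {0..1}) \<and>
         (\<exists>l>0. (\<integral>\<^sup>+t. ennreal (G (l *\<^sub>R u t)) \<partial>lebesgue_on {0..1}) < \<infinity>)}"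

text \<open>The usual \<open>\<epsilon>\<close>-\<open>\<delta>\<close> definition: \<open>D\<close> ranges over the finite families of
  non-overlapping compact subintervals of \<open>{a..b}\<close>.\<close>

definition abs_continuous_on :: "real \<Rightarrow> real \<Rightarrow> (real \<Rightarrow> 'a::real_normed_vector) \<Rightarrow> bool" where
  "abs_continuous_on a b u \<longleftrightarrow>
     (\<forall>e>0. \<exists>d>0. \<forall>D. D division_of \<Union>D \<longrightarrow> \<Union>D \<subseteq> {a..b} \<longrightarrow>
        (\<Sum>K\<in>D. Sup K - Inf K) < d \<longrightarrow> (\<Sum>K\<in>D. norm (u (Sup K) - u (Inf K))) < e)"

text \<open>An absolutely continuous function is differentiable almost everywhere on \<open>{0..1}\<close>; on the
  exceptional null set the value below is arbitrary and irrelevant.\<close>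

definition dot :: "(real \<Rightarrow> 'a::real_normed_vector) \<Rightarrow> real \<Rightarrow> 'a" where
  "dot u t = vector_derivative u (at t within {0..1})"

definition W1T :: "('a::euclidean_space \<Rightarrow> real) \<Rightarrow> (real \<Rightarrow> 'a) set" where
  "W1T G =
     {u. abs_continuous_on 0 1 u \<and> u \<in> Orlicz_space G \<and> dot u \<in> Orlicz_space G \<and> u 0 = u 1}"

text \<open>The extended reals make the infimum meaningful without a separate boundedness argument.
  If \<open>\<integral> G(u')\<close> is infinite (which cannot happen under the \<open>\<Delta>\<^sub>2\<close>-condition), then the Bochner
  integral in the denominator is 0 and the quotient is 0, in agreement with \<open>a / \<infinity> = 0\<close>.\<close>

definition C_const :: "((real^'n) \<times> (real^'n) \<Rightarrow> real) \<Rightarrow> ereal" where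
  "C_const G =
     - (INF u \<in> {u \<in> W1T G. \<not> u constant_on {0..1}}.
          ereal ((LINT t|lebesgue_on {0..1}. symp_J (dot u t) \<bullet> u t) /
                 (LINT t|lebesgue_on {0..1}. G (dot u t))))"

definition Hamiltonian_solution ::
    "((real^'n) \<times> (real^'n) \<Rightarrow> real) \<Rightarrow> (real \<Rightarrow> (real^'n) \<times> (real^'n)) \<Rightarrow> bool" where
  "Hamiltonian_solution G u \<longleftrightarrow>
     (\<forall>t. \<exists>u'. (u has_vector_derivative u') (at t) \<and> symp_J u' = - gradient G (u t))"

text \<open>Pairs of a nonconstant periodic solution and one of its periods, not necessarily the
  minimal one.\<close>

definition periodic_solutions ::
    "((real^'n) \<times> (real^'n) \<Rightarrow> real) \<Rightarrow> ((real \<Rightarrow> (real^'n) \<times> (real^'n)) \<times> real) set" where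
  "periodic_solutions G =
     {(u, T). Hamiltonian_solution G u \<and> \<not> u constant_on UNIV \<and> 0 < T \<and> (\<forall>t. u (t + T) = u t)}"

end

theory Submission
  imports Defs "HOL-Complex_Analysis.Great_Picard"
begin

text \<open>Rescaling a \<open>T\<close>-periodic solution \<open>y\<close> to the closed curve \<open>u t = y (T t) / T\<close> on \<open>[0,1]\<close> leaves
  the derivative unchanged up to reparametrisation, and since \<open>G\<^sup>\<star>(J z) = G z\<close> it turns the quotient of the
  solution into minus the quotient of \<open>u\<close> in the definition of \<open>C\<^sub>G\<close>; this gives one inequality.

  Conversely, let \<open>u\<close> be a closed curve with positive action \<open>A\<close> and with \<open>\<integral> G(u') = s\<close>. If a curve maximises
  the action among all closed curves with \<open>\<integral> G \<le> s\<close>, then its Euler--Lagrange equation is the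
  Hamiltonian system up to the rescaling above, the multiplier determining the period, and its quotient is at
  least \<open>A / s\<close>. Fixing the level \<open>s\<close> is what avoids any loss of compactness under the scaling \<open>u \<mapsto> c u\<close>.
  Weak compactness in the Orlicz space is avoided by discretisation: among polygons with \<open>N\<close> vertices
  the maximum is attained in finite dimension, its Euler--Lagrange equation is the midpoint rule, and
  \<open>\<Delta>\<^sub>2\<close> bounds the multiplier and hence the slopes independently of \<open>N\<close>, so that Arzela--Ascoli yields a
  solution in the limit. The polygons inscribed in \<open>u\<close> are admissible by Jensen's inequality, where
  \<open>u\<close> is recovered from \<open>u'\<close> by Lebesgue's theorem for absolutely continuous functions.\<close>

section \<open>Absolutely continuous functions\<close>

text \<open>The action is quadratic in the curve, while \<open>G\<close> need not be homogeneous, so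
  a homothety cannot normalise the quotient; hence each curve is compared with a maximiser at its
  own energy level. Attainment of the infimum is not asked for: below every positive value of the
  quotient \<open>A / s\<close>, any smaller positive number is reached by the quotient of some
  solution. Three facts make the bounds independent of \<open>N\<close>. Superlinear growth, in the
  form \<open>norm v - K \<le> G v\<close>, bounds the diameter of a polygon by its energy. The
  tangent inequality and \<Delta>2 enclose the denominator of the multiplier between
  \<open>s\<close> and \<open>C * s + 1\<close>. Symplecticity expresses the inverse of the gradient
  through the gradient, so the Euler-Lagrange equation can be solved for the slope as a continuous
  function of the positions: bounded positions give bounded slopes, and uniform convergence of
  polygons gives convergence of slopes. This is why the limit is C1. A supremum over no solutions
  would be -\<infinity>; an explicit circle supplies one solution with nonnegative quotient, which
  leaves only curves of positive action to be treated.\<close>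

lemma division_of_real_interval:
  fixes D :: "real set set"
  assumes "D division_of S" "K \<in> D"
  shows "Inf K \<le> Sup K" "K = {Inf K..Sup K}"
proof -
  obtain c d where K: "K = {c..d}" "K \<noteq> {}"
    using division_ofD(3,4)[OF assms] by (metis cbox_interval)
  then have "c \<le> d" by auto
  with K show "Inf K \<le> Sup K" "K = {Inf K..Sup K}" by auto
qed

text \<open>Equal consecutive terms contribute no interval, so every member has nonempty interior;
  \<open>h x x = 0\<close> makes the omitted steps invisible to the sums. One \<open>E\<close>
  serves all \<open>h\<close>, so that lengths and increments are read off the same
  division.\<close>

lemma mono_sequence_division:
  fixes s :: "nat \<Rightarrow> real"
  assumes "mono s"
  shows "\<exists>E. E division_of \<Union>E \<and> \<Union>E \<subseteq> {s 0..s n} \<and> (\<forall>K\<in>E. interior K \<noteq> {}) \<and>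
    (\<forall>h::real \<Rightarrow> real \<Rightarrow> real. (\<forall>x. h x x = 0) \<longrightarrow> (\<Sum>K\<in>E. h (Inf K) (Sup K)) = (\<Sum>i<n. h (s i) (s (Suc i))))"
proof (induction n)
  case 0
  have "({}::real set set) division_of \<Union>{}" by simp
  then show ?case by (intro exI[of _ "{}"]) auto
next
  case (Suc n)
  then obtain E where E: "E division_of \<Union>E" "\<Union>E \<subseteq> {s 0..s n}" "\<forall>K\<in>E. interior K \<noteq> {}"
    and h: "\<And>h::real \<Rightarrow> real \<Rightarrow> real. (\<forall>x. h x x = 0) \<Longrightarrow> (\<Sum>K\<in>E. h (Inf K) (Sup K)) = (\<Sum>i<n. h (s i) (s (Suc i)))"
    by blast
  have le: "s n \<le> s (Suc n)" "s 0 \<le> s n" using assms by (auto simp: mono_def)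
  show ?case
  proof (cases "s n = s (Suc n)")
    case True
    with E h show ?thesis by (intro exI[of _ E]) auto
  next
    case False
    let ?K = "{s n..s (Suc n)}"
    have lt: "s n < s (Suc n)" using False le by simp
    have K: "{?K} division_of ?K" using division_of_self[of "s n" "s (Suc n)"] lt by simp
    have "interior ?K \<inter> interior (\<Union>E) \<subseteq> interior ?K \<inter> interior {s 0..s n}"
      using E(2) interior_mono by blast
    also have "\<dots> = {}" by auto
    finally have int: "interior ?K \<inter> interior (\<Union>E) = {}" by blast
    have div: "insert ?K E division_of \<Union>(insert ?K E)"
      using division_disjoint_union[OF K E(1) int] by simp
    have notin: "?K \<notin> E"
    proof
      assume "?K \<in> E"
      with E(2) have "?K \<subseteq> {s 0..s n}" by blast
      with lt show False by simp
    qed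
    have "finite E" using E(1) by auto
    show ?thesis
    proof (intro exI[of _ "insert ?K E"] conjI allI impI div)
      show "\<Union>(insert ?K E) \<subseteq> {s 0..s (Suc n)}" using E(2) le by auto
      show "\<forall>K\<in>insert ?K E. interior K \<noteq> {}" using E(3) lt by auto
      fix h' :: "real \<Rightarrow> real \<Rightarrow> real" assume "\<forall>x. h' x x = 0"
      with h[of h'] show "(\<Sum>K\<in>insert ?K E. h' (Inf K) (Sup K)) = (\<Sum>i<Suc n. h' (s i) (s (Suc i)))"
        using notin \<open>finite E\<close> lt by simp
    qed
  qed
qed

text \<open>Nonempty interiors make the families \<open>E K\<close> disjoint: a common member would
  have its interior inside two non-overlapping intervals. A degenerate interval at a shared endpoint
  could otherwise count once in the union and twice in the double sum.\<close>

lemma division_of_refinement: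
  fixes D :: "real set set"
  assumes D: "D division_of \<Union>D"
    and E: "\<And>K. K \<in> D \<Longrightarrow> E K division_of \<Union>(E K)" "\<And>K. K \<in> D \<Longrightarrow> \<Union>(E K) \<subseteq> K"
    and ne: "\<And>K L. K \<in> D \<Longrightarrow> L \<in> E K \<Longrightarrow> interior L \<noteq> {}"
  shows "(\<Union>K\<in>D. E K) division_of \<Union>(\<Union>K\<in>D. E K)"
    and "sum f (\<Union>K\<in>D. E K) = (\<Sum>K\<in>D. sum f (E K))"
proof -
  have fin: "finite D" "\<And>K. K \<in> D \<Longrightarrow> finite (E K)" using D E(1) by blast+
  have disj: "interior L1 \<inter> interior L2 = {}"
    if "K1 \<in> D" "K2 \<in> D" "K1 \<noteq> K2" "L1 \<in> E K1" "L2 \<in> E K2" for K1 K2 L1 L2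
  proof -
    have "interior L1 \<subseteq> interior K1" "interior L2 \<subseteq> interior K2"
      using E(2) that by (meson Sup_le_iff interior_mono)+
    with division_ofD(5)[OF D that(1-3)] show ?thesis by blast
  qed
  show "(\<Union>K\<in>D. E K) division_of \<Union>(\<Union>K\<in>D. E K)"
  proof (rule division_ofI)
    show "finite (\<Union>K\<in>D. E K)" using fin by blast
    fix L assume "L \<in> (\<Union>K\<in>D. E K)"
    then obtain K where "K \<in> D" "L \<in> E K" by blast
    then show "L \<noteq> {}" "\<exists>a b. L = cbox a b"
      using division_ofD(3,4)[OF E(1)] by blast+
    show "L \<subseteq> \<Union>(\<Union>K\<in>D. E K)" using \<open>L \<in> (\<Union>K\<in>D. E K)\<close> by blast
    fix L' assume "L' \<in> (\<Union>K\<in>D. E K)" "L \<noteq> L'"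
    then obtain K' where "K' \<in> D" "L' \<in> E K'" by blast
    show "interior L \<inter> interior L' = {}"
    proof (cases "K = K'")
      case True
      then show ?thesis
        using division_ofD(5)[OF E(1)[OF \<open>K \<in> D\<close>] \<open>L \<in> E K\<close>] \<open>L' \<in> E K'\<close> \<open>L \<noteq> L'\<close> by simp
    next
      case False
      show ?thesis by (rule disj[OF \<open>K \<in> D\<close> \<open>K' \<in> D\<close> False \<open>L \<in> E K\<close> \<open>L' \<in> E K'\<close>])
    qed
  qed simp
  show "sum f (\<Union>K\<in>D. E K) = (\<Sum>K\<in>D. sum f (E K))"
  proof (rule sum.UNION_disjoint)
    show "\<forall>i\<in>D. \<forall>j\<in>D. i \<noteq> j \<longrightarrow> E i \<inter> E j = {}"
      using disj ne by (metis disjoint_iff inf.idem)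
  qed (use fin in auto)
qed

text \<open>Monotone sequences with repetitions take the place of divisions because clipping such a
  sequence by \<open>min\<close> or \<open>max\<close> yields one again.\<close>

definition variation_sums :: "(real \<Rightarrow> 'a::real_normed_vector) \<Rightarrow> real \<Rightarrow> real \<Rightarrow> real set" where
  "variation_sums u a b =
     {\<Sum>i<n. norm (u (s (Suc i)) - u (s i)) | n s. mono (s::nat \<Rightarrow> real) \<and> range s \<subseteq> {a..b}}"

definition variation :: "(real \<Rightarrow> 'a::real_normed_vector) \<Rightarrow> real \<Rightarrow> real \<Rightarrow> real" where
  "variation u a b = Sup (variation_sums u a b)"

lemma variation_sums_zero: "a \<le> b \<Longrightarrow> 0 \<in> variation_sums u a b"
  unfolding variation_sums_def
  by (rule CollectI, rule exI[of _ 0], rule exI[of _ "\<lambda>_. a"]) (auto simp: mono_def)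

lemma variation_sums_append:
  assumes "v \<in> variation_sums u a b" "b \<le> c" "a \<le> b"
  obtains w where "w \<in> variation_sums u a c" "v + norm (u c - u b) \<le> w"
proof -
  obtain n and s :: "nat \<Rightarrow> real" where s: "mono s" "range s \<subseteq> {a..b}"
    and v: "v = (\<Sum>i<n. norm (u (s (Suc i)) - u (s i)))"
    using assms unfolding variation_sums_def by blast
  have sb: "a \<le> s i" "s i \<le> b" for i using s(2) by (force simp: image_subset_iff)+
  \<comment> \<open>The sequence may stop before \<open>b\<close>, so \<open>b\<close> and then
    \<open>c\<close> are appended; the step from \<open>s n\<close> to \<open>b\<close> only adds a
    nonnegative term.\<close>
  define r where "r i = (if i \<le> n then s i else if i = Suc n then b else c)" for i
  have "mono r" unfolding r_def mono_iff_le_Suc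
    using s(1) sb assms(2) by (auto simp: mono_iff_le_Suc le_Suc_eq)
  moreover have "range r \<subseteq> {a..c}" unfolding r_def using sb assms(2,3) by (auto intro: order_trans[OF sb(2)])
  ultimately have "(\<Sum>i<Suc (Suc n). norm (u (r (Suc i)) - u (r i))) \<in> variation_sums u a c"
    unfolding variation_sums_def by blast
  moreover have "(\<Sum>i<n. norm (u (r (Suc i)) - u (r i))) = v"
    unfolding v r_def by (intro sum.cong) auto
  then have "(\<Sum>i<Suc (Suc n). norm (u (r (Suc i)) - u (r i))) = v + norm (u b - u (s n)) + norm (u c - u b)"
    by (simp add: r_def)
  then have "v + norm (u c - u b) \<le> (\<Sum>i<Suc (Suc n). norm (u (r (Suc i)) - u (r i)))"
    by simp
  ultimately show thesis using that by blast
qed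

text \<open>Clip the sequence at \<open>b\<close> from above and from below. A step on one side of
  \<open>b\<close> survives in one clipped sequence and collapses in the other; a step across
  \<open>b\<close> is split there by the triangle inequality.\<close>

lemma variation_sums_split:
  assumes "w \<in> variation_sums u a c" "a \<le> b" "b \<le> c"
  obtains v v' where "v \<in> variation_sums u a b" "v' \<in> variation_sums u b c" "w \<le> v + v'"
proof -
  obtain n and s :: "nat \<Rightarrow> real" where s: "mono s" "range s \<subseteq> {a..c}"
    and w: "w = (\<Sum>i<n. norm (u (s (Suc i)) - u (s i)))"
    using assms unfolding variation_sums_def by blast
  define p where "p i = min (s i) b" for i
  define q where "q i = max (s i) b" for i
  have sb: "a \<le> s i" "s i \<le> c" for i using s(2) by (force simp: image_subset_iff)+
  have "mono p" "mono q" using s(1) unfolding p_def q_def by (auto intro!: monoI min.mono max.mono dest: monoD)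
  moreover have "range p \<subseteq> {a..b}" "range q \<subseteq> {b..c}"
    using sb assms by (auto simp: p_def q_def)
  ultimately have 1: "(\<Sum>i<n. norm (u (p (Suc i)) - u (p i))) \<in> variation_sums u a b"
    "(\<Sum>i<n. norm (u (q (Suc i)) - u (q i))) \<in> variation_sums u b c"
    unfolding variation_sums_def by blast+
  have "norm (u (s (Suc i)) - u (s i)) \<le>
      norm (u (p (Suc i)) - u (p i)) + norm (u (q (Suc i)) - u (q i))" for i
  proof -
    have "s i \<le> s (Suc i)" using s(1) by (simp add: mono_iff_le_Suc)
    then consider "s (Suc i) \<le> b" | "b \<le> s i" | "s i \<le> b" "b \<le> s (Suc i)" by linarith
    then show ?thesis
    proof cases
      case 3
      have "u (s (Suc i)) - u (s i) = (u b - u (s i)) + (u (s (Suc i)) - u b)" by simp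
      then have "norm (u (s (Suc i)) - u (s i)) \<le> norm (u b - u (s i)) + norm (u (s (Suc i)) - u b)"
        by (metis norm_triangle_ineq)
      with 3 show ?thesis by (simp add: p_def q_def min_absorb1 min_absorb2 max_absorb1 max_absorb2)
    qed (use \<open>s i \<le> s (Suc i)\<close> in \<open>auto simp: p_def q_def\<close>)
  qed
  then have "w \<le> (\<Sum>i<n. norm (u (p (Suc i)) - u (p i))) + (\<Sum>i<n. norm (u (q (Suc i)) - u (q i)))"
    unfolding w by (simp flip: sum.distrib add: sum_mono)
  with 1 show thesis using that by blast
qed

text \<open>Subdividing the members of \<open>D\<close> does not increase the total length, so the
  same \<open>d\<close> controls every refinement. Increments may thus be replaced by arbitrary
  variation sums, which is what passes to the supremum.\<close>

lemma abs_continuous_on_variation_sums: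
  assumes ac: "abs_continuous_on a b u" and "0 < e"
  obtains d where "0 < d" "\<And>D v. D division_of \<Union>D \<Longrightarrow> \<Union>D \<subseteq> {a..b} \<Longrightarrow>
      (\<Sum>K\<in>D. Sup K - Inf K) < d \<Longrightarrow>
      (\<And>K. K \<in> D \<Longrightarrow> v K \<in> variation_sums u (Inf K) (Sup K)) \<Longrightarrow> (\<Sum>K\<in>D. v K) < e"
proof -
  obtain d where d: "0 < d" and D: "\<And>D. D division_of \<Union>D \<Longrightarrow> \<Union>D \<subseteq> {a..b} \<Longrightarrow>
     (\<Sum>K\<in>D. Sup K - Inf K) < d \<Longrightarrow> (\<Sum>K\<in>D. norm (u (Sup K) - u (Inf K))) < e"
    using ac[unfolded abs_continuous_on_def, rule_format, OF \<open>0 < e\<close>] by blast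
  show thesis
  proof (rule that[OF d])
    fix D :: "real set set" and v
    assume div: "D division_of \<Union>D" "\<Union>D \<subseteq> {a..b}" "(\<Sum>K\<in>D. Sup K - Inf K) < d"
      and v: "\<And>K. K \<in> D \<Longrightarrow> v K \<in> variation_sums u (Inf K) (Sup K)"
    have ex: "\<exists>E. E division_of \<Union>E \<and> \<Union>E \<subseteq> K \<and> (\<forall>L\<in>E. interior L \<noteq> {}) \<and>
       (\<Sum>L\<in>E. Sup L - Inf L) \<le> Sup K - Inf K \<and> (\<Sum>L\<in>E. norm (u (Sup L) - u (Inf L))) = v K"
      if K: "K \<in> D" for K
    proof -
      obtain n and s :: "nat \<Rightarrow> real" where s: "mono s" "range s \<subseteq> {Inf K..Sup K}"
        and vK: "v K = (\<Sum>i<n. norm (u (s (Suc i)) - u (s i)))"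
        using v[OF K] unfolding variation_sums_def by blast
      have sb: "Inf K \<le> s i" "s i \<le> Sup K" for i using s(2) by (force simp: image_subset_iff)+
      obtain E where E: "E division_of \<Union>E" "\<Union>E \<subseteq> {s 0..s n}" "\<forall>K\<in>E. interior K \<noteq> {}"
        and h: "\<And>h::real \<Rightarrow> real \<Rightarrow> real. (\<forall>x. h x x = 0) \<Longrightarrow>
           (\<Sum>K\<in>E. h (Inf K) (Sup K)) = (\<Sum>i<n. h (s i) (s (Suc i)))"
        using mono_sequence_division[OF s(1), of n] by blast
      have "\<Union>E \<subseteq> K"
        using E(2) sb division_of_real_interval(2)[OF div(1) K]
        by (metis atLeastatMost_subset_iff order_trans)
      moreover have "(\<Sum>L\<in>E. Sup L - Inf L) \<le> Sup K - Inf K"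
        using h[of "\<lambda>x y. y - x"] sb[of n] sb[of 0] by (simp add: sum_lessThan_telescope)
      ultimately show ?thesis
        using E h[of "\<lambda>x y. norm (u y - u x)"] vK by auto
    qed
    obtain E where E0: "\<forall>K\<in>D. E K division_of \<Union>(E K) \<and> \<Union>(E K) \<subseteq> K \<and> (\<forall>L\<in>E K. interior L \<noteq> {}) \<and>
        (\<Sum>L\<in>E K. Sup L - Inf L) \<le> Sup K - Inf K \<and> (\<Sum>L\<in>E K. norm (u (Sup L) - u (Inf L))) = v K"
      using bchoice[OF ballI[OF ex]] by (rule exE)
    have E: "E K division_of \<Union>(E K)" "\<Union>(E K) \<subseteq> K" "L \<in> E K \<Longrightarrow> interior L \<noteq> {}"
      "(\<Sum>L\<in>E K. Sup L - Inf L) \<le> Sup K - Inf K"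
      "(\<Sum>L\<in>E K. norm (u (Sup L) - u (Inf L))) = v K" if "K \<in> D" for K L
      using bspec[OF E0 that] by simp_all
    note R = division_of_refinement[of D E, OF div(1) E(1-3)]
    have "(\<Sum>K\<in>D. \<Sum>L\<in>E K. Sup L - Inf L) \<le> (\<Sum>K\<in>D. Sup K - Inf K)"
      by (rule sum_mono) (rule E(4))
    then have len: "(\<Sum>L\<in>(\<Union>K\<in>D. E K). Sup L - Inf L) < d"
      using R(2)[where f="\<lambda>L. Sup L - Inf L"] div(3) by simp
    have sub: "\<Union>(\<Union>K\<in>D. E K) \<subseteq> {a..b}"
    proof
      fix x assume "x \<in> \<Union>(\<Union>K\<in>D. E K)"
      then obtain K where "K \<in> D" "x \<in> \<Union>(E K)" by auto
      have "x \<in> K" by (rule subsetD[OF E(2)[OF \<open>K \<in> D\<close>] \<open>x \<in> \<Union>(E K)\<close>])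
      then show "x \<in> {a..b}" using \<open>K \<in> D\<close> div(2) by (meson UnionI subsetD)
    qed
    have "(\<Sum>L\<in>(\<Union>K\<in>D. E K). norm (u (Sup L) - u (Inf L))) < e"
      by (rule D[OF R(1) sub len])
    then show "(\<Sum>K\<in>D. v K) < e" using R(2)[where f="\<lambda>L. norm (u (Sup L) - u (Inf L))"] E(5) by simp
  qed
qed

text \<open>On an interval shorter than \<open>d\<close> all variation sums stay below 1; finitely
  many steps of length \<open>d / 2\<close> reach \<open>x\<close>, and each raises the bound by at
  most 1.\<close>

lemma abs_continuous_on_variation_bounded:
  assumes ac: "abs_continuous_on a b u" and "a \<le> x" "x \<le> b"
  shows "bdd_above (variation_sums u a x)"
proof -
  obtain d where "0 < d" and D: "\<And>D v. D division_of \<Union>D \<Longrightarrow> \<Union>D \<subseteq> {a..b} \<Longrightarrow>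
      (\<Sum>K\<in>D. Sup K - Inf K) < d \<Longrightarrow>
      (\<And>K. K \<in> D \<Longrightarrow> v K \<in> variation_sums u (Inf K) (Sup K)) \<Longrightarrow> (\<Sum>K\<in>D. v K) < (1::real)"
    using abs_continuous_on_variation_sums[OF ac zero_less_one] by blast
  have small: "v < 1" if "v \<in> variation_sums u y z" "a \<le> y" "y \<le> z" "z \<le> b" "z - y < d" for v y z
    using D[of "{{y..z}}" "\<lambda>_. v"] division_of_self[of y z] that by auto
  have bdd: "bdd_above (variation_sums u a (min x (a + real k * (d / 2))))" (is "bdd_above (variation_sums u a (?y k))") for k
  proof (induction k)
    case 0
    have "v < 1" if "v \<in> variation_sums u a a" for v
      using small[OF that] assms(2,3) \<open>0 < d\<close> by simp
    with assms(2) show ?case by (auto intro!: bdd_aboveI[of _ 1] simp: less_imp_le)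
  next
    case (Suc k)
    then obtain B where B: "\<And>v. v \<in> variation_sums u a (?y k) \<Longrightarrow> v \<le> B" by (auto simp: bdd_above_def)
    have y: "a \<le> ?y k" "?y k \<le> ?y (Suc k)" "?y (Suc k) \<le> b" "?y (Suc k) - ?y k < d"
    proof -
      define t where "t = a + real k * (d / 2)"
      have t: "a + real (Suc k) * (d / 2) = t + d / 2" by (simp add: t_def distrib_right)
      have "a \<le> t" unfolding t_def using \<open>0 < d\<close> by simp
      then show "a \<le> ?y k" "?y k \<le> ?y (Suc k)" "?y (Suc k) \<le> b" "?y (Suc k) - ?y k < d"
        using assms(2,3) \<open>0 < d\<close> unfolding t unfolding t_def[symmetric] min_def by auto
    qed
    have "w \<le> B + 1" if w: "w \<in> variation_sums u a (?y (Suc k))" for w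
    proof -
      obtain v v' where "v \<in> variation_sums u a (?y k)" "v' \<in> variation_sums u (?y k) (?y (Suc k))" "w \<le> v + v'"
        using variation_sums_split[OF w y(1,2)] .
      with B small[of v' "?y k" "?y (Suc k)"] y show ?thesis by fastforce
    qed
    then show ?case by (rule bdd_aboveI)
  qed
  obtain k :: nat where "(x - a) / (d / 2) \<le> real k" using real_arch_simple by blast
  then have "x \<le> a + real k * (d / 2)" using \<open>0 < d\<close> by (simp add: field_simps)
  then show ?thesis using bdd[of k] by (simp only: min_absorb1)
qed

text \<open>The variation is the increasing function that dominates the increments of
  \<open>u\<close>. It inherits absolute continuity because its increment over an interval is
  approximated by variation sums over that same interval.\<close>

lemma abs_continuous_on_variation:
  fixes u :: "real \<Rightarrow> 'a::real_normed_vector"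
  assumes ac: "abs_continuous_on a b u"
  shows "\<And>x y. a \<le> x \<Longrightarrow> x \<le> y \<Longrightarrow> y \<le> b \<Longrightarrow> norm (u y - u x) \<le> variation u a y - variation u a x"
    and "abs_continuous_on a b (variation u a)"
proof -
  note bdd = abs_continuous_on_variation_bounded[OF ac]
  show le: "norm (u y - u x) \<le> variation u a y - variation u a x"
    if xy: "a \<le> x" "x \<le> y" "y \<le> b" for x y
  proof -
    have "variation u a x \<le> variation u a y - norm (u y - u x)"
      unfolding variation_def[of u a x]
    proof (rule cSup_least)
      show "variation_sums u a x \<noteq> {}" using variation_sums_zero xy by blast
      fix v assume "v \<in> variation_sums u a x"
      then obtain w where w: "w \<in> variation_sums u a y" "v + norm (u y - u x) \<le> w"
        using variation_sums_append[OF _ xy(2,1)] by blast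
      have "w \<le> variation u a y"
        unfolding variation_def using w bdd[of y] xy by (intro cSup_upper) auto
      with w show "v \<le> variation u a y - norm (u y - u x)" by simp
    qed
    then show ?thesis by simp
  qed
  show "abs_continuous_on a b (variation u a)"
    unfolding abs_continuous_on_def
  proof (intro allI impI)
    fix e :: real assume "0 < e"
    then have "0 < e / 2" by simp
    from abs_continuous_on_variation_sums[OF ac this]
    obtain d where d: "0 < d" and D: "\<And>D v. D division_of \<Union>D \<Longrightarrow> \<Union>D \<subseteq> {a..b} \<Longrightarrow>
      (\<Sum>K\<in>D. Sup K - Inf K) < d \<Longrightarrow>
      (\<And>K. K \<in> D \<Longrightarrow> v K \<in> variation_sums u (Inf K) (Sup K)) \<Longrightarrow> (\<Sum>K\<in>D. v K) < e / 2" by blast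
    show "\<exists>d>0. \<forall>D. D division_of \<Union> D \<longrightarrow> \<Union> D \<subseteq> {a..b} \<longrightarrow> (\<Sum>K\<in>D. Sup K - Inf K) < d \<longrightarrow>
        (\<Sum>K\<in>D. norm (variation u a (Sup K) - variation u a (Inf K))) < e"
    proof (intro exI[of _ d] conjI d allI impI)
      fix D :: "real set set"
      assume div: "D division_of \<Union> D" "\<Union> D \<subseteq> {a..b}" "(\<Sum>K\<in>D. Sup K - Inf K) < d"
      \<comment> \<open>The error of approximating a supremum is distributed evenly over the members
        of \<open>D\<close>, within a total of \<open>e / 2\<close>; the \<open>+ 1\<close> covers
        the empty \<open>D\<close>.\<close>
      define \<eta> where "\<eta> = e / 2 / (real (card D) + 1)"
      have "\<eta> > 0" unfolding \<eta>_def using \<open>0 < e\<close> by (simp add: add_nonneg_pos)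
      have IS: "a \<le> Inf K" "Inf K \<le> Sup K" "Sup K \<le> b" if "K \<in> D" for K
      proof -
        have "{Inf K..Sup K} \<subseteq> {a..b}"
          using div(2) that division_of_real_interval(2)[OF div(1) that] by auto
        then show "a \<le> Inf K" "Inf K \<le> Sup K" "Sup K \<le> b"
          using division_of_real_interval(1)[OF div(1) that] by auto
      qed
      have "\<exists>v. v \<in> variation_sums u (Inf K) (Sup K) \<and>
          norm (variation u a (Sup K) - variation u a (Inf K)) \<le> v + \<eta>" if K: "K \<in> D" for K
      proof -
        have "0 \<le> variation u a (Sup K) - variation u a (Inf K)"
          using le[OF IS[OF K]] norm_ge_zero order_trans by blast
        have "variation u a (Sup K) - \<eta> < variation u a (Sup K)" using \<open>\<eta> > 0\<close> by simp
        then obtain w where w: "w \<in> variation_sums u a (Sup K)" "variation u a (Sup K) - \<eta> < w"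
          unfolding variation_def
          using less_cSupD[of "variation_sums u a (Sup K)"] variation_sums_zero IS[OF K]
          by (metis empty_iff order_trans)
        obtain v v' where v: "v \<in> variation_sums u a (Inf K)" "v' \<in> variation_sums u (Inf K) (Sup K)" "w \<le> v + v'"
          using variation_sums_split[OF w(1) IS(1,2)[OF K]] .
        have "v \<le> variation u a (Inf K)"
          unfolding variation_def using v bdd[of "Inf K"] IS[OF K] by (intro cSup_upper) auto
        with v w \<open>0 \<le> _ - _\<close> show ?thesis by (intro exI[of _ v']) auto
      qed
      then obtain v where v: "\<And>K. K \<in> D \<Longrightarrow> v K \<in> variation_sums u (Inf K) (Sup K)"
         "\<And>K. K \<in> D \<Longrightarrow> norm (variation u a (Sup K) - variation u a (Inf K)) \<le> v K + \<eta>" by metis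
      have "(\<Sum>K\<in>D. norm (variation u a (Sup K) - variation u a (Inf K))) \<le> (\<Sum>K\<in>D. v K + \<eta>)"
        using v(2) by (rule sum_mono)
      also have "\<dots> = (\<Sum>K\<in>D. v K) + real (card D) * \<eta>" by (simp add: sum.distrib)
      also have "(\<Sum>K\<in>D. v K) < e / 2" using D[OF div v(1)] .
      also have "real (card D) * \<eta> \<le> e / 2"
        unfolding \<eta>_def using \<open>0 < e\<close> by (simp add: field_simps)
      finally show "(\<Sum>K\<in>D. norm (variation u a (Sup K) - variation u a (Inf K))) < e" by simp
    qed
  qed
qed

text \<open>Meant for \<open>w\<close> the variation of \<open>u\<close> minus a coordinate of
  \<open>u\<close>, with \<open>v\<close> the variation itself.\<close>

lemma abs_continuous_on_dominated:
  assumes u: "abs_continuous_on a b u" and v: "abs_continuous_on a b v"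
    and le: "\<And>x y. a \<le> x \<Longrightarrow> x \<le> y \<Longrightarrow> y \<le> b \<Longrightarrow> norm (w y - w x) \<le> norm (u y - u x) + norm (v y - v x)"
  shows "abs_continuous_on a b w"
  unfolding abs_continuous_on_def
proof (intro allI impI)
  fix e :: real assume "0 < e"
  then have "0 < e / 2" by simp
  obtain d1 where d1: "0 < d1" "\<forall>D. D division_of \<Union> D \<longrightarrow> \<Union> D \<subseteq> {a..b} \<longrightarrow> (\<Sum>K\<in>D. Sup K - Inf K) < d1 \<longrightarrow>
      (\<Sum>K\<in>D. norm (u (Sup K) - u (Inf K))) < e / 2"
    using u[unfolded abs_continuous_on_def, rule_format, OF \<open>0 < e / 2\<close>] by blast
  obtain d2 where d2: "0 < d2" "\<forall>D. D division_of \<Union> D \<longrightarrow> \<Union> D \<subseteq> {a..b} \<longrightarrow> (\<Sum>K\<in>D. Sup K - Inf K) < d2 \<longrightarrow>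
      (\<Sum>K\<in>D. norm (v (Sup K) - v (Inf K))) < e / 2"
    using v[unfolded abs_continuous_on_def, rule_format, OF \<open>0 < e / 2\<close>] by blast
  show "\<exists>d>0. \<forall>D. D division_of \<Union> D \<longrightarrow> \<Union> D \<subseteq> {a..b} \<longrightarrow> (\<Sum>K\<in>D. Sup K - Inf K) < d \<longrightarrow>
      (\<Sum>K\<in>D. norm (w (Sup K) - w (Inf K))) < e"
  proof (intro exI[of _ "min d1 d2"] conjI allI impI)
    fix D :: "real set set"
    assume D: "D division_of \<Union> D" "\<Union> D \<subseteq> {a..b}" "(\<Sum>K\<in>D. Sup K - Inf K) < min d1 d2"
    have "(\<Sum>K\<in>D. norm (w (Sup K) - w (Inf K))) \<le>
        (\<Sum>K\<in>D. norm (u (Sup K) - u (Inf K)) + norm (v (Sup K) - v (Inf K)))"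
    proof (rule sum_mono)
      fix K assume "K \<in> D"
      note K = division_of_real_interval[OF D(1) \<open>K \<in> D\<close>]
      have "{Inf K..Sup K} \<subseteq> {a..b}" using D(2) \<open>K \<in> D\<close> K(2) by auto
      with K(1) show "norm (w (Sup K) - w (Inf K)) \<le> norm (u (Sup K) - u (Inf K)) + norm (v (Sup K) - v (Inf K))"
        by (intro le) auto
    qed
    also have "\<dots> < e / 2 + e / 2"
      using d1(2)[rule_format, OF D(1,2)] d2(2)[rule_format, OF D(1,2)] D(3)
      by (simp add: sum.distrib)
    finally show "(\<Sum>K\<in>D. norm (w (Sup K) - w (Inf K))) < e" by simp
  qed (use d1 d2 in simp)
qed

lemma abs_continuous_on_imp_continuous_on:
  assumes "abs_continuous_on a b u"
  shows "continuous_on {a..b} u"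
  unfolding continuous_on_iff
proof (intro ballI allI impI)
  fix x e :: real assume x: "x \<in> {a..b}" and "0 < e"
  obtain d where d: "0 < d" and D: "\<And>D. D division_of \<Union> D \<Longrightarrow> \<Union> D \<subseteq> {a..b} \<Longrightarrow> (\<Sum>K\<in>D. Sup K - Inf K) < d \<Longrightarrow>
      (\<Sum>K\<in>D. norm (u (Sup K) - u (Inf K))) < e"
    using assms[unfolded abs_continuous_on_def, rule_format, OF \<open>0 < e\<close>] by blast
  have "dist (u y) (u x) < e" if y: "y \<in> {a..b}" "dist y x < d" for y
  proof -
    have "{{min x y..max x y}} division_of {min x y..max x y}"
      using division_of_self[of "min x y" "max x y"] by simp
    then have "norm (u (max x y) - u (min x y)) < e"
      using D[of "{{min x y..max x y}}"] x y by (auto simp: dist_real_def abs_if split: if_splits)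
    then show ?thesis by (auto simp: dist_norm max_def min_def norm_minus_commute split: if_splits)
  qed
  with d show "\<exists>d>0. \<forall>x'\<in>{a..b}. dist x' x < d \<longrightarrow> dist (u x') (u x) < e" by blast
qed

section \<open>Densities of absolutely continuous functions\<close>

lemma sum_length_division:
  fixes p :: "real set set"
  assumes "p division_of \<Union>p"
  shows "emeasure lborel (\<Union>p) = ennreal (\<Sum>K\<in>p. Sup K - Inf K)"
proof -
  have fin: "finite p" using assms by auto
  have "((\<lambda>x. 1::real) has_integral (\<Sum>K\<in>p. Sup K - Inf K)) (\<Union>p)"
  proof (rule has_integral_combine_division[OF assms])
    fix K assume "K \<in> p"
    note K = division_of_real_interval[OF assms this]
    have "((\<lambda>x. 1::real) has_integral Sup K - Inf K) {Inf K..Sup K}"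
      using has_integral_const_real[of "1::real" "Inf K" "Sup K"] K(1) by (simp del: has_integral_const_real)
    then show "((\<lambda>x. 1::real) has_integral Sup K - Inf K) K"
      by (simp only: K(2)[symmetric])
  qed
  moreover have "\<Union>p \<in> sets borel"
  proof (rule sets.countable_Union)
    show "countable p" using fin by (rule countable_finite)
    show "p \<subseteq> sets borel"
    proof
      fix K assume "K \<in> p"
      show "K \<in> sets borel"
        by (subst division_of_real_interval(2)[OF assms \<open>K \<in> p\<close>]) simp
    qed
  qed
  moreover have "0 \<le> (\<Sum>K\<in>p. Sup K - Inf K)"
    using division_of_real_interval(1)[OF assms] by (intro sum_nonneg) simp
  ultimately show ?thesis using has_integral_iff_emeasure_lborel by blast
qed

text \<open>\<open>f\<close> is the Radon-Nikodym derivative of the Stieltjes measure of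
  \<open>F\<close>. For absolute continuity of that measure, a Lebesgue null set is enclosed in an
  open set of length below \<open>d\<close>; finite unions of boxes inside it split into
  non-overlapping intervals, to which the hypothesis on \<open>F\<close> applies.\<close>

lemma mono_abs_continuous_density:
  fixes F :: "real \<Rightarrow> real"
  assumes ab: "a \<le> b" and mono: "\<And>x y. a \<le> x \<Longrightarrow> x \<le> y \<Longrightarrow> y \<le> b \<Longrightarrow> F x \<le> F y"
    and ac: "abs_continuous_on a b F"
  obtains f where "\<And>x. a \<le> x \<Longrightarrow> x \<le> b \<Longrightarrow> (f has_integral (F x - F a)) {a..x}"
proof -
  \<comment> \<open>Freezing \<open>F\<close> outside \<open>{a..b}\<close> gives a continuous
    increasing function on the whole line, from which the Stieltjes measure is formed.\<close>
  define H where "H x = F (max a (min b x))" for x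
  have H: "H x = F x" if "a \<le> x" "x \<le> b" for x using that by (simp add: H_def)
  have contH: "continuous_on UNIV H"
    unfolding H_def
    by (rule continuous_on_compose2[OF abs_continuous_on_imp_continuous_on[OF ac]])
       (use ab in \<open>auto intro!: continuous_intros\<close>)
  have monoH: "H x \<le> H y" if "x \<le> y" for x y
    unfolding H_def by (rule mono) (use ab that in auto)
  define M where "M = interval_measure H"
  have setsM [simp, measurable_cong]: "sets M = sets borel" by (simp add: M_def)
  have M: "emeasure M {x..y} = ennreal (H y - H x)" if "x \<le> y" for x y
    unfolding M_def by (rule emeasure_interval_measure_Icc[OF that monoH contH])
  \<comment> \<open>Restricting the measure to the open interval allows an enclosing open set to be
    cut down to a subset of \<open>{a..b}\<close> that is still open; the endpoints carry no mass
    since \<open>H\<close> is continuous.\<close>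
  define S where "S = {a<..<b}"
  have S: "S \<in> sets borel" by (simp add: S_def)
  define N where "N = density M (indicator S)"
  have N: "emeasure N B = emeasure M (S \<inter> B)" if "B \<in> sets borel" for B
    unfolding N_def by (rule emeasure_restricted) (use that S in auto)
  have setsN: "sets N = sets lborel" by (simp add: N_def)
  have "absolutely_continuous lborel N"
    unfolding absolutely_continuous_def
  proof
    fix B :: "real set" assume "B \<in> null_sets lborel"
    then have B: "B \<in> sets borel" "emeasure lborel B = 0" by auto
    define B' where "B' = S \<inter> B"
    have B': "B' \<in> sets borel" using B S by (simp add: B'_def)
    have nullB': "emeasure lborel B' = 0"
      using emeasure_mono[of B' B lborel] B B' by (auto simp: B'_def)
    have eps: "emeasure M B' \<le> 0 + ennreal e" if "0 < e" for e
    proof -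
      obtain d where d: "0 < d" and D: "\<And>D. D division_of \<Union> D \<Longrightarrow> \<Union> D \<subseteq> {a..b} \<Longrightarrow>
          (\<Sum>K\<in>D. Sup K - Inf K) < d \<Longrightarrow> (\<Sum>K\<in>D. norm (F (Sup K) - F (Inf K))) < e"
        using ac[unfolded abs_continuous_on_def, rule_format, OF \<open>0 < e\<close>] by blast
      obtain T where T: "open T" "B' \<subseteq> T" "T - B' \<in> lmeasurable" "emeasure lebesgue (T - B') < ennreal d"
        using sets_lebesgue_outer_open[of B' d] B' d by auto
      define U where "U = T \<inter> S"
      have "open U" using T by (simp add: U_def S_def open_Int)
      have "B' \<subseteq> U" using T by (auto simp: U_def B'_def)
      have [measurable]: "T \<in> sets borel" "U \<in> sets borel" using T \<open>open U\<close> by auto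
      have "emeasure lborel U \<le> emeasure lborel ((T - B') \<union> B')"
        using T B' by (intro emeasure_mono) (auto simp: U_def)
      also have "\<dots> \<le> emeasure lborel (T - B') + emeasure lborel B'"
        using T B' by (intro emeasure_subadditive) auto
      also have "\<dots> < ennreal d"
        using T B' nullB' by (simp add: emeasure_completion)
      finally have Ud: "emeasure lborel U < ennreal d" .
      obtain \<D> where \<D>: "countable \<D>" "\<D> \<subseteq> Pow U" "\<And>X. X \<in> \<D> \<Longrightarrow> \<exists>a b. X = cbox a b" "\<Union>\<D> = U"
        using open_countable_Union_open_cbox[OF \<open>open U\<close>] by metis
      have fin: "emeasure M (\<Union>\<E>) \<le> ennreal e" if E: "finite \<E>" "\<E> \<subseteq> \<D>" for \<E>
      proof -
        obtain p where p0: "p division_of \<Union>\<E>"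
          using elementary_unions_intervals[OF E(1)] \<D>(3) E(2) by (metis subsetD)
        then have eq: "\<Union>p = \<Union>\<E>" by (rule division_ofD(6))
        then have p: "p division_of \<Union>p" using p0 by simp
        have pU: "\<Union>p \<subseteq> U" unfolding eq using E(2) \<D>(4) by auto
        then have pab: "\<Union>p \<subseteq> {a..b}" by (auto simp: U_def S_def)
        have "ennreal (\<Sum>K\<in>p. Sup K - Inf K) < ennreal d"
          unfolding sum_length_division[OF p, symmetric]
          using emeasure_mono[OF pU, of lborel] Ud by auto
        then have "(\<Sum>K\<in>p. Sup K - Inf K) < d" by (metis ennreal_leI not_le)
        then have small: "(\<Sum>K\<in>p. norm (F (Sup K) - F (Inf K))) < e" by (rule D[OF p pab])
        have K: "K \<in> sets borel \<and> emeasure M K = ennreal (norm (F (Sup K) - F (Inf K)))" if "K \<in> p" for K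
        proof -
          note K = division_of_real_interval[OF p that]
          have "{Inf K..Sup K} \<subseteq> {a..b}" using pab that K(2) by auto
          then have *: "a \<le> Inf K" "Sup K \<le> b" using K(1) by auto
          have "emeasure M K = ennreal (H (Sup K) - H (Inf K))"
            using M[OF K(1)] K(2) by simp
          also have "H (Sup K) - H (Inf K) = norm (F (Sup K) - F (Inf K))"
            using * K(1) mono[of "Inf K" "Sup K"] by (simp add: H)
          finally show ?thesis using K(2) by (metis atLeastAtMost_borel)
        qed
        have "emeasure M (\<Union>p) = emeasure M (\<Union>K\<in>p. K)" by simp
        also have "\<dots> \<le> (\<Sum>K\<in>p. emeasure M K)"
          using p K by (intro emeasure_subadditive_finite) auto
        also have "\<dots> = (\<Sum>K\<in>p. ennreal (norm (F (Sup K) - F (Inf K))))"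
          using K by (intro sum.cong) auto
        also have "\<dots> = ennreal (\<Sum>K\<in>p. norm (F (Sup K) - F (Inf K)))"
          by (rule sum_ennreal) simp
        also have "\<dots> \<le> ennreal e" using small by (intro ennreal_leI) simp
        finally show ?thesis unfolding eq .
      qed
      have "emeasure M U \<le> ennreal e"
      proof (cases "\<D> = {}")
        case True
        then show ?thesis using \<D>(4) by simp
      next
        case False
        define c where "c = from_nat_into \<D>"
        have c: "c n \<in> \<D>" for n unfolding c_def by (rule from_nat_into[OF False])
        have Uc: "U = (\<Union>n. \<Union>(c ` {..n}))"
        proof -
          have "U = \<Union>(range c)"
            using range_from_nat_into[OF False \<D>(1)] \<D>(4) by (simp add: c_def)
          also have "\<dots> = (\<Union>n. \<Union>(c ` {..n}))"
          proof (intro equalityI subsetI)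
            fix x assume "x \<in> \<Union>(range c)"
            then obtain i where "x \<in> c i" by auto
            then have "x \<in> \<Union>(c ` {..i})" by auto
            then show "x \<in> (\<Union>n. \<Union>(c ` {..n}))" by (rule UN_I[OF UNIV_I])
          qed auto
          finally show ?thesis .
        qed
        have "emeasure M (\<Union>n. \<Union>(c ` {..n})) = (SUP n. emeasure M (\<Union>(c ` {..n})))"
        proof (rule SUP_emeasure_incseq[symmetric])
          have "c n \<in> sets borel" for n using \<D>(3)[OF c, of n] by auto
          then show "range (\<lambda>n. \<Union> (c ` {..n})) \<subseteq> sets M" by auto
          show "incseq (\<lambda>n. \<Union> (c ` {..n}))" by (intro monoI Union_mono image_mono) auto
        qed
        also have "\<dots> \<le> ennreal e"
          using c by (intro SUP_least fin) auto
        finally show ?thesis using Uc by simp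
      qed
      moreover have "emeasure M B' \<le> emeasure M U"
        using \<open>B' \<subseteq> U\<close> by (intro emeasure_mono) auto
      ultimately show ?thesis by simp
    qed
    have "emeasure M B' \<le> 0" by (rule ennreal_le_epsilon) (rule eps)
    then have "emeasure N B = 0" using N[OF B(1)] by (simp add: B'_def)
    then show "B \<in> null_sets N" using B(1) setsN by auto
  qed
  then obtain f where f: "f \<in> borel_measurable lborel" "density lborel f = N"
    using sigma_finite_measure.Radon_Nikodym[OF sigma_finite_lborel _ setsN] by blast
  have [measurable]: "f \<in> borel_measurable borel" using f(1) by simp
  have Nab: "emeasure N {a..x} = ennreal (F x - F a)" if "a \<le> x" "x \<le> b" for x
  proof -
    have pt: "emeasure M {y} = 0" for y using M[of y y] by simp
    have "emeasure N {a..x} = emeasure M (S \<inter> {a..x})" by (rule N) simp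
    also have "\<dots> = emeasure M {a..x}"
    proof (rule antisym)
      have "emeasure M {a..x} \<le> emeasure M ((S \<inter> {a..x}) \<union> {a} \<union> {b})"
        using S that by (intro emeasure_mono) (auto simp: S_def)
      also have "\<dots> \<le> emeasure M (S \<inter> {a..x}) + emeasure M {a} + emeasure M {b}"
        using S by (intro order_trans[OF emeasure_subadditive] add_right_mono emeasure_subadditive) auto
      finally show "emeasure M {a..x} \<le> emeasure M (S \<inter> {a..x})" by (simp add: pt)
    qed (use S in \<open>auto intro!: emeasure_mono\<close>)
    finally show ?thesis using M[of a x] that H[of x] H[of a] ab by simp
  qed
  have int: "(\<integral>\<^sup>+y. f y * indicator {a..x} y \<partial>lborel) = ennreal (F x - F a)" if "a \<le> x" "x \<le> b" for x
    using Nab[OF that] f(1) unfolding f(2)[symmetric] by (simp add: emeasure_density)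
  have "AE y in lborel. f y * indicator {a..b} y \<noteq> \<infinity>"
    by (rule nn_integral_noteq_infinite) (use int[of b] ab in auto)
  then have fin: "AE y in lborel. y \<in> {a..b} \<longrightarrow> f y < top"
    by eventually_elim (auto simp: less_top)
  show thesis
  proof (rule that[of "\<lambda>y. enn2real (f y)"])
    fix x assume x: "a \<le> x" "x \<le> b"
    have "(\<integral>\<^sup>+y. ennreal (enn2real (f y) * indicator {a..x} y) \<partial>lborel) = (\<integral>\<^sup>+y. f y * indicator {a..x} y \<partial>lborel)"
      by (rule nn_integral_cong_AE, use fin in eventually_elim) (use x in \<open>auto simp: indicator_def\<close>)
    then have "((\<lambda>y. enn2real (f y) * indicator {a..x} y) has_integral (F x - F a)) UNIV"
      using int[OF x] mono[of a x] x by (intro nn_integral_has_integral) auto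
    then have "((\<lambda>y. if y \<in> {a..x} then enn2real (f y) else 0) has_integral (F x - F a)) UNIV"
      by (rule has_integral_eq[rotated]) (auto simp: indicator_def)
    then show "((\<lambda>y. enn2real (f y)) has_integral (F x - F a)) {a..x}"
      by (simp only: has_integral_restrict_UNIV)
  qed
qed

text \<open>Each coordinate of \<open>u\<close> is the difference of \<open>V\<close> and
  \<open>V\<close> minus that coordinate. Both are increasing, since the increments of
  \<open>V\<close> dominate those of \<open>u\<close>, and both are absolutely continuous.\<close>

lemma abs_continuous_on_density:
  fixes u :: "real \<Rightarrow> 'a::euclidean_space"
  assumes ab: "a \<le> b" and ac: "abs_continuous_on a b u"
  obtains g where "\<And>x. a \<le> x \<Longrightarrow> x \<le> b \<Longrightarrow> (g has_integral (u x - u a)) {a..x}"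
proof -
  define V where "V = variation u a"
  note V = abs_continuous_on_variation[OF ac, folded V_def]
  have Vmono: "V x \<le> V y" if "a \<le> x" "x \<le> y" "y \<le> b" for x y
    using V(1)[OF that] norm_ge_zero[of "u y - u x"] by linarith
  obtain f where f: "\<And>x. a \<le> x \<Longrightarrow> x \<le> b \<Longrightarrow> (f has_integral (V x - V a)) {a..x}"
    using mono_abs_continuous_density[OF ab Vmono V(2)] by blast
  have ex: "\<exists>h. \<forall>x. a \<le> x \<longrightarrow> x \<le> b \<longrightarrow> (h has_integral (u x - u a) \<bullet> i) {a..x}" if i: "i \<in> Basis" for i
  proof -
    have comp: "\<bar>u y \<bullet> i - u x \<bullet> i\<bar> \<le> norm (u y - u x)" for x y
      using Basis_le_norm[OF i, of "u y - u x"] by (simp add: inner_diff_left)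
    have mono: "V x - u x \<bullet> i \<le> V y - u y \<bullet> i" if "a \<le> x" "x \<le> y" "y \<le> b" for x y
      using V(1)[OF that] comp[of y x] by linarith
    have ac': "abs_continuous_on a b (\<lambda>x. V x - u x \<bullet> i)"
    proof (rule abs_continuous_on_dominated[OF ac V(2)])
      fix x y
      show "norm (V y - u y \<bullet> i - (V x - u x \<bullet> i)) \<le> norm (u y - u x) + norm (V y - V x)"
        using comp[of y x] by simp
    qed
    obtain f' where f': "\<And>x. a \<le> x \<Longrightarrow> x \<le> b \<Longrightarrow> (f' has_integral (V x - u x \<bullet> i - (V a - u a \<bullet> i))) {a..x}"
      using mono_abs_continuous_density[OF ab mono ac'] by blast
    show ?thesis
    proof (intro exI[of _ "\<lambda>x. f x - f' x"] allI impI)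
      fix x assume "a \<le> x" "x \<le> b"
      from has_integral_diff[OF f[OF this] f'[OF this]]
      show "((\<lambda>x. f x - f' x) has_integral (u x - u a) \<bullet> i) {a..x}" by (simp add: inner_diff_left)
    qed
  qed
  obtain H where H0: "\<forall>i\<in>Basis. \<forall>x. a \<le> x \<longrightarrow> x \<le> b \<longrightarrow> (H i has_integral (u x - u a) \<bullet> i) {a..x}"
    using bchoice[OF ballI[OF ex]] by (rule exE)
  have H: "(H i has_integral (u x - u a) \<bullet> i) {a..x}" if "i \<in> Basis" "a \<le> x" "x \<le> b" for i x
    using bspec[OF H0 that(1)] that(2,3) by blast
  show thesis
  proof (rule that[of "\<lambda>t. \<Sum>i\<in>Basis. H i t *\<^sub>R i"])
    fix x assume x: "a \<le> x" "x \<le> b"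
    show "((\<lambda>t. \<Sum>i\<in>Basis. H i t *\<^sub>R i) has_integral (u x - u a)) {a..x}"
    proof (subst has_integral_componentwise_iff, rule ballI)
      fix i :: 'a assume i: "i \<in> Basis"
      have "(\<lambda>t. (\<Sum>i\<in>Basis. H i t *\<^sub>R i) \<bullet> i) = H i"
        using i by (simp add: inner_sum_left_Basis)
      then show "((\<lambda>t. (\<Sum>i\<in>Basis. H i t *\<^sub>R i) \<bullet> i) has_integral (u x - u a) \<bullet> i) {a..x}"
        using H[OF i x] by simp
    qed
  qed
qed

text \<open>The Lebesgue differentiation theorem is applied to averages over
  \<open>{x..x + h}\<close>, which gives the right-hand derivative. Applying it to the reflected
  integrand as well gives the left-hand one; hence the exceptional set is a union with a reflected
  null set.\<close>

lemma indefinite_integral_has_vector_derivative_ae: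
  fixes g :: "real \<Rightarrow> 'a::euclidean_space"
  assumes g: "\<And>x. a \<le> x \<Longrightarrow> x \<le> b \<Longrightarrow> (g has_integral (u x - u a)) {a..x}"
  obtains N where "negligible N" "\<And>x. a < x \<Longrightarrow> x < b \<Longrightarrow> x \<notin> N \<Longrightarrow> (u has_vector_derivative g x) (at x)"
proof (cases "a \<le> b")
  case True
  define g0 where "g0 t = (if t \<in> {a..b} then g t else 0)" for t
  have "g integrable_on {a..b}" using g[of b] True by blast
  then have "g0 integrable_on UNIV" unfolding g0_def by (simp only: integrable_restrict_UNIV)
  then have int0: "g0 integrable_on cbox x y" for x y by (rule integrable_on_subcbox) simp
  have intr: "(\<lambda>t. g0 (- t)) integrable_on cbox x y" for x y :: real
    using int0[of "-y" "-x"] Henstock_Kurzweil_Integration.integrable_reflect_real[where f=g0 and a="-y" and b="-x"] by simp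
  have I: "integral {x..y} g0 = u y - u x" if "a \<le> x" "x \<le> y" "y \<le> b" for x y
  proof -
    have "integral {a..x} g + integral {x..y} g = integral {a..y} g"
      using that g[of y] by (intro Henstock_Kurzweil_Integration.integral_combine) auto
    moreover have "integral {a..x} g = u x - u a" "integral {a..y} g = u y - u a"
      using g[of x] g[of y] that by auto
    moreover have "integral {x..y} g0 = integral {x..y} g"
      using that by (intro Henstock_Kurzweil_Integration.integral_cong) (auto simp: g0_def)
    ultimately show ?thesis by (simp add: algebra_simps)
  qed
  obtain N1 where N1: "negligible N1" "\<And>x e. x \<notin> N1 \<Longrightarrow> 0 < e \<Longrightarrow>
      \<exists>d>0. \<forall>h. 0 < h \<and> h < d \<longrightarrow> norm (integral (cbox x (x + h *\<^sub>R One)) g0 /\<^sub>R h ^ DIM(real) - g0 x) < e"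
    using integrable_ccontinuous_explicit[OF int0] by blast
  obtain N2 where N2: "negligible N2" "\<And>x e. x \<notin> N2 \<Longrightarrow> 0 < e \<Longrightarrow>
      \<exists>d>0. \<forall>h. 0 < h \<and> h < d \<longrightarrow> norm (integral (cbox x (x + h *\<^sub>R One)) (\<lambda>t. g0 (- t)) /\<^sub>R h ^ DIM(real) - g0 (- x)) < e"
    using integrable_ccontinuous_explicit[OF intr] by blast
  show thesis
  proof (rule that[of "N1 \<union> uminus ` N2"])
    show "negligible (N1 \<union> uminus ` N2)"
      using N1(1) N2(1)
      by (intro negligible_Un negligible_differentiable_image_negligible) (auto intro!: derivative_intros)
    fix x assume x: "a < x" "x < b" "x \<notin> N1 \<union> uminus ` N2"
    then have "x \<notin> N1" "- x \<notin> N2" using imageI[of "- x" N2 uminus] by auto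
    have g0x: "g0 x = g x" using x by (simp add: g0_def)
    show "(u has_vector_derivative g x) (at x)"
      unfolding has_vector_derivative_def has_derivative_within_alt
    proof (intro conjI allI impI)
      show "bounded_linear (\<lambda>y. y *\<^sub>R g x)" by (rule bounded_linear_scaleR_left)
      fix e :: real assume "0 < e"
      obtain d1 where d1: "d1 > 0" "\<And>h. 0 < h \<Longrightarrow> h < d1 \<Longrightarrow> norm (integral {x..x + h} g0 /\<^sub>R h - g x) < e"
        using N1(2)[OF \<open>x \<notin> N1\<close> \<open>0 < e\<close>] g0x by auto
      obtain d2 where d2: "d2 > 0" "\<And>h. 0 < h \<Longrightarrow> h < d2 \<Longrightarrow> norm (integral {-x..-x + h} (\<lambda>t. g0 (- t)) /\<^sub>R h - g x) < e"
        using N2(2)[OF \<open>- x \<notin> N2\<close> \<open>0 < e\<close>] g0x by auto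
      have key: "norm (p - h *\<^sub>R g x) \<le> e * h" if "0 < h" "norm (p /\<^sub>R h - g x) < e" for p h
      proof -
        have "p - h *\<^sub>R g x = h *\<^sub>R (p /\<^sub>R h - g x)" using that by (simp add: scaleR_diff_right)
        then show ?thesis using that by (simp add: mult.commute)
      qed
      show "\<exists>d>0. \<forall>y\<in>UNIV. norm (y - x) < d \<longrightarrow> norm (u y - u x - (y - x) *\<^sub>R g x) \<le> e * norm (y - x)"
      proof (intro exI[of _ "min (min d1 d2) (min (x - a) (b - x))"] conjI ballI impI)
        show "0 < min (min d1 d2) (min (x - a) (b - x))" using x d1 d2 by simp
        fix y assume y: "norm (y - x) < min (min d1 d2) (min (x - a) (b - x))"
        consider "y = x" | "x < y" | "y < x" by linarith
        then show "norm (u y - u x - (y - x) *\<^sub>R g x) \<le> e * norm (y - x)"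
        proof cases
          case 2
          have "integral {x..x + (y - x)} g0 = u y - u x" using I[of x y] 2 x y by simp
          then show ?thesis using d1(2)[of "y - x"] key[of "y - x" "u y - u x"] 2 y by simp
        next
          case 3
          have "integral {-x..-x + (x - y)} (\<lambda>t. g0 (- t)) = u x - u y"
            using Henstock_Kurzweil_Integration.integral_reflect_real[where f=g0 and a=y and b=x] I[of y x] 3 x y by simp
          then have "norm (u x - u y - (x - y) *\<^sub>R g x) \<le> e * (x - y)"
            using d2(2)[of "x - y"] key[of "x - y" "u x - u y"] 3 y by simp
          also have "u x - u y - (x - y) *\<^sub>R g x = - (u y - u x - (y - x) *\<^sub>R g x)"
            by (simp add: algebra_simps)
          finally show ?thesis using 3 by (simp only: norm_minus_cancel) simp
        qed simp
      qed
    qed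
  qed
qed (use that[of "{}"] in auto)

text \<open>The density of \<open>u\<close> agrees with \<open>dot u\<close> off a null set. In this
  form chords of \<open>u\<close> become integrals of its derivative, as Jensen's inequality will
  require.\<close>

lemma abs_continuous_on_has_integral_dot:
  fixes u :: "real \<Rightarrow> 'a::euclidean_space"
  assumes ac: "abs_continuous_on 0 1 u" and st: "0 \<le> s" "s \<le> t" "t \<le> 1"
  shows "(dot u has_integral (u t - u s)) {s..t}"
proof -
  obtain g where g: "\<And>x. 0 \<le> x \<Longrightarrow> x \<le> 1 \<Longrightarrow> (g has_integral (u x - u 0)) {0..x}"
    using abs_continuous_on_density[OF zero_le_one ac] by blast
  have "\<exists>N. negligible N \<and> (\<forall>x. 0 < x \<longrightarrow> x < 1 \<longrightarrow> x \<notin> N \<longrightarrow> (u has_vector_derivative g x) (at x))"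
  proof (rule indefinite_integral_has_vector_derivative_ae[of 0 1 g u, OF g])
    fix N assume N: "negligible N" "\<And>x. 0 < x \<Longrightarrow> x < 1 \<Longrightarrow> x \<notin> N \<Longrightarrow> (u has_vector_derivative g x) (at x)"
    show ?thesis
      by (intro exI[of _ N] conjI allI impI N)
  qed
  then obtain N where N: "negligible N" "\<forall>x. 0 < x \<longrightarrow> x < 1 \<longrightarrow> x \<notin> N \<longrightarrow> (u has_vector_derivative g x) (at x)"
    by blast
  have dot: "dot u x = g x" if "0 < x" "x < 1" "x \<notin> N" for x
  proof -
    have "(u has_vector_derivative g x) (at x)" using N(2) that by blast
    then have "(u has_vector_derivative g x) (at x within {0..1})"
      by (rule has_vector_derivative_at_within)
    then show ?thesis
      unfolding dot_def by (rule vector_derivative_within_closed_interval[OF zero_less_one, rotated]) (use that in simp)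
  qed
  have gst: "(g has_integral (u t - u s)) {s..t}"
  proof -
    have int: "g integrable_on {0..t}" using g[of t] st by auto
    then have "integral {0..s} g + integral {s..t} g = integral {0..t} g"
      using st by (intro Henstock_Kurzweil_Integration.integral_combine) auto
    moreover have "integral {0..s} g = u s - u 0" "integral {0..t} g = u t - u 0"
      using g[of s] g[of t] st by auto
    moreover have "g integrable_on {s..t}"
      using int by (rule integrable_on_subinterval) (use st in auto)
    ultimately show ?thesis by (simp add: has_integral_iff algebra_simps)
  qed
  show ?thesis
  proof (rule has_integral_spike[OF _ _ gst])
    show "negligible (N \<union> {0, 1})" using N(1) by (intro negligible_Un) auto
  qed (use st dot in auto)
qed

section \<open>Convex gradients and symplectic duality\<close>

text \<open>The adjoint of the derivative at 1 is its Riesz vector; uniqueness of the derivative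
  makes the definite description in \<open>gradient\<close> meaningful.\<close>

lemma gradient_works:
  fixes G :: "'a::euclidean_space \<Rightarrow> real"
  assumes "G differentiable (at x)"
  shows "(G has_derivative (\<lambda>h. gradient G x \<bullet> h)) (at x)"
proof -
  obtain G' where G': "(G has_derivative G') (at x)" using assms by (auto simp: differentiable_def)
  then have "linear G'" by (rule has_derivative_linear)
  then have eq: "h \<bullet> adjoint G' 1 = G' h" for h using adjoint_works[of G' h 1] by simp
  have "GDERIV G x :> adjoint G' 1" using G' by (simp add: gderiv_def eq)
  moreover have "D = adjoint G' 1" if "GDERIV G x :> D" for D
  proof -
    have "(\<lambda>h. h \<bullet> D) = G'" using has_derivative_unique[OF that[unfolded gderiv_def] G'] .
    then have "h \<bullet> D = h \<bullet> adjoint G' 1" for h by (metis eq)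
    then show ?thesis by (metis vector_eq_ldot)
  qed
  ultimately have "GDERIV G x :> gradient G x" unfolding gradient_def by (rule theI)
  then show ?thesis by (simp add: gderiv_def inner_commute)
qed

lemma convex_on_gradient_le:
  fixes G :: "'a::euclidean_space \<Rightarrow> real"
  assumes "convex_on UNIV G" "G differentiable (at x)"
  shows "G x + gradient G x \<bullet> (y - x) \<le> G y"
proof -
  define \<phi> where "\<phi> t = G (x + t *\<^sub>R (y - x))" for t :: real
  have conv: "convex_on UNIV \<phi>"
  proof (rule convex_onI)
    fix t a b :: real assume t: "0 < t" "t < 1"
    have "x + ((1 - t) * a + t * b) *\<^sub>R (y - x) =
        (1 - t) *\<^sub>R (x + a *\<^sub>R (y - x)) + t *\<^sub>R (x + b *\<^sub>R (y - x))"
      by (simp add: algebra_simps)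
    then show "\<phi> ((1 - t) *\<^sub>R a + t *\<^sub>R b) \<le> (1 - t) * \<phi> a + t * \<phi> b"
      unfolding \<phi>_def using convex_onD[OF assms(1), of t "x + a *\<^sub>R (y - x)" "x + b *\<^sub>R (y - x)"] t by simp
  qed simp
  have line: "((\<lambda>t. x + t *\<^sub>R (y - x)) has_derivative (\<lambda>t. t *\<^sub>R (y - x))) (at 0)"
    by (auto intro!: derivative_eq_intros)
  have \<phi>: "\<phi> = (\<lambda>t. G (x + t *\<^sub>R (y - x)))" by (simp add: \<phi>_def fun_eq_iff)
  from has_derivative_compose[OF line, of G "\<lambda>h. gradient G x \<bullet> h"] gradient_works[OF assms(2)]
  have "(\<phi> has_derivative (\<lambda>t. gradient G x \<bullet> t *\<^sub>R (y - x))) (at 0)" by (simp add: \<phi>)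
  then have "(\<phi> has_field_derivative gradient G x \<bullet> (y - x)) (at 0)"
    unfolding has_field_derivative_def by (rule has_derivative_eq_rhs) (simp add: fun_eq_iff)
  from convex_on_imp_above_tangent[OF conv _ _ _ this, of 1]
  show ?thesis by (simp add: \<phi>_def)
qed

text \<open>The function \<open>G y - p \<bullet> y\<close> is minimal at \<open>x\<close>, so its
  derivative vanishes there.\<close>

lemma subgradient_eq_gradient:
  fixes G :: "'a::euclidean_space \<Rightarrow> real"
  assumes diff: "G differentiable (at x)" and p: "\<And>y. G x + p \<bullet> (y - x) \<le> G y"
  shows "gradient G x = p"
proof -
  have "((\<lambda>y. G y - p \<bullet> y) has_derivative (\<lambda>h. gradient G x \<bullet> h - p \<bullet> h)) (at x)"
    by (intro derivative_intros gradient_works diff)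
  moreover have "G x - p \<bullet> x \<le> G y - p \<bullet> y" for y
    using p[of y] by (simp add: inner_diff_right)
  ultimately have "(\<lambda>h. gradient G x \<bullet> h - p \<bullet> h) = (\<lambda>h. 0)"
    using differential_zero_maxmin[of x UNIV "\<lambda>y. G y - p \<bullet> y"] by auto
  then have "gradient G x \<bullet> h = p \<bullet> h" for h by (metis right_minus_eq)
  then show ?thesis by (metis vector_eq_rdot)
qed

text \<open>With \<open>q\<close> the difference of the gradients, test at \<open>x + w\<close>,
  where \<open>w\<close> has length \<delta> and the direction of \<open>q\<close>. The tangent
  inequalities at \<open>x\<close> and \<open>y\<close> and the first-order expansion at
  \<open>x\<close> then bound \<open>norm q\<close> by the remainder at \<open>x\<close> alone,
  uniformly in \<open>y\<close> near \<open>x\<close>.\<close>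

lemma convex_on_continuous_gradient:
  fixes G :: "'a::euclidean_space \<Rightarrow> real"
  assumes conv: "convex_on UNIV G" and diff: "\<And>x. G differentiable (at x)"
  shows "continuous_on UNIV (gradient G)"
  unfolding continuous_on_iff
proof (intro ballI allI impI)
  fix x :: 'a and e :: real assume "0 < e"
  define \<epsilon> where "\<epsilon> = e / 3"
  have "0 < \<epsilon>" using \<open>0 < e\<close> by (simp add: \<epsilon>_def)
  obtain d where "d > 0" and d: "\<And>y. norm (y - x) < d \<Longrightarrow> norm (G y - G x - gradient G x \<bullet> (y - x)) \<le> \<epsilon> * norm (y - x)"
    using gradient_works[OF diff, of x, unfolded has_derivative_within_alt, THEN conjunct2, rule_format, OF \<open>0 < \<epsilon>\<close>]
    by auto
  define \<delta> where "\<delta> = d / 2"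
  have \<delta>: "0 < \<delta>" "\<delta> < d" using \<open>0 < d\<close> by (auto simp: \<delta>_def)
  have "dist (gradient G y) (gradient G x) < e" if y: "dist y x < \<delta> / 2" for y
  proof (cases "gradient G y = gradient G x")
    case False
    define q where "q = gradient G y - gradient G x"
    have q: "norm q > 0" using False by (simp add: q_def)
    define w where "w = (\<delta> / norm q) *\<^sub>R q"
    have w: "norm w = \<delta>" "q \<bullet> w = \<delta> * norm q"
      using \<delta> q by (auto simp: w_def power2_norm_eq_inner[symmetric] power2_eq_square)
    have 1: "G (x + w) \<le> G x + gradient G x \<bullet> w + \<epsilon> * \<delta>"
      using d[of "x + w"] w \<delta> by simp
    have 2: "G y + gradient G y \<bullet> (x + w - y) \<le> G (x + w)"
      by (rule convex_on_gradient_le[OF conv diff])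
    have 3: "G x + gradient G x \<bullet> (y - x) \<le> G y"
      by (rule convex_on_gradient_le[OF conv diff])
    have "\<delta> * norm q \<le> q \<bullet> (y - x) + \<epsilon> * \<delta>"
      using 1 2 3 unfolding w(2)[symmetric] by (simp add: q_def algebra_simps)
    also have "q \<bullet> (y - x) \<le> norm q * norm (y - x)" by (rule norm_cauchy_schwarz)
    also have "norm q * norm (y - x) \<le> norm q * (\<delta> / 2)"
      using y by (intro mult_left_mono) (auto simp: dist_norm)
    finally have "\<delta> * norm q \<le> \<delta> * (2 * \<epsilon>)" by (simp add: algebra_simps)
    then have "norm q \<le> 2 * \<epsilon>" using \<delta>(1) by (simp only: mult_le_cancel_left_pos)
    then show ?thesis using \<open>0 < e\<close> by (simp add: dist_norm q_def \<epsilon>_def)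
  qed (use \<open>0 < e\<close> in simp)
  with \<delta> show "\<exists>d>0. \<forall>x'\<in>UNIV. dist x' x < d \<longrightarrow> dist (gradient G x') (gradient G x) < e"
    by (intro exI[of _ "\<delta> / 2"]) auto
qed

section \<open>Algebra of the symplectic matrix\<close>

lemma symp_J_simps [simp]:
  "symp_J (symp_J z) = - z" "symp_J (- z) = - symp_J z" "symp_J 0 = 0"
  "symp_J (x + y) = symp_J x + symp_J y" "symp_J (x - y) = symp_J x - symp_J y"
  "symp_J (c *\<^sub>R z) = c *\<^sub>R symp_J z"
  by (auto simp: symp_J_def prod_eq_iff)

lemma symp_J_eq_0_iff: "symp_J x = 0 \<longleftrightarrow> x = 0"
  by (auto simp: symp_J_def prod_eq_iff)

lemma symp_J_inner: "symp_J x \<bullet> y = - (x \<bullet> symp_J y)"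
  by (simp add: symp_J_def inner_prod_def inner_commute)

lemma symp_J_inner_self [simp]: "symp_J x \<bullet> x = 0"
  by (simp add: symp_J_def inner_prod_def inner_commute)

lemma inner_symp_J_self [simp]: "x \<bullet> symp_J x = 0"
  using symp_J_inner_self[of x] by (simp only: inner_commute)

lemma symp_J_inner_symp_J [simp]: "symp_J x \<bullet> symp_J y = x \<bullet> y"
  by (simp add: symp_J_inner)

lemma norm_symp_J [simp]: "norm (symp_J x) = norm x"
  by (simp add: norm_eq_sqrt_inner symp_J_inner)

lemma bounded_linear_symp_J: "bounded_linear symp_J"
  by (rule bounded_linear_intro[of _ 1]) auto

section \<open>Growth and Fenchel duality of differentiable G-functions\<close>

locale differentiable_G_function =
  fixes G :: "'a::euclidean_space \<Rightarrow> real"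
  assumes G_function: "G_function G" and differentiable: "\<And>x. G differentiable (at x)"
begin

abbreviation g where "g \<equiv> gradient G"

lemma nonneg: "0 \<le> G x" and G_eq_0_iff: "G x = 0 \<longleftrightarrow> x = 0" and even: "G (- x) = G x"
  and convex: "convex_on UNIV G"
  using G_function by (auto simp: G_function_def)

lemma G_0 [simp]: "G 0 = 0" by (simp add: G_eq_0_iff)

lemmas has_derivative = gradient_works[OF differentiable]
lemmas tangent_le = convex_on_gradient_le[OF convex differentiable]
lemmas continuous_gradient = convex_on_continuous_gradient[OF convex differentiable]

lemma continuous: "continuous_on S G"
  using differentiable
  by (meson continuous_at_imp_continuous_on differentiable_imp_continuous_within)

text \<open>Superlinear growth is used in this form: it converts bounds on energy into bounds on
  length.\<close>

lemma linear_growth: "\<exists>K\<ge>0. \<forall>v. norm v - K \<le> G v"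
proof -
  have "eventually (\<lambda>u. 1 \<le> G u / norm u) at_infinity"
    using G_function by (auto simp: G_function_def filterlim_at_top)
  then obtain b where b: "\<And>u. b \<le> norm u \<Longrightarrow> 1 \<le> G u / norm u"
    by (auto simp: eventually_at_infinity)
  have "norm v - max b 0 \<le> G v" for v
  proof (cases "b \<le> norm v \<and> v \<noteq> 0")
    case True
    then show ?thesis using b[of v] by (auto simp: field_simps)
  next
    case False
    then show ?thesis using nonneg[of v] by auto
  qed
  then show ?thesis by (intro exI[of _ "max b 0"]) auto
qed

lemma le_gradient_inner: "G v \<le> g v \<bullet> v"
  using tangent_le[of v 0] by simp

text \<open>The tangent at \<open>v\<close>, evaluated at \<open>2 *\<^sub>R v\<close>, lies below
  \<open>C * G v + 1\<close>.\<close>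

lemma gradient_inner_le:
  assumes "\<And>u. G (2 *\<^sub>R u) \<le> C * G u + 1"
  shows "g v \<bullet> v \<le> C * G v + 1"
  using tangent_le[of v "2 *\<^sub>R v"] assms[of v] nonneg[of v] by (simp add: scaleR_2)

text \<open>Equality case of the Fenchel-Young inequality: by the tangent inequality the supremum is
  attained at \<open>v\<close>.\<close>

lemma convex_conjugate_gradient: "convex_conjugate G (g v) = ereal (g v \<bullet> v - G v)"
  unfolding convex_conjugate_def
proof (rule antisym)
  show "(SUP u. ereal (u \<bullet> g v - G u)) \<le> ereal (g v \<bullet> v - G v)"
  proof (rule SUP_least)
    fix u show "ereal (u \<bullet> g v - G u) \<le> ereal (g v \<bullet> v - G v)"
      using tangent_le[of v u] by (simp add: inner_diff_right inner_commute)
  qed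
  show "ereal (g v \<bullet> v - G v) \<le> (SUP u. ereal (u \<bullet> g v - G u))"
    by (rule SUP_upper2[of v]) (auto simp: inner_commute)
qed

end

locale symplectic_G_function = differentiable_G_function G
  for G :: "(real^'n) \<times> (real^'n) \<Rightarrow> real" +
  assumes symplectic: "symplectic G"
begin

lemma convex_conjugate_gradient_symp: "convex_conjugate G (g v) = ereal (G (- symp_J (g v)))"
proof -
  have "convex_conjugate G (symp_J (- symp_J (g v))) = ereal (G (- symp_J (g v)))"
    using symplectic unfolding symplectic_def by blast
  then show ?thesis by simp
qed

text \<open>The inverse of the gradient is the gradient of the conjugate, which symplecticity
  expresses through \<open>G\<close> itself.\<close>

lemma gradient_inverse: "g (- symp_J (g v)) = - symp_J v"
proof (rule subgradient_eq_gradient[OF differentiable])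
  fix y
  \<comment> \<open>Fenchel-Young for the pair \<open>v\<close>, \<open>symp_J y\<close> bounds
    \<open>G y\<close> from below by an affine function of \<open>y\<close> with slope
    \<open>- symp_J v\<close>; equality holds at \<open>y = - symp_J (g v)\<close>, so this slope is
    a subgradient there.\<close>
  have "ereal (v \<bullet> symp_J y - G v) \<le> convex_conjugate G (symp_J y)"
    unfolding convex_conjugate_def by (rule SUP_upper) simp
  also have "\<dots> = ereal (G y)" using symplectic unfolding symplectic_def by blast
  finally have "v \<bullet> symp_J y - G v \<le> G y" by simp
  moreover have "G (- symp_J (g v)) = g v \<bullet> v - G v"
    using convex_conjugate_gradient convex_conjugate_gradient_symp by (metis ereal.inject)
  ultimately show "G (- symp_J (g v)) + (- symp_J v) \<bullet> (y - (- symp_J (g v))) \<le> G y"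
    using symp_J_inner[of v y] inner_commute[of v "g v"] by (simp add: inner_add_right)
qed

lemma eq_symp_gradient: "v = symp_J (g (- symp_J (g v)))"
  using gradient_inverse[of v] by auto

end

section \<open>The discrete variational problem\<close>

text \<open>Indexing by all integers lets the neighbours \<open>k - 1\<close> and
  \<open>k + 1\<close> be written without reduction modulo \<open>N\<close>.\<close>

definition periodic_seq :: "nat \<Rightarrow> (int \<Rightarrow> 'a) \<Rightarrow> bool" where
  "periodic_seq N X \<longleftrightarrow> (\<forall>i. X (i + int N) = X i)"

lemma periodic_seq_mod:
  assumes "periodic_seq N X"
  shows "X (i mod int N) = X i"
proof -
  have *: "X (j + int k * int N) = X j" for j k
  proof (induction k)
    case (Suc k)
    have "X (j + int (Suc k) * int N) = X ((j + int k * int N) + int N)" by (simp add: algebra_simps)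
    also have "\<dots> = X (j + int k * int N)" using assms unfolding periodic_seq_def by blast
    finally show ?case using Suc by simp
  qed simp
  show ?thesis
  proof (cases "0 \<le> i div int N")
    case True
    have "i = i mod int N + int (nat (i div int N)) * int N" using True by simp
    then show ?thesis by (metis *)
  next
    case False
    have "i mod int N = i - i div int N * int N" by (simp add: minus_div_mult_eq_mod)
    then have "i mod int N = i + int (nat (- (i div int N))) * int N" using False by simp
    then show ?thesis by (metis *)
  qed
qed

lemma sum_periodic_shift:
  fixes f :: "int \<Rightarrow> 'a::ab_group_add"
  assumes "f (int N) = f 0"
  shows "(\<Sum>k<N. f (int k + 1)) = (\<Sum>k<N. f (int k))"
proof -
  have "f 0 + (\<Sum>k<N. f (int k + 1)) = (\<Sum>k<Suc N. f (int k))"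
    by (subst sum.lessThan_Suc_shift) (simp add: add.commute)
  also have "\<dots> = f 0 + (\<Sum>k<N. f (int k))" using assms by simp
  finally show ?thesis by simp
qed

text \<open>This is the exact integral of \<open>u' \<bullet> symp_J u\<close> along the closed
  polygon with vertices \<open>X\<close>: on each edge the part quadratic in the edge vanishes by
  antisymmetry, and so does \<open>X k \<bullet> symp_J (X k)\<close>.\<close>

definition action :: "nat \<Rightarrow> (int \<Rightarrow> (real^'n) \<times> (real^'n)) \<Rightarrow> real" where
  "action N X = (\<Sum>k<N. X (int k + 1) \<bullet> symp_J (X (int k)))"

text \<open>The first variation. As the action is a quadratic form, the expansion in
  \<open>action_add\<close> is exact.\<close>

definition action_deriv :: "nat \<Rightarrow> (int \<Rightarrow> (real^'n) \<times> (real^'n)) \<Rightarrow> (int \<Rightarrow> (real^'n) \<times> (real^'n)) \<Rightarrow> real" where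
  "action_deriv N X h = (\<Sum>k<N. h (int k + 1) \<bullet> symp_J (X (int k)) + X (int k + 1) \<bullet> symp_J (h (int k)))"

lemma action_add:
  "action N (\<lambda>i. X i + e *\<^sub>R h i) = action N X + e * action_deriv N X h + e\<^sup>2 * action N h"
  by (simp add: action_def action_deriv_def inner_add_left inner_add_right sum.distrib sum_distrib_left
      algebra_simps power2_eq_square)

lemma action_deriv_self: "action_deriv N X X = 2 * action N X"
  by (simp add: action_def action_deriv_def sum_distrib_left)

lemma action_deriv_add_scale:
  "action_deriv N X (\<lambda>i. h i + c *\<^sub>R k i) = action_deriv N X h + c * action_deriv N X k"
  by (simp add: action_deriv_def inner_add_left inner_add_right sum.distrib sum_distrib_left algebra_simps)

text \<open>Summation by parts over a period frees \<open>h\<close> of shifts, so that the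
  Euler-Lagrange equation can be read off by a choice of \<open>h\<close>.\<close>

lemma action_deriv_eq:
  assumes "periodic_seq N X" "periodic_seq N h"
  shows "action_deriv N X h = (\<Sum>k<N. h (int k) \<bullet> symp_J (X (int k - 1) - X (int k + 1)))"
proof -
  have X: "X (int N - 1) = X (- 1)" using assms(1)[unfolded periodic_seq_def, rule_format, of "-1"] by simp
  have h: "h (int N) = h 0" using assms(2)[unfolded periodic_seq_def, rule_format, of 0] by simp
  have "(\<Sum>k<N. h (int k + 1) \<bullet> symp_J (X (int k))) = (\<Sum>k<N. h (int k) \<bullet> symp_J (X (int k - 1)))"
    using sum_periodic_shift[of "\<lambda>i. h i \<bullet> symp_J (X (i - 1))" N] X h by simp
  moreover have "X (int k + 1) \<bullet> symp_J (h (int k)) = - (h (int k) \<bullet> symp_J (X (int k + 1)))" for k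
    by (simp add: symp_J_inner flip: inner_commute[of "symp_J (X (int k + 1))"])
  ultimately show ?thesis
    by (simp add: action_deriv_def sum.distrib inner_diff_right sum_subtractf sum_negf)
qed

lemma action_translate:
  assumes "periodic_seq N X"
  shows "action N (\<lambda>i. X i + c) = action N X"
proof -
  have "X (int N) = X 0" using assms[unfolded periodic_seq_def, rule_format, of 0] by simp
  then have "(\<Sum>k<N. X (int k + 1) \<bullet> symp_J c) = (\<Sum>k<N. X (int k) \<bullet> symp_J c)"
    by (intro sum_periodic_shift) simp
  moreover have "c \<bullet> symp_J (X (int k)) = - (X (int k) \<bullet> symp_J c)" for k
    using symp_J_inner[of c "X (int k)"] by (simp add: inner_commute)
  ultimately show ?thesis
    by (simp add: action_def inner_add_left inner_add_right sum.distrib sum_negf sum_subtractf)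
qed

section \<open>The discrete energy and its first variation\<close>

context differentiable_G_function
begin

text \<open>The integral of \<open>G\<close> over the slopes of the polygon, whose edges are run
  through in time \<open>1 / real N\<close> each.\<close>

definition energy :: "nat \<Rightarrow> (int \<Rightarrow> 'a) \<Rightarrow> real" where
  "energy N X = (\<Sum>k<N. G (real N *\<^sub>R (X (int k + 1) - X (int k)))) / real N"

text \<open>The factor \<open>real N\<close> from the chain rule cancels the mesh size, so no
  normalisation remains.\<close>

definition energy_deriv :: "nat \<Rightarrow> (int \<Rightarrow> 'a) \<Rightarrow> (int \<Rightarrow> 'a) \<Rightarrow> real" where
  "energy_deriv N X h =
     (\<Sum>k<N. g (real N *\<^sub>R (X (int k + 1) - X (int k))) \<bullet> (h (int k + 1) - h (int k)))"

lemma energy_translate: "energy N (\<lambda>i. X i + c) = energy N X"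
  by (simp add: energy_def)

lemma continuous_energy: "continuous_on UNIV (energy N)"
  unfolding energy_def divide_inverse
  by (intro continuous_intros continuous_on_compose2[OF continuous[of UNIV]]) auto

lemma has_real_derivative_energy:
  assumes "0 < N"
  shows "((\<lambda>e. energy N (\<lambda>i. X i + e *\<^sub>R h i)) has_real_derivative energy_deriv N X h) (at 0)"
proof -
  have d: "((\<lambda>e. G (real N *\<^sub>R (X (int k + 1) + e *\<^sub>R h (int k + 1) - (X (int k) + e *\<^sub>R h (int k)))))
      has_real_derivative real N * (g (real N *\<^sub>R (X (int k + 1) - X (int k))) \<bullet> (h (int k + 1) - h (int k)))) (at 0)"
    (is "((\<lambda>e. G (?p e)) has_real_derivative ?d) _") for k
  proof -
    have "(?p has_derivative (\<lambda>e. real N *\<^sub>R (e *\<^sub>R h (int k + 1) - e *\<^sub>R h (int k)))) (at 0)"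
      by (auto intro!: derivative_eq_intros)
    from has_derivative_compose[OF this has_derivative]
    have "((\<lambda>e. G (?p e)) has_derivative (\<lambda>e. g (?p 0) \<bullet> (real N *\<^sub>R (e *\<^sub>R h (int k + 1) - e *\<^sub>R h (int k))))) (at 0)"
      by simp
    then show ?thesis unfolding has_field_derivative_def
      by (rule has_derivative_eq_rhs) (simp add: fun_eq_iff inner_diff_right algebra_simps)
  qed
  have "((\<lambda>e. (\<Sum>k<N. G (real N *\<^sub>R (X (int k + 1) + e *\<^sub>R h (int k + 1) - (X (int k) + e *\<^sub>R h (int k))))) / real N)
      has_real_derivative (\<Sum>k<N. real N * (g (real N *\<^sub>R (X (int k + 1) - X (int k))) \<bullet> (h (int k + 1) - h (int k)))) / real N) (at 0)"
    by (rule DERIV_cdivide, rule DERIV_sum, rule d)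
  then show ?thesis
    using assms unfolding energy_def energy_deriv_def by (simp flip: sum_distrib_left)
qed

lemma energy_deriv_add_scale:
  "energy_deriv N X (\<lambda>i. h i + c *\<^sub>R k i) = energy_deriv N X h + c * energy_deriv N X k"
  by (simp add: energy_deriv_def inner_add_right inner_diff_right sum.distrib sum_subtractf sum_distrib_left algebra_simps)

lemma energy_deriv_self:
  assumes "0 < N"
  shows "energy_deriv N X X =
    (\<Sum>k<N. g (real N *\<^sub>R (X (int k + 1) - X (int k))) \<bullet> (real N *\<^sub>R (X (int k + 1) - X (int k)))) / real N"
  using assms by (simp add: energy_deriv_def flip: sum_distrib_left)

text \<open>\<open>energy_deriv N X X\<close> will be the denominator of the multiplier; this bound
  keeps it away from 0, and the next one, from the \<Delta>2-condition, keeps it bounded.\<close>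

lemma energy_le_energy_deriv_self:
  assumes "0 < N"
  shows "energy N X \<le> energy_deriv N X X"
  unfolding energy_deriv_self[OF assms] energy_def
  by (intro divide_right_mono sum_mono le_gradient_inner) simp

lemma energy_deriv_self_le:
  assumes "0 < N" "\<And>u. G (2 *\<^sub>R u) \<le> C * G u + 1"
  shows "energy_deriv N X X \<le> C * energy N X + 1"
proof -
  have "energy_deriv N X X \<le> (\<Sum>k<N. C * G (real N *\<^sub>R (X (int k + 1) - X (int k))) + 1) / real N"
    unfolding energy_deriv_self[OF assms(1)]
    by (intro divide_right_mono sum_mono gradient_inner_le assms(2)) simp
  also have "\<dots> = C * energy N X + 1"
    using assms(1) by (simp add: energy_def sum.distrib add_divide_distrib flip: sum_distrib_left)
  finally show ?thesis .
qed

lemma energy_deriv_eq: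
  assumes "periodic_seq N X" "periodic_seq N h"
  defines "v \<equiv> \<lambda>i. g (real N *\<^sub>R (X (i + 1) - X i))"
  shows "energy_deriv N X h = (\<Sum>k<N. h (int k) \<bullet> (v (int k - 1) - v (int k)))"
proof -
  have "X (int N) = X 0" "X (int N - 1) = X (- 1)"
    using assms(1)[unfolded periodic_seq_def, rule_format, of "-1"]
      assms(1)[unfolded periodic_seq_def, rule_format, of 0] by simp_all
  moreover have "h (int N) = h 0" using assms(2)[unfolded periodic_seq_def, rule_format, of 0] by simp
  ultimately have "(\<Sum>k<N. v (int k) \<bullet> h (int k + 1)) = (\<Sum>k<N. v (int k - 1) \<bullet> h (int k))"
    using sum_periodic_shift[of "\<lambda>i. v (i - 1) \<bullet> h i" N] by (simp add: v_def)
  moreover have "energy_deriv N X h = (\<Sum>k<N. v (int k) \<bullet> (h (int k + 1) - h (int k)))"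
    by (simp add: energy_deriv_def v_def)
  ultimately show ?thesis
    by (simp add: inner_diff_right sum_subtractf inner_commute)
qed

text \<open>Linear growth bounds the total length of one period by \<open>s + K\<close>, whatever
  \<open>N\<close>; periodicity brings both indices into that period.\<close>

lemma oscillation_le:
  assumes "periodic_seq N X" "0 < N" "energy N X \<le> s" and K: "\<And>v. norm v - K \<le> G v"
  shows "norm (X i - X j) \<le> s + K"
proof -
  have "(\<Sum>k<N. norm (real N *\<^sub>R (X (int k + 1) - X (int k)))) \<le>
      (\<Sum>k<N. G (real N *\<^sub>R (X (int k + 1) - X (int k))) + K)"
    by (intro sum_mono) (use K in \<open>simp only: diff_le_eq\<close>)
  also have "\<dots> = real N * (energy N X + K)"
    using assms(2) by (simp add: energy_def sum.distrib field_simps)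
  also have "\<dots> \<le> real N * (s + K)" using assms(3) by (intro mult_left_mono) auto
  also have "(\<Sum>k<N. norm (real N *\<^sub>R (X (int k + 1) - X (int k)))) = real N * (\<Sum>k<N. norm (X (int k + 1) - X (int k)))"
    by (simp add: sum_distrib_left)
  finally have var: "(\<Sum>k<N. norm (X (int k + 1) - X (int k))) \<le> s + K" using assms(2) by simp
  have le: "norm (X (int q) - X (int p)) \<le> s + K" if "p \<le> q" "q \<le> N" for p q
  proof -
    have "X (int q) - X (int p) = (\<Sum>k=p..<q. X (int (Suc k)) - X (int k))"
      using sum_Suc_diff'[OF that(1), of "\<lambda>k. X (int k)"] by simp
    also have "norm \<dots> \<le> (\<Sum>k=p..<q. norm (X (int k + 1) - X (int k)))"
      by (intro order_trans[OF norm_sum] sum_mono) (simp add: add.commute)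
    also have "\<dots> \<le> (\<Sum>k<N. norm (X (int k + 1) - X (int k)))"
      using that by (intro sum_mono2) auto
    finally show ?thesis using var by simp
  qed
  define p q where "p = nat (i mod int N)" and "q = nat (j mod int N)"
  have "X i = X (int p)" "X j = X (int q)"
    using periodic_seq_mod[OF assms(1)] assms(2) by (simp_all add: p_def q_def)
  moreover have "p \<le> N" "q \<le> N"
    using assms(2) by (auto simp: p_def q_def nat_le_iff intro!: less_imp_le pos_mod_bound)
  ultimately show ?thesis using le[of p q] le[of q p] by (metis linear norm_minus_commute)
qed

end

section \<open>Maximisation of the discrete action at fixed energy\<close>

context symplectic_G_function
begin

text \<open>Energy and action are invariant under translation, so one vertex may be pinned at 0. The
  oscillation bound then places the admissible sequences in a product of closed balls, compact by
  Tychonoff.\<close>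

lemma exists_action_maximizer:
  assumes N: "0 < N" and Y: "periodic_seq N Y" "energy N Y \<le> s"
  obtains X where "periodic_seq N X" "X 0 = 0" "energy N X \<le> s"
    "\<forall>Z. periodic_seq N Z \<longrightarrow> energy N Z \<le> s \<longrightarrow> action N Z \<le> action N X"
proof -
  obtain K where K: "\<forall>v. norm v - K \<le> G v" using linear_growth by blast
  define S where "S = {X. periodic_seq N X \<and> X 0 = 0 \<and> energy N X \<le> s}"
  define B where "B = (UNIV :: int set) \<rightarrow>\<^sub>E cball (0::(real^'n) \<times> (real^'n)) (s + K)"
  have "compactin (product_topology (\<lambda>_::int. euclidean) UNIV) B"
    unfolding B_def by (subst compactin_PiE) auto
  then have "compact B" by (simp add: euclidean_product_topology)
  moreover have "closed S"
    unfolding S_def periodic_seq_def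
    by (intro closed_Collect_conj closed_Collect_all closed_Collect_eq closed_Collect_le
        continuous_energy continuous_on_product_coordinates continuous_on_const)
  moreover have "S \<subseteq> B"
  proof
    fix X assume "X \<in> S"
    then have "norm (X i - X 0) \<le> s + K" for i
      unfolding S_def using N K by (intro oscillation_le[of N X s K i 0]) auto
    with \<open>X \<in> S\<close> show "X \<in> B" by (simp add: B_def S_def PiE_iff)
  qed
  ultimately have "compact S" by (metis compact_Int_closed inf.absorb_iff2 inf_commute)
  have normalize: "(\<lambda>i. Z i + - Z 0) \<in> S" if "periodic_seq N Z" "energy N Z \<le> s" for Z
    using that energy_translate[of N Z "- Z 0"] by (auto simp: S_def periodic_seq_def)
  have "continuous_on UNIV (action N)"
    unfolding action_def
    by (intro continuous_intros bounded_linear.continuous_on[OF bounded_linear_symp_J]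
        continuous_on_product_coordinates)
  then have "continuous_on S (action N)" by (rule continuous_on_subset) simp
  moreover have "S \<noteq> {}" using normalize[OF Y] by blast
  ultimately obtain X where X: "X \<in> S" "\<forall>Z\<in>S. action N Z \<le> action N X"
    using continuous_attains_sup[OF \<open>compact S\<close>] by blast
  show thesis
  proof (rule that[of X])
    show "\<forall>Z. periodic_seq N Z \<longrightarrow> energy N Z \<le> s \<longrightarrow> action N Z \<le> action N X"
    proof (intro allI impI)
      fix Z assume Z: "periodic_seq N Z" "energy N Z \<le> s"
      then show "action N Z \<le> action N X"
        using bspec[OF X(2) normalize[OF Z]] action_translate[OF Z(1), of "- Z 0"] by simp
    qed
  qed (use X(1) in \<open>auto simp: S_def\<close>)
qed

text \<open>A Lagrange multiplier by hand: a direction that strictly lowers the energy cannot raise the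
  action, and \<open>-X\<close> lowers the energy strictly.\<close>

lemma maximizer_multiplier:
  assumes N: "0 < N" and X: "periodic_seq N X" "energy N X \<le> s" and "0 < action N X"
    and max: "\<And>Z. periodic_seq N Z \<Longrightarrow> energy N Z \<le> s \<Longrightarrow> action N Z \<le> action N X"
    and h: "periodic_seq N h"
  shows "0 < energy_deriv N X X"
    and "action_deriv N X h = 2 * action N X / energy_deriv N X X * energy_deriv N X h"
proof -
  have per: "periodic_seq N (\<lambda>i. k i + c *\<^sub>R l i)" if "periodic_seq N k" "periodic_seq N l" for k l c
    using that by (simp add: periodic_seq_def)
  \<comment> \<open>Zero energy would force every edge to vanish, hence zero action.\<close>
  have "energy N X > 0"
  proof (rule ccontr)
    assume "\<not> energy N X > 0"
    then have "(\<Sum>k<N. G (real N *\<^sub>R (X (int k + 1) - X (int k)))) \<le> 0"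
      using N by (simp add: energy_def divide_le_0_iff zero_less_divide_iff not_less)
    then have "(\<Sum>k<N. G (real N *\<^sub>R (X (int k + 1) - X (int k)))) = 0"
      by (intro antisym sum_nonneg nonneg)
    then have "\<forall>k\<in>{..<N}. G (real N *\<^sub>R (X (int k + 1) - X (int k))) = 0"
      by (subst (asm) sum_nonneg_eq_0_iff) (auto simp: nonneg)
    then have "X (int k + 1) = X (int k)" if "k < N" for k
      using that N by (simp add: G_eq_0_iff)
    then have "action N X = 0" by (simp add: action_def)
    then show False using assms(4) by simp
  qed
  then show pos: "0 < energy_deriv N X X" using energy_le_energy_deriv_self[OF N, of X] by linarith
  have descent: "action_deriv N X k \<le> 0" if k: "periodic_seq N k" and neg: "energy_deriv N X k < 0" for k
  proof -
    obtain d where "d > 0" and d: "\<And>e. 0 < e \<Longrightarrow> e < d \<Longrightarrow> energy N (\<lambda>i. X i + e *\<^sub>R k i) < energy N X"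
      using DERIV_neg_dec_right[OF has_real_derivative_energy[OF N] neg] by auto
    have *: "action_deriv N X k + e * action N k \<le> 0" if e: "0 < e" "e < d" for e
    proof -
      have "action N (\<lambda>i. X i + e *\<^sub>R k i) \<le> action N X"
        using d[OF e] X(2) by (intro max per X k) simp
      then have "e * (action_deriv N X k + e * action N k) \<le> 0"
        by (simp add: action_add power2_eq_square algebra_simps)
      then show ?thesis using e by (simp add: mult_le_0_iff)
    qed
    have "((\<lambda>e. action_deriv N X k + e * action N k) \<longlongrightarrow> action_deriv N X k + 0 * action N k) (at_right 0)"
      by (intro tendsto_intros)
    moreover have "eventually (\<lambda>e. action_deriv N X k + e * action N k \<le> 0) (at_right 0)"
      using * \<open>d > 0\<close> by (auto simp: eventually_at_right[OF \<open>d > 0\<close>])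
    ultimately have "action_deriv N X k + 0 * action N k \<le> 0"
      by (rule tendsto_upperbound) simp
    then show ?thesis by simp
  qed
  \<comment> \<open>Subtracting a small multiple of \<open>X\<close> turns a neutral direction into
    a descending one; \<open>c\<close> is chosen so that this costs exactly \<open>e\<close> of the
    first variation of the action.\<close>
  have kernel: "action_deriv N X k \<le> 0" if k: "periodic_seq N k" and 0: "energy_deriv N X k = 0" for k
  proof (rule field_le_epsilon)
    fix e :: real assume "0 < e"
    define c where "c = e / (2 * action N X)"
    have "c > 0" using \<open>0 < e\<close> assms(4) by (simp add: c_def)
    have "energy_deriv N X (\<lambda>i. k i + (-c) *\<^sub>R X i) < 0"
      unfolding energy_deriv_add_scale using 0 pos \<open>c > 0\<close> by simp
    from descent[OF per[OF k X(1)] this] show "action_deriv N X k \<le> 0 + e"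
      unfolding action_deriv_add_scale action_deriv_self using assms(4) by (simp add: c_def)
  qed
  \<comment> \<open>\<open>m\<close> is the projection of \<open>h\<close> along \<open>X\<close>
    onto the kernel of the energy variation. Both \<open>m\<close> and \<open>-m\<close> are
    neutral, so the action variation vanishes on \<open>m\<close>.\<close>
  define c where "c = energy_deriv N X h / energy_deriv N X X"
  define m where "m i = h i + (-c) *\<^sub>R X i" for i
  have m: "m = (\<lambda>i. h i + (-c) *\<^sub>R X i)" by (simp add: m_def fun_eq_iff)
  have perm: "periodic_seq N m" unfolding m by (rule per[OF h X(1)])
  have e0: "energy_deriv N X m = 0"
    unfolding m energy_deriv_add_scale using pos by (simp add: c_def)
  have neg: "action_deriv N X (\<lambda>i. 0 + (-1) *\<^sub>R m i) = - action_deriv N X m"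
    "energy_deriv N X (\<lambda>i. 0 + (-1) *\<^sub>R m i) = - energy_deriv N X m"
    unfolding action_deriv_add_scale energy_deriv_add_scale
    by (simp_all add: action_deriv_def energy_deriv_def)
  have "periodic_seq N (\<lambda>i. 0 + (-1) *\<^sub>R m i)"
    using perm by (simp add: periodic_seq_def)
  from kernel[OF this] have "action_deriv N X m \<ge> 0" unfolding neg using e0 by simp
  then have "action_deriv N X m = 0" using kernel[OF perm e0] by simp
  then show "action_deriv N X h = 2 * action N X / energy_deriv N X X * energy_deriv N X h"
    unfolding m action_deriv_add_scale action_deriv_self by (simp add: c_def)
qed

text \<open>With energy to spare, \<open>X\<close> could be enlarged by a factor
  \<open>1 + e\<close>, which strictly increases a positive quadratic action.\<close>

lemma maximizer_energy_eq:
  assumes N: "0 < N" and X: "periodic_seq N X" "energy N X \<le> s" and "0 < action N X"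
    and max: "\<And>Z. periodic_seq N Z \<Longrightarrow> energy N Z \<le> s \<Longrightarrow> action N Z \<le> action N X"
  shows "energy N X = s"
proof (rule ccontr)
  assume "energy N X \<noteq> s"
  then have "energy N X < s" using X by simp
  have "isCont (\<lambda>e. energy N (\<lambda>i. X i + e *\<^sub>R X i)) 0"
    using has_real_derivative_energy[OF N] by (rule DERIV_isCont)
  then have "((\<lambda>e. energy N (\<lambda>i. X i + e *\<^sub>R X i)) \<longlongrightarrow> energy N X) (at_right 0)"
    by (simp add: isCont_def filterlim_at_split)
  then have "eventually (\<lambda>e. energy N (\<lambda>i. X i + e *\<^sub>R X i) < s) (at_right 0)"
    using \<open>energy N X < s\<close> by (rule order_tendstoD(2))
  moreover have "eventually (\<lambda>e::real. 0 < e) (at_right 0)" by (rule eventually_at_right_less)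
  ultimately have "eventually (\<lambda>e. energy N (\<lambda>i. X i + e *\<^sub>R X i) < s \<and> 0 < e) (at_right (0::real))"
    by (rule eventually_conj)
  then obtain e :: real where e: "energy N (\<lambda>i. X i + e *\<^sub>R X i) < s" "0 < e"
    using eventually_happens'[of "at_right (0::real)"] by auto
  have "action N (\<lambda>i. X i + e *\<^sub>R X i) \<le> action N X"
    using e X(1) by (intro max) (auto simp: periodic_seq_def)
  moreover have "0 < e * (2 * action N X)" "0 \<le> e\<^sup>2 * action N X" using e assms(4) by simp_all
  ultimately show False
    unfolding action_add action_deriv_self by linarith
qed

text \<open>The midpoint rule for the Hamiltonian system, as Euler--Lagrange equation of the discrete
  problem; the multiplier and the trajectory are bounded independently of the step size.\<close>

lemma discrete_solution:
  assumes C: "0 < C" "\<And>u. G (2 *\<^sub>R u) \<le> C * G u + 1" and "0 < s" "0 < a"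
  shows "\<exists>l\<^sub>1 l\<^sub>2 B. 0 < l\<^sub>1 \<and> (\<forall>N Y. 0 < N \<longrightarrow> periodic_seq N Y \<longrightarrow> energy N Y \<le> s \<longrightarrow> a \<le> action N Y \<longrightarrow>
    (\<exists>X l. periodic_seq N X \<and> energy N X \<le> s \<and> a \<le> action N X \<and> l\<^sub>1 \<le> l \<and> l \<le> l\<^sub>2 \<and>
      (\<forall>i. real N *\<^sub>R (X (i + 1) - X i) = symp_J (g ((1 / l) *\<^sub>R (X i + X (i + 1))))) \<and>
      (\<forall>i. norm (X i) \<le> B)))"
proof -
  obtain K where K: "0 \<le> K" "\<And>v. norm v - K \<le> G v" using linear_growth by blast
  \<comment> \<open>\<open>R\<close> bounds the diameter of every admissible polygon, and some edge
    of the maximiser will have slope at most \<open>R\<close>.\<close>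
  define R where "R = s + K"
  have "R > 0" using assms(3) K by (simp add: R_def)
  have "compact (g ` cball 0 R)"
    by (intro compact_continuous_image continuous_on_subset[OF continuous_gradient]) auto
  then obtain M where M: "\<And>v. norm v \<le> R \<Longrightarrow> norm (g v) \<le> M"
    by (meson bounded_iff compact_imp_bounded image_eqI mem_cball_0)
  \<comment> \<open>The multiplier is \<open>2 * action N X / D\<close>; the action lies between
    \<open>a\<close> and \<open>R * R\<close>, and \<open>D\<close> between \<open>s\<close> and
    \<open>C * s + 1\<close>.\<close>
  define l\<^sub>1 where "l\<^sub>1 = 2 * a / (C * s + 1)"
  define l\<^sub>2 where "l\<^sub>2 = 2 * (R * R) / s"
  \<comment> \<open>Half of a bound \<open>l\<^sub>2 * M\<close> for the sum of two neighbouring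
    vertices plus two diameters.\<close>
  define B where "B = (l\<^sub>2 * M + 2 * R) / 2"
  have l1: "0 < l\<^sub>1" using assms by (simp add: l\<^sub>1_def add_pos_pos)
  have "\<exists>X l. periodic_seq N X \<and> energy N X \<le> s \<and> a \<le> action N X \<and> l\<^sub>1 \<le> l \<and> l \<le> l\<^sub>2 \<and>
      (\<forall>i. real N *\<^sub>R (X (i + 1) - X i) = symp_J (g ((1 / l) *\<^sub>R (X i + X (i + 1))))) \<and>
      (\<forall>i. norm (X i) \<le> B)"
    if N: "0 < N" and Y: "periodic_seq N Y" "energy N Y \<le> s" "a \<le> action N Y" for N Y
  proof -
    obtain X where X: "periodic_seq N X" "X 0 = 0" "energy N X \<le> s"
      and max: "\<forall>Z. periodic_seq N Z \<longrightarrow> energy N Z \<le> s \<longrightarrow> action N Z \<le> action N X"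
      using exists_action_maximizer[OF N Y(1,2)] .
    have aX: "a \<le> action N X" using max Y by force
    then have pos: "0 < action N X" using assms(4) by simp
    have osc: "norm (X i - X j) \<le> R" for i j
      unfolding R_def by (rule oscillation_le[OF X(1) N X(3) K(2)])
    have eqs: "energy N X = s"
      using maximizer_energy_eq[OF N X(1,3) pos] max by blast
    have mult: "action_deriv N X h = 2 * action N X / energy_deriv N X X * energy_deriv N X h"
      if "periodic_seq N h" for h
      by (rule maximizer_multiplier(2)[OF N X(1,3) pos _ that]) (use max in simp)
    define D where "D = energy_deriv N X X"
    define l where "l = 2 * action N X / D"
    have D: "s \<le> D" "D \<le> C * s + 1"
      using energy_le_energy_deriv_self[OF N, of X] energy_deriv_self_le[OF N C(2), of X] eqs
      by (simp_all add: D_def)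
    have "D > 0" using D assms(3) by simp
    have lpos: "0 < l" using pos \<open>D > 0\<close> by (simp add: l_def)
    have l1l: "l\<^sub>1 \<le> l"
      unfolding l\<^sub>1_def l_def using aX assms(4) D \<open>D > 0\<close> pos by (intro frac_le) auto
    \<comment> \<open>Length times radius: the edges have total length at most
      \<open>energy N X + K = R\<close>, and all vertices lie within \<open>R\<close> of
      \<open>X 0 = 0\<close>.\<close>
    have "action N X \<le> R * R"
    proof -
      have "action N X = (\<Sum>k<N. (X (int k + 1) - X (int k)) \<bullet> symp_J (X (int k)))"
        by (simp add: action_def inner_diff_left)
      also have "\<dots> \<le> (\<Sum>k<N. (G (real N *\<^sub>R (X (int k + 1) - X (int k))) + K) / real N * R)"
      proof (rule sum_mono)
        fix k
        have "(X (int k + 1) - X (int k)) \<bullet> symp_J (X (int k)) \<le>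
            norm (X (int k + 1) - X (int k)) * norm (X (int k))"
          using norm_cauchy_schwarz[of "X (int k + 1) - X (int k)" "symp_J (X (int k))"] by simp
        also have "norm (X (int k)) \<le> R" using osc[of "int k" 0] X(2) by simp
        also have "norm (X (int k + 1) - X (int k)) \<le> (G (real N *\<^sub>R (X (int k + 1) - X (int k))) + K) / real N"
        proof -
          have "norm (X (int k + 1) - X (int k)) * real N \<le> G (real N *\<^sub>R (X (int k + 1) - X (int k))) + K"
            using K(2)[of "real N *\<^sub>R (X (int k + 1) - X (int k))"]
            by (simp only: diff_le_eq norm_scaleR) (simp add: mult.commute)
          then show ?thesis using N by (simp only: pos_le_divide_eq of_nat_0_less_iff)
        qed
        finally show "(X (int k + 1) - X (int k)) \<bullet> symp_J (X (int k)) \<le>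
            (G (real N *\<^sub>R (X (int k + 1) - X (int k))) + K) / real N * R"
          using \<open>R > 0\<close> by (simp add: mult_left_mono mult_right_mono)
      qed
      also have "\<dots> = (energy N X + K) * R"
        using N by (simp add: energy_def sum.distrib add_divide_distrib flip: sum_distrib_right sum_divide_distrib)
      also have "\<dots> = R * R" using eqs by (simp add: R_def)
      finally show ?thesis .
    qed
    then have ll2: "l \<le> l\<^sub>2"
      unfolding l\<^sub>2_def l_def using D assms(3) pos \<open>R > 0\<close> by (intro frac_le) auto
    define v where "v i = real N *\<^sub>R (X (i + 1) - X i)" for i
    \<comment> \<open>The summed form of the Euler-Lagrange equation: stationarity says exactly that
      \<open>q\<close> does not depend on \<open>i\<close>, as for a first integral.\<close>
    define q where "q i = l *\<^sub>R g (v i) - symp_J (X i + X (i + 1))" for i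
    have perX: "X (i + int N) = X i" for i using X(1) by (simp add: periodic_seq_def)
    have perX1: "X (i + int N + 1) = X (i + 1)" "X (i + int N - 1) = X (i - 1)" for i
      using perX[of "i + 1"] perX[of "i - 1"] by (simp_all add: algebra_simps)
    have perq: "periodic_seq N q"
      by (simp add: periodic_seq_def q_def v_def perX perX1)
    \<comment> \<open>The residual \<open>h\<close> of the Euler--Lagrange equation, tested against itself, must vanish.\<close>
    define h where "h i = q (i - 1) - q i" for i
    have perh: "periodic_seq N h"
      using perq[unfolded periodic_seq_def, rule_format]
      by (simp add: periodic_seq_def h_def) (metis add_diff_eq diff_add_eq)
    have "0 = l * energy_deriv N X h - action_deriv N X h"
      using mult[OF perh] by (simp add: l_def D_def)
    also have "\<dots> = (\<Sum>k<N. h (int k) \<bullet> h (int k))"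
      unfolding energy_deriv_eq[OF X(1) perh] action_deriv_eq[OF X(1) perh]
        sum_distrib_left sum_subtractf[symmetric]
      by (intro sum.cong) (simp_all add: h_def q_def v_def algebra_simps)
    finally have "\<forall>k\<in>{..<N}. h (int k) \<bullet> h (int k) = 0"
      by (subst (asm) eq_commute, subst (asm) sum_nonneg_eq_0_iff) auto
    then have "q (int k - 1) = q (int k)" if "k < N" for k
      using that by (simp add: h_def)
    then have step: "q (int k) = q (int (Suc k))" if "Suc k < N" for k
      using that by (metis add_diff_cancel_left' of_nat_Suc)
    have "q (int k) = q 0" if "k < N" for k
      using that by (induction k) (use step in auto)
    then have q: "q i = q 0" for i
      using periodic_seq_mod[OF perq, of i] N
      by (metis Euclidean_Rings.pos_mod_bound Euclidean_Rings.pos_mod_sign nat_0_le nat_less_iff of_nat_0_less_iff)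
    \<comment> \<open>Translation by \<open>c\<close> absorbs the constant of integration, because
      \<open>symp_J (c + c) = q 0\<close>; energy and action do not change.\<close>
    define c where "c = - (1 / 2) *\<^sub>R symp_J (q 0)"
    define X' where "X' i = X i + c" for i
    have lg: "l *\<^sub>R g (v i) = symp_J (X' i + X' (i + 1))" for i
    proof -
      have "l *\<^sub>R g (v i) = symp_J (X i + X (i + 1)) + q 0" using q[of i] by (simp add: q_def algebra_simps)
      also have "q 0 = symp_J (c + c)" by (simp add: c_def flip: scaleR_2)
      finally show ?thesis by (simp add: X'_def)
    qed
    \<comment> \<open>Symplectic duality inverts the gradient and makes the slope an explicit
      function of the positions.\<close>
    have "v i = symp_J (g ((1 / l) *\<^sub>R (X' i + X' (i + 1))))" for i
    proof -
      have "g (v i) = (1 / l) *\<^sub>R (l *\<^sub>R g (v i))" using lpos by simp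
      also have "\<dots> = (1 / l) *\<^sub>R symp_J (X' i + X' (i + 1))" by (simp only: lg)
      finally have "- symp_J (g (v i)) = (1 / l) *\<^sub>R (X' i + X' (i + 1))" by (simp add: algebra_simps)
      then show ?thesis using eq_symp_gradient[of "v i"] by simp
    qed
    then have mid: "real N *\<^sub>R (X' (i + 1) - X' i) = symp_J (g ((1 / l) *\<^sub>R (X' i + X' (i + 1))))" for i
      by (simp add: X'_def v_def)
    \<comment> \<open>If all slopes exceeded \<open>R = s + K\<close>, each \<open>G (v k)\<close>
      would exceed \<open>s\<close>, and so would their mean. One moderate slope fixes the position
      of the whole translated polygon.\<close>
    have "\<exists>k<N. norm (v (int k)) \<le> R"
    proof (rule ccontr)
      assume "\<not> ?thesis"
      then have "s < G (v (int k))" if "k < N" for k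
        using K(2)[of "v (int k)"] that by (force simp: R_def)
      then have "(\<Sum>k<N. s) < (\<Sum>k<N. G (v (int k)))"
        using N by (intro sum_strict_mono) auto
      then have "s < energy N X" using N by (simp add: energy_def v_def field_simps)
      then show False using eqs by simp
    qed
    then obtain k where k: "norm (v (int k)) \<le> R" by blast
    have bound: "norm (X' i) \<le> B" for i
    proof -
      have "norm (X' (int k) + X' (int k + 1)) = l * norm (g (v (int k)))"
        using arg_cong[OF lg[of "int k"], of norm] lpos by (simp del: symp_J_simps(4))
      also have "\<dots> \<le> l\<^sub>2 * M"
        using M[OF k] ll2 lpos by (intro mult_mono) auto
      finally have 1: "norm (X' (int k) + X' (int k + 1)) \<le> l\<^sub>2 * M" .
      have "2 *\<^sub>R X' i = (X' (int k) + X' (int k + 1)) + (X i - X (int k)) + (X i - X (int k + 1))"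
        by (simp add: X'_def scaleR_2)
      then have "norm (2 *\<^sub>R X' i) \<le> norm (X' (int k) + X' (int k + 1)) + norm (X i - X (int k)) + norm (X i - X (int k + 1))"
        by (metis (no_types) add_right_mono norm_triangle_ineq order_trans)
      then show ?thesis
        using 1 osc[of i "int k"] osc[of i "int k + 1"] by (simp add: B_def)
    qed
    show ?thesis
    proof (intro exI[of _ X'] exI[of _ l] conjI allI)
      show "periodic_seq N X'" using X(1) by (simp add: periodic_seq_def X'_def)
      have eq: "X' = (\<lambda>i. X i + c)" by (simp add: X'_def fun_eq_iff)
      show "energy N X' \<le> s" unfolding eq energy_translate by (rule X(3))
      show "a \<le> action N X'" unfolding eq action_translate[OF X(1)] by (rule aX)
    qed (fact l1l ll2 mid bound)+
  qed
  then show ?thesis using l1 by blast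
qed

end

section \<open>Passage to the limit\<close>

text \<open>The estimate adds up across breakpoints, so it extends from pieces of cells to intervals
  by induction on the cells met. With \<open>w = 0\<close> it yields a Lipschitz bound, with
  \<open>w\<close> a limiting slope the differentiability of the limit.\<close>

lemma piecewise_affine_bound:
  fixes f :: "real \<Rightarrow> 'a::real_normed_vector"
  assumes N: "0 < N"
    and cell: "\<And>i a b. real_of_int i \<le> real N * a \<Longrightarrow> a \<le> b \<Longrightarrow> real N * b \<le> real_of_int i + 1 \<Longrightarrow>
      p \<le> a \<Longrightarrow> b \<le> q \<Longrightarrow> norm (f b - f a - (b - a) *\<^sub>R w) \<le> e * (b - a)"
    and "p \<le> a" "a \<le> b" "b \<le> q"
  shows "norm (f b - f a - (b - a) *\<^sub>R w) \<le> e * (b - a)"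
proof -
  have *: "norm (f b - f a - (b - a) *\<^sub>R w) \<le> e * (b - a)"
    if "real_of_int i \<le> real N * a" "a \<le> b" "real N * b \<le> real_of_int i + real k + 1" "p \<le> a" "b \<le> q" for i k a b
    using that
  proof (induction k arbitrary: i a)
    case 0
    then show ?case using cell[of i a b] by simp
  next
    case (Suc k)
    define c where "c = (real_of_int i + 1) / real N"
    have c: "real N * c = real_of_int i + 1" using N by (simp add: c_def)
    consider "real N * b \<le> real_of_int i + 1" | "real_of_int i + 1 \<le> real N * a"
      | "real N * a \<le> real N * c" "real N * c \<le> real N * b" using c by linarith
    then show ?case
    proof cases
      case 1
      then show ?thesis using cell[of i a b] Suc.prems by simp
    next
      case 2
      then show ?thesis using Suc.IH[of "i + 1" a] Suc.prems by simp
    next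
      case 3
      then have abc: "a \<le> c" "c \<le> b" using N by simp_all
      have "norm (f c - f a - (c - a) *\<^sub>R w) \<le> e * (c - a)"
        using cell[of i a c] Suc.prems abc c by simp
      moreover have "norm (f b - f c - (b - c) *\<^sub>R w) \<le> e * (b - c)"
        using Suc.IH[of "i + 1" c] Suc.prems abc c by simp
      moreover have "f b - f a - (b - a) *\<^sub>R w = (f c - f a - (c - a) *\<^sub>R w) + (f b - f c - (b - c) *\<^sub>R w)"
        by (simp add: algebra_simps)
      then have "norm (f b - f a - (b - a) *\<^sub>R w) \<le> norm (f c - f a - (c - a) *\<^sub>R w) + norm (f b - f c - (b - c) *\<^sub>R w)"
        by (metis norm_triangle_ineq)
      ultimately show ?thesis by (simp add: algebra_simps)
    qed
  qed
  show ?thesis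
  proof (rule *)
    show "real_of_int \<lfloor>real N * a\<rfloor> \<le> real N * a" by simp
    have "real N * b \<le> real_of_int \<lceil>real N * b\<rceil>" by simp
    also have "real_of_int \<lceil>real N * b\<rceil> \<le> real_of_int \<lfloor>real N * a\<rfloor> + real (nat (\<lceil>real N * b\<rceil> - \<lfloor>real N * a\<rfloor>)) + 1"
      by linarith
    finally show "real N * b \<le> real_of_int \<lfloor>real N * a\<rfloor> + real (nat (\<lceil>real N * b\<rceil> - \<lfloor>real N * a\<rfloor>)) + 1" .
  qed (use assms in auto)
qed

section \<open>Riemann sums and polygonal interpolation\<close>

lemma integral_cells:
  fixes f :: "real \<Rightarrow> 'a::euclidean_space"
  assumes N: "0 < N" and f: "f integrable_on {0..1}"
  shows "integral {0..1} f = (\<Sum>k<N. integral {real k / real N..(real k + 1) / real N} f)"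
proof -
  have "integral {0..real m / real N} f = (\<Sum>k<m. integral {real k / real N..(real k + 1) / real N} f)"
    if "m \<le> N" for m
    using that
  proof (induction m)
    case (Suc m)
    have "integral {0..real m / real N} f + integral {real m / real N..real (Suc m) / real N} f =
        integral {0..real (Suc m) / real N} f"
    proof (rule Henstock_Kurzweil_Integration.integral_combine)
      show "f integrable_on {0..real (Suc m) / real N}"
        using f by (rule integrable_on_subinterval) (use Suc.prems N in auto)
    qed (use N in \<open>auto simp: divide_right_mono\<close>)
    then show ?case using Suc by (simp add: add.commute)
  qed simp
  from this[of N] show ?thesis using N by simp
qed

text \<open>The values \<open>c k\<close> need only be close to \<open>f\<close> on the cell; they
  will come from the discrete solution, not from sampling \<open>f\<close>.\<close>

lemma riemann_sum_error:
  fixes f :: "real \<Rightarrow> real"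
  assumes N: "0 < N" and f: "f integrable_on {0..1}"
    and close: "\<And>k t. k < N \<Longrightarrow> real k \<le> real N * t \<Longrightarrow> real N * t \<le> real k + 1 \<Longrightarrow> \<bar>f t - c k\<bar> \<le> e"
  shows "\<bar>integral {0..1} f - (\<Sum>k<N. c k) / real N\<bar> \<le> e"
proof -
  have cell: "\<bar>integral {real k / real N..(real k + 1) / real N} f - c k / real N\<bar> \<le> e / real N" if k: "k < N" for k
  proof -
    let ?I = "{real k / real N..(real k + 1) / real N}"
    have "f integrable_on ?I"
      using f by (rule integrable_on_subinterval) (use k N in \<open>auto simp: field_simps\<close>)
    have le: "real k / real N \<le> (real k + 1) / real N" by (simp add: divide_right_mono)
    have "((\<lambda>t. f t - c k) has_integral (integral ?I f - c k * (1 / real N))) ?I"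
      using has_integral_diff[OF integrable_integral[OF \<open>f integrable_on ?I\<close>] has_integral_const_real[of "c k" "real k / real N" "(real k + 1) / real N"]] le
      by (simp add: diff_divide_distrib[symmetric] field_simps)
    moreover have "0 \<le> e" using close[of k "real k / real N"] k N by fastforce
    ultimately have "norm (integral ?I f - c k * (1 / real N)) \<le> e * measure lborel (cbox (real k / real N) ((real k + 1) / real N))"
      by (intro has_integral_bound[where f="\<lambda>t. f t - c k"]) (use close[OF k] N in \<open>auto simp: field_simps\<close>)
    also have "measure lborel (cbox (real k / real N) ((real k + 1) / real N)) = 1 / real N"
      using le by (simp add: diff_divide_distrib[symmetric])
    finally show ?thesis by simp
  qed
  have "integral {0..1} f - (\<Sum>k<N. c k) / real N =
      (\<Sum>k<N. integral {real k / real N..(real k + 1) / real N} f - c k / real N)"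
    by (simp add: integral_cells[OF N f] sum_subtractf sum_divide_distrib)
  also have "\<bar>\<dots>\<bar> \<le> (\<Sum>k<N. e / real N)"
    by (intro order_trans[OF sum_abs] sum_mono cell) auto
  also have "\<dots> = e" using N by simp
  finally show ?thesis .
qed

definition interp :: "nat \<Rightarrow> (int \<Rightarrow> 'a::real_vector) \<Rightarrow> real \<Rightarrow> 'a" where
  "interp N X t = X \<lfloor>real N * t\<rfloor> + (real N * t - of_int \<lfloor>real N * t\<rfloor>) *\<^sub>R (X (\<lfloor>real N * t\<rfloor> + 1) - X \<lfloor>real N * t\<rfloor>)"

text \<open>The formula holds on closed cells, so a breakpoint may be assigned to either
  neighbour.\<close>

lemma interp_cell:
  assumes "real_of_int i \<le> real N * t" "real N * t \<le> real_of_int i + 1"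
  shows "interp N X t = X i + (real N * t - of_int i) *\<^sub>R (X (i + 1) - X i)"
proof (cases "real N * t = real_of_int i + 1")
  case True
  then have "\<lfloor>real N * t\<rfloor> = i + 1" by (metis floor_of_int of_int_1 of_int_add)
  then show ?thesis using True by (simp add: interp_def)
next
  case False
  then have "\<lfloor>real N * t\<rfloor> = i" using assms by (intro floor_unique) auto
  then show ?thesis by (simp add: interp_def)
qed

lemma interp_add_int:
  assumes "periodic_seq N X"
  shows "interp N X (t + of_int m) = interp N X t"
proof -
  have X: "X (i + int N * m) = X i" for i
    using periodic_seq_mod[OF assms, of "i + int N * m"] periodic_seq_mod[OF assms, of i] by simp
  have "real N * (t + of_int m) = real N * t + of_int (int N * m)" by (simp add: algebra_simps)
  then have "\<lfloor>real N * (t + of_int m)\<rfloor> = \<lfloor>real N * t\<rfloor> + int N * m" by (metis floor_add_int)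
  then show ?thesis
    using X[of "\<lfloor>real N * t\<rfloor>"] X[of "\<lfloor>real N * t\<rfloor> + 1"]
    by (simp add: interp_def algebra_simps)
qed

lemma interp_close:
  assumes "real_of_int i \<le> real N * t" "real N * t \<le> real_of_int i + 1"
  shows "norm (interp N X t - X i) \<le> norm (X (i + 1) - X i)"
    and "norm (interp N X t - X (i + 1)) \<le> norm (X (i + 1) - X i)"
proof -
  define r where "r = real N * t - of_int i"
  have r: "0 \<le> r" "r \<le> 1" using assms by (auto simp: r_def)
  have eq: "interp N X t = X i + r *\<^sub>R (X (i + 1) - X i)" using interp_cell[OF assms] by (simp add: r_def)
  show "norm (interp N X t - X i) \<le> norm (X (i + 1) - X i)"
    unfolding eq using r by (simp add: mult_left_le_one_le)
  have "interp N X t - X (i + 1) = (r - 1) *\<^sub>R (X (i + 1) - X i)" unfolding eq by (simp add: algebra_simps)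
  then show "norm (interp N X t - X (i + 1)) \<le> norm (X (i + 1) - X i)"
    using r by (simp add: mult_left_le_one_le)
qed

lemma interp_slope:
  assumes "real_of_int i \<le> real N * a" "a \<le> b" "real N * b \<le> real_of_int i + 1" "0 < N"
    and "norm (real N *\<^sub>R (X (i + 1) - X i) - w) \<le> e"
  shows "norm (interp N X b - interp N X a - (b - a) *\<^sub>R w) \<le> e * (b - a)"
proof -
  have ab: "real N * a \<le> real N * b" using assms by simp
  have E: "interp N X a = X i + (real N * a - of_int i) *\<^sub>R (X (i + 1) - X i)"
    "interp N X b = X i + (real N * b - of_int i) *\<^sub>R (X (i + 1) - X i)"
    using assms ab by (intro interp_cell; linarith)+
  have "interp N X b - interp N X a - (b - a) *\<^sub>R w = (b - a) *\<^sub>R (real N *\<^sub>R (X (i + 1) - X i) - w)"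
    unfolding E by (simp add: algebra_simps)
  then show ?thesis using mult_left_mono[OF assms(5), of "b - a"] assms(2) by (simp add: mult.commute)
qed

text \<open>By the midpoint rule a slope is a fixed continuous function \<Psi> of the multiplier and
  of two neighbouring vertices. Uniform convergence of the polygons therefore forces uniform
  convergence of their slopes, which gives the differential equation and the limits of all Riemann
  sums in slope and position. The general \<open>H\<close> covers action and energy at once.\<close>

lemma (in symplectic_G_function) midpoint_rule_limit:
  fixes X :: "nat \<Rightarrow> int \<Rightarrow> (real^'n) \<times> (real^'n)" and N :: "nat \<Rightarrow> nat" and l :: "nat \<Rightarrow> real"
  assumes N: "\<And>n. n < N n" and per: "\<And>n. periodic_seq (N n) (X n)"
    and l: "0 < l\<^sub>1" "\<And>n. l\<^sub>1 \<le> l n" "\<And>n. l n \<le> l\<^sub>2"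
    and mid: "\<And>n i. real (N n) *\<^sub>R (X n (i + 1) - X n i) = symp_J (g ((1 / l n) *\<^sub>R (X n i + X n (i + 1))))"
    and bnd: "\<And>n i. norm (X n i) \<le> B"
  shows "\<exists>u m r. 0 < m \<and> strict_mono r \<and> (\<forall>t. (u has_vector_derivative symp_J (g (m *\<^sub>R u t))) (at t)) \<and>
    (\<forall>t. u (t + 1) = u t) \<and>
    (\<forall>H. continuous_on UNIV H \<longrightarrow>
      (\<lambda>n. (\<Sum>k<N (r n). H (real (N (r n)) *\<^sub>R (X (r n) (int k + 1) - X (r n) (int k)), X (r n) (int k))) / real (N (r n)))
        \<longlonglongrightarrow> (integral {0..1} (\<lambda>t. H (symp_J (g (m *\<^sub>R u t)), u t)) :: real))"
proof -
  have Npos: "0 < N n" for n using N[of n] by simp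
  have "0 \<le> B" using bnd[of 0 0] norm_ge_zero order_trans by blast
  have lpos: "0 < l n" for n using l(1) l(2)[of n] by linarith
  define V where "V n i = real (N n) *\<^sub>R (X n (i + 1) - X n i)" for n i
  define \<Psi> :: "real \<times> (real^'n) \<times> (real^'n) \<Rightarrow> (real^'n) \<times> (real^'n)"
    where "\<Psi> p = symp_J (g (fst p *\<^sub>R snd p))" for p
  have V: "V n i = \<Psi> (1 / l n, X n i + X n (i + 1))" for n i by (simp add: V_def \<Psi>_def mid)
  have cont\<Psi>: "continuous_on A \<Psi>" for A
    unfolding \<Psi>_def
    by (intro bounded_linear.continuous_on[OF bounded_linear_symp_J]
        continuous_on_compose2[OF continuous_gradient] continuous_intros) auto
  \<comment> \<open>The radius covers both sums of two vertices, of norm at most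
    \<open>2 * B\<close>, and \<open>2 *\<^sub>R u t\<close> for the limit, of norm at most
    \<open>6 * B\<close>.\<close>
  define S where "S = {0..1 / l\<^sub>1} \<times> cball (0 :: (real^'n) \<times> (real^'n)) (6 * B)"
  have "compact S" unfolding S_def by (intro compact_Times) auto
  have "bounded (\<Psi> ` S)" by (intro compact_imp_bounded compact_continuous_image cont\<Psi> \<open>compact S\<close>)
  then obtain L where "0 < L" and L: "\<forall>y\<in>\<Psi> ` S. norm y \<le> L"
    using bounded_pos by blast
  have lS: "1 / l n \<in> {0..1 / l\<^sub>1}" for n
    using l(1) l(2)[of n] lpos[of n] by (auto intro!: divide_left_mono)
  have XX: "norm (X n i + X n (i + 1)) \<le> 2 * B" for n i
    using norm_triangle_ineq[of "X n i" "X n (i + 1)"] bnd[of n i] bnd[of n "i + 1"] by linarith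
  have XS: "(1 / l n, X n i + X n (i + 1)) \<in> S" for n i
    using lS[of n] XX[of n i] \<open>0 \<le> B\<close> by (simp add: S_def)
  have VL: "norm (V n i) \<le> L" for n i using L XS[of n i] V by auto
  have dX: "norm (X n (i + 1) - X n i) \<le> L / real (N n)" for n i
    using VL[of n i] Npos[of n] unfolding V_def norm_scaleR by (simp add: pos_le_divide_eq mult.commute)
  define f where "f n = interp (N n) (X n)" for n
  have flip: "norm (f n b - f n a) \<le> L * \<bar>b - a\<bar>" for n a b
  proof -
    have *: "norm (f n b - f n a - (b - a) *\<^sub>R 0) \<le> L * (b - a)" if "a \<le> b" for a b
    proof (rule piecewise_affine_bound[OF Npos[of n], of a b])
      fix i x y assume "real_of_int i \<le> real (N n) * x" "x \<le> y" "real (N n) * y \<le> real_of_int i + 1"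
      then show "norm (f n y - f n x - (y - x) *\<^sub>R 0) \<le> L * (y - x)"
        unfolding f_def by (rule interp_slope) (use Npos VL[of n i] in \<open>auto simp: V_def\<close>)
    qed (use that in auto)
    show ?thesis using *[of a b] *[of b a] by (cases "a \<le> b") (auto simp: norm_minus_commute)
  qed
  have fclose: "norm (f n t - X n i) \<le> L / real (N n)" "norm (f n t - X n (i + 1)) \<le> L / real (N n)"
    if "real_of_int i \<le> real (N n) * t" "real (N n) * t \<le> real_of_int i + 1" for n t i
    using interp_close[OF that, of "X n"] dX[of n i] by (auto simp: f_def)
  have fB: "norm (f n t) \<le> 3 * B" for n t
  proof -
    define i where "i = \<lfloor>real (N n) * t\<rfloor>"
    have "norm (f n t - X n i) \<le> norm (X n (i + 1) - X n i)"
      unfolding f_def by (rule interp_close) (auto simp: i_def)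
    also have "\<dots> \<le> norm (X n (i + 1)) + norm (X n i)" by (rule norm_triangle_ineq4)
    finally show ?thesis
      using bnd[of n i] bnd[of n "i + 1"] norm_triangle_ineq2[of "f n t" "X n i"] by linarith
  qed
  obtain \<mu> r0 where \<mu>: "\<mu> \<in> {l\<^sub>1..l\<^sub>2}" and r0: "strict_mono (r0 :: nat \<Rightarrow> nat)" and lim0: "(l \<circ> r0) \<longlonglongrightarrow> \<mu>"
    using compact_Icc[of l\<^sub>1 l\<^sub>2] l unfolding compact_def by (metis atLeastAtMost_iff)
  have equi: "\<exists>d>0. \<forall>n y. y \<in> {0..1} \<and> norm (x - y) < d \<longrightarrow> norm (f (r0 n) x - f (r0 n) y) < e" if "0 < e" for x e
  proof (intro exI[of _ "e / L"] conjI allI impI)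
    fix n y assume "y \<in> {0..1} \<and> norm (x - y) < e / L"
    then have "L * \<bar>x - y\<bar> < e" using \<open>0 < L\<close> by (simp add: field_simps)
    then show "norm (f (r0 n) x - f (r0 n) y) < e" using flip[of "r0 n" x y] by linarith
  qed (use that \<open>0 < L\<close> in simp)
  obtain u0 k where k: "strict_mono (k :: nat \<Rightarrow> nat)"
    and u0: "\<And>e. 0 < e \<Longrightarrow> \<exists>n0. \<forall>n x. n \<ge> n0 \<and> x \<in> {0..1} \<longrightarrow> norm (f (r0 (k n)) x - u0 x) < e"
    using Arzela_Ascoli[of "{0..1::real}" "\<lambda>n. f (r0 n)" "3 * B", OF compact_Icc fB equi] by metis
  define r where "r n = r0 (k n)" for n
  have r: "strict_mono r" using r0 k by (auto simp: r_def strict_mono_def)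
  have rn: "n \<le> r n" for n by (rule seq_suble[OF r])
  \<comment> \<open>Convergence is obtained on one period and extended to the line through the
    fractional part.\<close>
  define u where "u t = u0 (frac t)" for t
  have ffrac: "f n (frac t) = f n t" for n t
    using interp_add_int[OF per[of n], of "frac t" "\<lfloor>t\<rfloor>"] by (simp add: f_def frac_def)
  have conv: "\<exists>n0. \<forall>n\<ge>n0. \<forall>t. norm (f (r n) t - u t) < e" if e: "0 < e" for e
  proof -
    obtain n0 where n0: "\<forall>n x. n \<ge> n0 \<and> x \<in> {0..1} \<longrightarrow> norm (f (r n) x - u0 x) < e"
      using u0[OF e] unfolding r_def by blast
    have "norm (f (r n) t - u t) < e" if "n \<ge> n0" for n t
    proof -
      have "frac t \<in> {0..1}" using frac_ge_0[of t] frac_lt_1[of t] by simp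
      then show ?thesis using n0 that ffrac[of "r n" t] unfolding u_def by metis
    qed
    then show ?thesis by blast
  qed
  have lim: "(\<lambda>n. f (r n) t) \<longlonglongrightarrow> u t" for t
    unfolding LIMSEQ_iff using conv by meson
  have ulip: "norm (u b - u a) \<le> L * \<bar>b - a\<bar>" for a b
    by (rule tendsto_upperbound[OF tendsto_norm[OF tendsto_diff[OF lim lim]]]) (auto simp: flip)
  have uB: "norm (u t) \<le> 3 * B" for t
    by (rule tendsto_upperbound[OF tendsto_norm[OF lim]]) (auto simp: fB)
  have contu: "continuous_on A u" for A
  proof (rule continuous_on_subset[OF _ subset_UNIV], unfold continuous_on_iff, intro ballI allI impI)
    fix x e :: real assume "0 < e"
    show "\<exists>d>0. \<forall>x'\<in>UNIV. dist x' x < d \<longrightarrow> dist (u x') (u x) < e"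
    proof (intro exI[of _ "e / L"] conjI ballI impI)
      fix y assume "dist y x < e / L"
      then have "L * \<bar>y - x\<bar> < e" using \<open>0 < L\<close> by (simp add: field_simps dist_real_def)
      then show "dist (u y) (u x) < e" using ulip[of y x] by (simp add: dist_norm)
    qed (use \<open>0 < e\<close> \<open>0 < L\<close> in simp)
  qed
  have "0 < \<mu>" using \<mu> l(1) by simp
  have liml: "(\<lambda>n. 1 / l (r n)) \<longlonglongrightarrow> 1 / \<mu>"
  proof -
    have "(\<lambda>n. l (r0 (k n))) \<longlonglongrightarrow> \<mu>"
      using LIMSEQ_subseq_LIMSEQ[OF lim0 k] by (simp add: o_def)
    then show ?thesis unfolding r_def using \<open>0 < \<mu>\<close> by (intro tendsto_divide) auto
  qed
  \<comment> \<open>Two neighbouring vertices have the same limit, so their sum tends to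
    \<open>2 *\<^sub>R u t\<close>; this is the origin of the factor \<open>2 / \<mu>\<close>, the
    final \<open>m\<close>.\<close>
  define w where "w t = \<Psi> (1 / \<mu>, 2 *\<^sub>R u t)" for t
  have w: "w t = symp_J (g ((2 / \<mu>) *\<^sub>R u t))" for t by (simp add: w_def \<Psi>_def)
  have wS: "(1 / \<mu>, 2 *\<^sub>R u t) \<in> S" for t
    using \<mu> l(1) uB[of t] by (auto simp: S_def intro!: divide_left_mono)
  have wL: "norm (w t) \<le> L" for t using L wS[of t] by (auto simp: w_def)
  have contw: "continuous_on A w" for A
    unfolding w_def by (intro continuous_on_compose2[OF cont\<Psi>[of UNIV]] continuous_intros contu) auto
  \<comment> \<open>Slopes and vertices of late polygons are close to \<open>w\<close> and
    \<open>u\<close> uniformly in time, even when read at a nearby time \<open>t0\<close>; this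
    shift is what the difference quotient needs.\<close>
  have U: "\<exists>d>0. \<exists>n0. \<forall>n\<ge>n0. \<forall>i t t0. real_of_int i \<le> real (N (r n)) * t \<longrightarrow> real (N (r n)) * t \<le> real_of_int i + 1 \<longrightarrow>
      \<bar>t - t0\<bar> < d \<longrightarrow> norm (V (r n) i - w t0) < e \<and> norm (X (r n) i - u t0) < e" if e: "0 < e" for e
  proof -
    have "uniformly_continuous_on S \<Psi>"
      by (intro compact_uniformly_continuous cont\<Psi> \<open>compact S\<close>)
    then obtain d1 where "d1 > 0" and d1: "\<And>p q. p \<in> S \<Longrightarrow> q \<in> S \<Longrightarrow> dist q p < d1 \<Longrightarrow> dist (\<Psi> q) (\<Psi> p) < e"
      unfolding uniformly_continuous_on_def using e by blast
    \<comment> \<open>A quarter of \<open>d1\<close> for each of the two vertices and one for the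
      multiplier; within \<rho>, thirds go to mesh size, convergence and the shift in time.\<close>
    define \<rho> where "\<rho> = min e (d1 / 4)"
    have "0 < \<rho>" "\<rho> \<le> e" "\<rho> \<le> d1 / 4" using \<open>0 < e\<close> \<open>0 < d1\<close> by (auto simp: \<rho>_def)
    obtain n1 where n1: "\<forall>n\<ge>n1. \<forall>t. norm (f (r n) t - u t) < \<rho> / 3" using conv[of "\<rho> / 3"] \<open>0 < \<rho>\<close> by auto
    obtain n2 :: nat where n2: "3 * L / \<rho> < real n2" using reals_Archimedean2 by blast
    have "eventually (\<lambda>n. \<bar>1 / l (r n) - 1 / \<mu>\<bar> < d1 / 4) sequentially"
      using liml \<open>0 < d1\<close> unfolding tendsto_iff dist_real_def by (metis zero_less_divide_iff zero_less_numeral)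
    then obtain n3 where n3: "\<forall>n\<ge>n3. \<bar>1 / l (r n) - 1 / \<mu>\<bar> < d1 / 4"
      unfolding eventually_sequentially by blast
    show ?thesis
    proof (intro exI[of _ "\<rho> / (3 * L)"] exI[of _ "max n1 (max n2 n3)"] conjI allI impI)
      show "0 < \<rho> / (3 * L)" using \<open>0 < \<rho>\<close> \<open>0 < L\<close> by simp
      fix n i t t0
      assume n: "max n1 (max n2 n3) \<le> n" and it: "real_of_int i \<le> real (N (r n)) * t" "real (N (r n)) * t \<le> real_of_int i + 1"
        and t: "\<bar>t - t0\<bar> < \<rho> / (3 * L)"
      have "real n2 \<le> real (N (r n))" using n rn[of n] N[of "r n"] by simp
      then have "3 * L / \<rho> < real (N (r n))" using n2 by linarith
      then have s1: "L / real (N (r n)) < \<rho> / 3" using \<open>0 < \<rho>\<close> Npos[of "r n"] by (simp add: field_simps)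
      have s2: "norm (f (r n) t - u t) < \<rho> / 3" using n1 n by simp
      have "L * \<bar>t - t0\<bar> < \<rho> / 3" using t \<open>0 < L\<close> by (simp add: field_simps)
      then have s3: "norm (u t - u t0) < \<rho> / 3" using ulip[of t t0] by linarith
      have near: "norm (x - u t0) < \<rho>" if "norm (f (r n) t - x) \<le> L / real (N (r n))" for x
      proof -
        have "x - u t0 = - (f (r n) t - x) + (f (r n) t - u t) + (u t - u t0)" by simp
        then have "norm (x - u t0) \<le> norm (- (f (r n) t - x)) + norm (f (r n) t - u t) + norm (u t - u t0)"
          by (metis norm_triangle_mono order_refl norm_triangle_ineq)
        then show ?thesis using that s1 s2 s3 by (simp only: norm_minus_cancel)
      qed
      note X1 = near[OF fclose(1)[OF it]] and X2 = near[OF fclose(2)[OF it]]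
      show "norm (X (r n) i - u t0) < e" using X1 \<open>\<rho> \<le> e\<close> by simp
      have "X (r n) i + X (r n) (i + 1) - 2 *\<^sub>R u t0 = (X (r n) i - u t0) + (X (r n) (i + 1) - u t0)"
        by (simp add: scaleR_2)
      then have "norm (X (r n) i + X (r n) (i + 1) - 2 *\<^sub>R u t0) \<le> norm (X (r n) i - u t0) + norm (X (r n) (i + 1) - u t0)"
        by (metis norm_triangle_ineq)
      then have *: "norm (X (r n) i + X (r n) (i + 1) - 2 *\<^sub>R u t0) < d1 / 2"
        using X1 X2 \<open>\<rho> \<le> d1 / 4\<close> by linarith
      have "dist (1 / l (r n), X (r n) i + X (r n) (i + 1)) (1 / \<mu>, 2 *\<^sub>R u t0) \<le>
          norm (1 / l (r n) - 1 / \<mu>) + norm (X (r n) i + X (r n) (i + 1) - 2 *\<^sub>R u t0)"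
        unfolding dist_norm diff_Pair by (rule norm_Pair_le)
      also have "\<dots> < d1 / 4 + d1 / 2"
        using n3 n * by (intro add_strict_mono) auto
      finally have "dist (1 / l (r n), X (r n) i + X (r n) (i + 1)) (1 / \<mu>, 2 *\<^sub>R u t0) < d1" using \<open>0 < d1\<close> by simp
      from d1[OF wS XS this] show "norm (V (r n) i - w t0) < e" by (simp add: V w_def dist_norm)
    qed
  qed
  have deriv: "(u has_vector_derivative w t0) (at t0)" for t0
    unfolding has_vector_derivative_def has_derivative_within_alt
  proof (intro conjI allI impI)
    show "bounded_linear (\<lambda>y. y *\<^sub>R w t0)" by (rule bounded_linear_scaleR_left)
    fix e :: real assume "0 < e"
    obtain d n0 where "d > 0" and d: "\<forall>n\<ge>n0. \<forall>i t t0. real_of_int i \<le> real (N (r n)) * t \<longrightarrow> real (N (r n)) * t \<le> real_of_int i + 1 \<longrightarrow>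
      \<bar>t - t0\<bar> < d \<longrightarrow> norm (V (r n) i - w t0) < e \<and> norm (X (r n) i - u t0) < e"
      using U[OF \<open>0 < e\<close>] by blast
    \<comment> \<open>The secant bound holds for each late polygon with the same constants, hence
      for the limit.\<close>
    have *: "norm (u b - u a - (b - a) *\<^sub>R w t0) \<le> e * (b - a)" if ab: "a \<le> b" "t0 - d < a" "b < t0 + d" for a b
    proof -
      have "norm (f (r n) b - f (r n) a - (b - a) *\<^sub>R w t0) \<le> e * (b - a)" if "n \<ge> n0" for n
      proof (rule piecewise_affine_bound[OF Npos[of "r n"], of a b])
        fix i x y assume xy: "real_of_int i \<le> real (N (r n)) * x" "x \<le> y" "real (N (r n)) * y \<le> real_of_int i + 1" "a \<le> x" "y \<le> b"
        have "real (N (r n)) * x \<le> real (N (r n)) * y" using xy by (simp add: mult_left_mono)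
        then have "norm (V (r n) i - w t0) < e"
          using d[rule_format, OF that xy(1), of t0] xy ab by auto
        then show "norm (f (r n) y - f (r n) x - (y - x) *\<^sub>R w t0) \<le> e * (y - x)"
          unfolding f_def using xy Npos by (intro interp_slope) (auto simp: V_def)
      qed (use ab in auto)
      then have "eventually (\<lambda>n. norm (f (r n) b - f (r n) a - (b - a) *\<^sub>R w t0) \<le> e * (b - a)) sequentially"
        unfolding eventually_sequentially by blast
      then show ?thesis
        by (rule tendsto_upperbound[rotated]) (simp, intro tendsto_intros lim)
    qed
    show "\<exists>d>0. \<forall>y\<in>UNIV. norm (y - t0) < d \<longrightarrow> norm (u y - u t0 - (y - t0) *\<^sub>R w t0) \<le> e * norm (y - t0)"
    proof (intro exI[of _ d] conjI ballI impI \<open>0 < d\<close>)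
      fix y assume y: "norm (y - t0) < d"
      show "norm (u y - u t0 - (y - t0) *\<^sub>R w t0) \<le> e * norm (y - t0)"
      proof (cases "t0 \<le> y")
        case True
        then show ?thesis using *[of t0 y] y \<open>0 < d\<close> by simp
      next
        case False
        have "u y - u t0 - (y - t0) *\<^sub>R w t0 = - (u t0 - u y - (t0 - y) *\<^sub>R w t0)" by (simp add: algebra_simps)
        then have "norm (u y - u t0 - (y - t0) *\<^sub>R w t0) = norm (u t0 - u y - (t0 - y) *\<^sub>R w t0)"
          by (simp only: norm_minus_cancel)
        then show ?thesis using *[of y t0] y False \<open>0 < d\<close> by simp
      qed
    qed
  qed
  have riemann: "(\<lambda>n. (\<Sum>k<N (r n). H (V (r n) (int k), X (r n) (int k))) / real (N (r n)))
        \<longlonglongrightarrow> (integral {0..1} (\<lambda>t. H (w t, u t)) :: real)" if H: "continuous_on UNIV H" for H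
    unfolding LIMSEQ_iff
  proof (intro allI impI)
    fix e :: real assume "0 < e"
    define S' where "S' = cball (0 :: (real^'n) \<times> (real^'n)) L \<times> cball (0 :: (real^'n) \<times> (real^'n)) (3 * B)"
    have "uniformly_continuous_on S' H"
      unfolding S'_def by (intro compact_uniformly_continuous continuous_on_subset[OF H] compact_Times) auto
    then obtain d1 where "d1 > 0" and d1: "\<And>p q. p \<in> S' \<Longrightarrow> q \<in> S' \<Longrightarrow> dist q p < d1 \<Longrightarrow> dist (H q) (H p) < e / 2"
      unfolding uniformly_continuous_on_def using \<open>0 < e\<close> by (metis half_gt_zero)
    obtain d n0 where "d > 0" and d: "\<forall>n\<ge>n0. \<forall>i t t0. real_of_int i \<le> real (N (r n)) * t \<longrightarrow> real (N (r n)) * t \<le> real_of_int i + 1 \<longrightarrow>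
      \<bar>t - t0\<bar> < d \<longrightarrow> norm (V (r n) i - w t0) < d1 / 2 \<and> norm (X (r n) i - u t0) < d1 / 2"
      using U[of "d1 / 2"] \<open>0 < d1\<close> by auto
    show "\<exists>n0. \<forall>n\<ge>n0. norm ((\<Sum>k<N (r n). H (V (r n) (int k), X (r n) (int k))) / real (N (r n)) -
         integral {0..1} (\<lambda>t. H (w t, u t))) < e"
    proof (intro exI[of _ n0] allI impI)
      fix n assume n: "n0 \<le> n"
      have "\<bar>integral {0..1} (\<lambda>t. H (w t, u t)) - (\<Sum>k<N (r n). H (V (r n) (int k), X (r n) (int k))) / real (N (r n))\<bar> \<le> e / 2"
      proof (rule riemann_sum_error[OF Npos])
        show "(\<lambda>t. H (w t, u t)) integrable_on {0..1}"
          by (intro integrable_continuous_interval continuous_on_compose2[OF H] continuous_intros contu contw) auto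
        fix k t assume "real k \<le> real (N (r n)) * t" "real (N (r n)) * t \<le> real k + 1"
        then have near: "norm (V (r n) (int k) - w t) < d1 / 2" "norm (X (r n) (int k) - u t) < d1 / 2"
          using d[rule_format, OF n, of "int k" t t] \<open>0 < d\<close> by auto
        have "dist (w t, u t) (V (r n) (int k), X (r n) (int k)) \<le> norm (w t - V (r n) (int k)) + norm (u t - X (r n) (int k))"
          unfolding dist_norm diff_Pair by (rule norm_Pair_le)
        also have "\<dots> < d1" using near by (simp add: norm_minus_commute)
        finally have "dist (H (w t, u t)) (H (V (r n) (int k), X (r n) (int k))) < e / 2"
          using VL wL uB bnd[of "r n" "int k"] \<open>0 \<le> B\<close> by (intro d1) (auto simp: S'_def)
        then show "\<bar>H (w t, u t) - H (V (r n) (int k), X (r n) (int k))\<bar> \<le> e / 2"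
          by (simp add: dist_real_def)
      qed
      then show "norm ((\<Sum>k<N (r n). H (V (r n) (int k), X (r n) (int k))) / real (N (r n)) -
         integral {0..1} (\<lambda>t. H (w t, u t))) < e" using \<open>0 < e\<close> by (simp add: abs_minus_commute)
    qed
  qed
  have "u (t + 1) = u t" for t by (simp add: u_def frac_1_eq)
  then show ?thesis
    using deriv riemann r \<open>0 < \<mu>\<close> unfolding w V_def
    by (intro exI[of _ u] exI[of _ "2 / \<mu>"] exI[of _ r]) auto
qed

section \<open>Closed curves and periodic solutions\<close>

lemma C1_abs_continuous_on:
  fixes u :: "real \<Rightarrow> 'a::euclidean_space"
  assumes u: "\<And>t. t \<in> {a..b} \<Longrightarrow> (u has_vector_derivative u' t) (at t within {a..b})"
    and u': "continuous_on {a..b} u'"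
  shows "abs_continuous_on a b u"
  unfolding abs_continuous_on_def
proof (intro allI impI)
  fix e :: real assume "0 < e"
  have "bounded (u' ` {a..b})" by (intro compact_imp_bounded compact_continuous_image u') auto
  then obtain L where "0 < L" and L: "\<forall>y\<in>u' ` {a..b}. norm y \<le> L" using bounded_pos by blast
  have lip: "norm (u y - u x) \<le> L * (y - x)" if "a \<le> x" "x \<le> y" "y \<le> b" for x y
  proof -
    have "(u has_derivative (\<lambda>h. h *\<^sub>R u' t)) (at t within {a..b})" if "t \<in> {a..b}" for t
      using u[OF that] by (simp add: has_vector_derivative_def)
    moreover have "onorm (\<lambda>h. h *\<^sub>R u' t) \<le> L" if "t \<in> {a..b}" for t
    proof (rule onorm_le)
      fix h :: real
      have "norm (u' t) \<le> L" using L that by auto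
      then show "norm (h *\<^sub>R u' t) \<le> L * norm h" by (simp add: mult.commute[of L] mult_left_mono)
    qed
    ultimately show ?thesis
      using differentiable_bound[of "{a..b}" u "\<lambda>t h. h *\<^sub>R u' t" L y x] that by auto
  qed
  show "\<exists>d>0. \<forall>D. D division_of \<Union> D \<longrightarrow> \<Union> D \<subseteq> {a..b} \<longrightarrow> (\<Sum>K\<in>D. Sup K - Inf K) < d \<longrightarrow>
      (\<Sum>K\<in>D. norm (u (Sup K) - u (Inf K))) < e"
  proof (intro exI[of _ "e / L"] conjI allI impI)
    fix D :: "real set set"
    assume D: "D division_of \<Union> D" "\<Union> D \<subseteq> {a..b}" "(\<Sum>K\<in>D. Sup K - Inf K) < e / L"
    have "(\<Sum>K\<in>D. norm (u (Sup K) - u (Inf K))) \<le> (\<Sum>K\<in>D. L * (Sup K - Inf K))"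
    proof (rule sum_mono)
      fix K assume "K \<in> D"
      note K = division_of_real_interval[OF D(1) \<open>K \<in> D\<close>]
      have "{Inf K..Sup K} \<subseteq> {a..b}" using D(2) \<open>K \<in> D\<close> K(2) by auto
      with K(1) show "norm (u (Sup K) - u (Inf K)) \<le> L * (Sup K - Inf K)" by (intro lip) auto
    qed
    also have "\<dots> = L * (\<Sum>K\<in>D. Sup K - Inf K)" by (simp add: sum_distrib_left)
    also have "\<dots> < e" using D(3) \<open>0 < L\<close> by (simp add: field_simps)
    finally show "(\<Sum>K\<in>D. norm (u (Sup K) - u (Inf K))) < e" .
  qed (use \<open>0 < e\<close> \<open>0 < L\<close> in simp)
qed

lemma lebesgue_integral_continuous_interval:
  fixes f :: "real \<Rightarrow> 'b::euclidean_space"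
  assumes "continuous_on {a..b} f"
  shows "(LINT t|lebesgue_on {a..b}. f t) = integral {a..b} f"
  by (intro lebesgue_integral_eq_integral continuous_imp_integrable_real assms) simp

section \<open>Smooth closed curves and Jensen's inequality\<close>

context differentiable_G_function
begin

lemma continuous_on_Orlicz_space:
  fixes u :: "real \<Rightarrow> 'a"
  assumes u: "continuous_on {0..1} u"
  shows "u \<in> Orlicz_space G"
proof -
  have "integrable (lebesgue_on {0..1}) (\<lambda>t. G (1 *\<^sub>R u t))"
    by (intro continuous_imp_integrable_real continuous_on_compose2[OF continuous[of UNIV]] continuous_intros u) auto
  then have "(\<integral>\<^sup>+t. ennreal (norm (G (1 *\<^sub>R u t))) \<partial>lebesgue_on {0..1}) < \<infinity>"
    by (simp only: integrable_iff_bounded)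
  moreover have "u \<in> borel_measurable (lebesgue_on {0..1})"
    using continuous_imp_integrable_real[OF u] by (rule borel_measurable_integrable)
  ultimately show ?thesis
    unfolding Orlicz_space_def using nonneg by (auto intro!: exI[of _ "1::real"])
qed

lemma C1_W1T:
  fixes u :: "real \<Rightarrow> 'a"
  assumes u: "\<And>t. (u has_vector_derivative u' t) (at t)"
    and u': "continuous_on UNIV u'" and "u 0 = u 1"
  shows "u \<in> W1T G" and "\<And>t. t \<in> {0..1} \<Longrightarrow> dot u t = u' t"
proof -
  show dot: "dot u t = u' t" if "t \<in> {0..1}" for t
    unfolding dot_def
    by (rule vector_derivative_within_closed_interval[OF zero_less_one that])
      (rule has_vector_derivative_at_within[OF u])
  have u'01: "continuous_on {0..1} u'" using u' by (rule continuous_on_subset) simp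
  have "continuous_on {0..1} (dot u)"
    using u'01 by (rule continuous_on_eq) (simp add: dot)
  moreover have "abs_continuous_on 0 1 u"
    by (rule C1_abs_continuous_on[OF has_vector_derivative_at_within[OF u] u'01])
  moreover from this have "continuous_on {0..1} u" by (rule abs_continuous_on_imp_continuous_on)
  ultimately show "u \<in> W1T G"
    unfolding W1T_def using continuous_on_Orlicz_space \<open>u 0 = u 1\<close> by blast
qed

text \<open>Integrate the tangent inequality at the mean value \<open>q\<close>; the linear term
  cancels.\<close>

lemma jensen_interval:
  assumes "x < y" and v: "(v has_integral p) {x..y}" and Gv: "(\<lambda>t. G (v t)) integrable_on {x..y}"
  shows "(y - x) * G ((1 / (y - x)) *\<^sub>R p) \<le> integral {x..y} (\<lambda>t. G (v t))"
proof -
  define q where "q = (1 / (y - x)) *\<^sub>R p"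
  have p: "p = (y - x) *\<^sub>R q" using assms(1) by (simp add: q_def)
  have "((\<lambda>t. g q \<bullet> v t) has_integral g q \<bullet> p) {x..y}"
    using has_integral_linear[OF v bounded_linear_inner_right[of "g q"]] by (simp add: o_def)
  then have "((\<lambda>t. G q - g q \<bullet> q + g q \<bullet> v t) has_integral (y - x) * (G q - g q \<bullet> q) + g q \<bullet> p) {x..y}"
    using has_integral_const_real[of "G q - g q \<bullet> q" x y] assms(1) by (intro has_integral_add) auto
  moreover have "(y - x) * (G q - g q \<bullet> q) + g q \<bullet> p = (y - x) * G q"
    unfolding p by (simp add: algebra_simps)
  ultimately have "((\<lambda>t. G q - g q \<bullet> q + g q \<bullet> v t) has_integral (y - x) * G q) {x..y}" by simp
  then show ?thesis
    unfolding q_def[symmetric]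
  proof (rule has_integral_le[OF _ integrable_integral[OF Gv]])
    show "G q - g q \<bullet> q + g q \<bullet> v t \<le> G (v t)" for t
      using tangent_le[of q "v t"] by (simp add: inner_diff_right)
  qed
qed

end

section \<open>Polygons inscribed in a closed curve\<close>

context symplectic_G_function
begin

text \<open>The slope of a chord is the mean of \<open>u'\<close> over the cell, so Jensen applies
  cell by cell. For the action, replacing \<open>u\<close> on a cell by its value at the left end
  costs at most its oscillation times the integral of \<open>norm (v t)\<close>.\<close>

lemma W1T_sampling:
  assumes u: "u \<in> W1T G" and Gint: "integrable (lebesgue_on {0..1}) (\<lambda>t. G (dot u t))"
    and a: "a < - (LINT t|lebesgue_on {0..1}. symp_J (dot u t) \<bullet> u t)"
  shows "\<exists>N0. \<forall>N\<ge>N0. 0 < N \<longrightarrow> (\<exists>Y. periodic_seq N Y \<and>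
    energy N Y \<le> (LINT t|lebesgue_on {0..1}. G (dot u t)) \<and> a \<le> action N Y)"
proof -
  let ?M = "lebesgue_on {0..1::real}"
  define v where "v = dot u"
  have ac: "abs_continuous_on 0 1 u" and u01: "u 0 = u 1" and vm: "v \<in> borel_measurable ?M"
    using u by (auto simp: W1T_def Orlicz_space_def v_def)
  have contu: "continuous_on {0..1} u" by (rule abs_continuous_on_imp_continuous_on[OF ac])
  have um: "u \<in> borel_measurable ?M"
    using continuous_imp_integrable_real[OF contu] by (rule borel_measurable_integrable)
  obtain K where K: "0 \<le> K" "\<And>x. norm x - K \<le> G x" using linear_growth by blast
  have vint: "integrable ?M v"
  proof (rule Bochner_Integration.integrable_bound)
    show "integrable ?M (\<lambda>t. G (v t) + K)"
      unfolding v_def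
      by (intro Bochner_Integration.integrable_add Gint continuous_imp_integrable_real continuous_on_const)
    show "AE t in ?M. norm (v t) \<le> norm (G (v t) + K)"
    proof (rule AE_I2)
      fix t show "norm (v t) \<le> norm (G (v t) + K)" using K(2)[of "v t"] by (simp only: real_norm_def)
    qed
  qed (rule vm)
  have Jm: "(\<lambda>t. symp_J (u t)) \<in> borel_measurable ?M"
    by (rule measurable_compose[OF um borel_measurable_continuous_onI])
      (rule bounded_linear.continuous_on[OF bounded_linear_symp_J continuous_on_id])
  have "bounded (u ` {0..1})" by (intro compact_imp_bounded compact_continuous_image contu) auto
  then obtain U where U: "\<forall>y\<in>u ` {0..1}. norm y \<le> U" using bounded_iff by blast
  have vJint: "integrable ?M (\<lambda>t. v t \<bullet> symp_J (u t))"
  proof (rule Bochner_Integration.integrable_bound)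
    show "integrable ?M (\<lambda>t. U * norm (v t))" using vint by (intro integrable_mult_right integrable_norm)
    show "(\<lambda>t. v t \<bullet> symp_J (u t)) \<in> borel_measurable ?M" using vm Jm by (rule borel_measurable_inner)
    show "AE t in ?M. norm (v t \<bullet> symp_J (u t)) \<le> norm (U * norm (v t))"
    proof (rule AE_I2)
      fix t assume "t \<in> space ?M"
      then have "norm (u t) \<le> U" using U by simp
      have "norm (v t \<bullet> symp_J (u t)) \<le> norm (v t) * norm (symp_J (u t))"
        using Cauchy_Schwarz_ineq2[of "v t" "symp_J (u t)"] by simp
      also have "\<dots> \<le> norm (v t) * U" using \<open>norm (u t) \<le> U\<close> by (simp add: mult_left_mono)
      finally show "norm (v t \<bullet> symp_J (u t)) \<le> norm (U * norm (v t))"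
        by (metis abs_ge_self mult.commute order_trans real_norm_def)
    qed
  qed
  have S: "{0..1::real} \<in> sets lebesgue" by simp
  note HK = integrable_on_lebesgue_on[OF _ S] lebesgue_integral_eq_integral[OF _ S]
  define A where "A = integral {0..1} (\<lambda>t. v t \<bullet> symp_J (u t))"
  have aA: "a < A"
  proof -
    have "(LINT t|?M. symp_J (dot u t) \<bullet> u t) = (LINT t|?M. - (v t \<bullet> symp_J (u t)))"
      by (simp add: v_def symp_J_inner)
    then show ?thesis using a HK(2)[OF vJint] by (simp add: A_def)
  qed
  define W where "W = integral {0..1} (\<lambda>t. norm (v t))"
  have normint: "(\<lambda>t. norm (v t)) integrable_on {0..1}" by (rule HK(1)[OF integrable_norm[OF vint]])
  have "0 \<le> W" unfolding W_def by (intro integral_nonneg normint) auto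
  \<comment> \<open>The admissible oscillation on a cell: it loses at most \<open>A - a\<close> of
    action. The \<open>+ 1\<close> covers \<open>W = 0\<close>.\<close>
  define e where "e = (A - a) / (W + 1)"
  have "0 < e" using aA \<open>0 \<le> W\<close> by (simp add: e_def)
  have eW: "e * W \<le> A - a"
  proof -
    have "e * W \<le> e * (W + 1)" using \<open>0 < e\<close> by (simp add: mult_left_mono)
    also have "\<dots> = A - a" using \<open>0 \<le> W\<close> by (simp add: e_def)
    finally show ?thesis .
  qed
  have "uniformly_continuous_on {0..1} u" by (intro compact_uniformly_continuous contu) auto
  then obtain d where "d > 0" and d: "\<And>x y. x \<in> {0..1} \<Longrightarrow> y \<in> {0..1} \<Longrightarrow> dist y x < d \<Longrightarrow> dist (u y) (u x) < e"
    unfolding uniformly_continuous_on_def using \<open>0 < e\<close> by blast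
  obtain N0 :: nat where N0: "1 / d < real N0" using reals_Archimedean2 by blast
  show ?thesis
  proof (intro exI[of _ N0] allI impI)
    fix N assume "N0 \<le> N" and N: "0 < N"
    then have "1 / d < real N" using N0 by linarith
    then have Nd: "1 / real N < d" using \<open>0 < d\<close> N by (simp add: field_simps)
    \<comment> \<open>The fractional part makes the samples periodic; at \<open>k = N\<close> it
      gives \<open>u 0\<close>, which equals \<open>u 1\<close> for a closed curve.\<close>
    define Y where "Y i = u (frac (real_of_int i / real N))" for i
    define I where "I k = {real k / real N..(real k + 1) / real N}" for k
    have perY: "periodic_seq N Y"
    proof -
      have "real_of_int (i + int N) / real N = real_of_int i / real N + 1" for i
        using N by (simp add: field_simps)
      then show ?thesis unfolding periodic_seq_def Y_def by (metis frac_1_eq)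
    qed
    have Yk: "Y (int k) = u (real k / real N)" if "k \<le> N" for k
    proof (cases "k = N")
      case True
      then show ?thesis using N u01 by (simp add: Y_def)
    next
      case False
      then have "frac (real k / real N) = real k / real N" using that N by (subst frac_eq) auto
      then show ?thesis by (simp add: Y_def)
    qed
    have Isub: "I k \<subseteq> {0..1}" if "k < N" for k
    proof -
      have "real k + 1 \<le> real N" using that by simp
      then have "(real k + 1) / real N \<le> 1" using N by simp
      moreover have "0 \<le> real k / real N" by simp
      ultimately show ?thesis unfolding I_def by (intro atLeastatMost_subset_iff[THEN iffD2] disjI2 conjI)
    qed
    have len: "(real k + 1) / real N - real k / real N = 1 / real N" for k
      by (simp add: diff_divide_distrib[symmetric])
    have klt: "real k / real N < (real k + 1) / real N" for k using N by (simp add: divide_strict_right_mono)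
    have vI: "(v has_integral (Y (int k + 1) - Y (int k))) (I k)" if "k < N" for k
    proof -
      have "Y (int k + 1) = u ((real k + 1) / real N)" "Y (int k) = u (real k / real N)"
        using Yk[of "Suc k"] Yk[of k] that by (simp_all add: add.commute)
      moreover have "0 \<le> real k / real N" "(real k + 1) / real N \<le> 1"
        using Isub[OF that] klt[of k] by (auto simp: I_def)
      ultimately show ?thesis
        unfolding I_def v_def
        using abs_continuous_on_has_integral_dot[OF ac, of "real k / real N" "(real k + 1) / real N"] klt[of k] by simp
    qed
    have sub: "f integrable_on I k" if "f integrable_on {0..1}" "k < N" for f :: "real \<Rightarrow> real" and k
      using integrable_on_subinterval[OF that(1)] Isub[OF that(2)] by (simp add: I_def)
    have Gint': "(\<lambda>t. G (v t)) integrable_on {0..1}" unfolding v_def by (rule HK(1)[OF Gint])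
    have "energy N Y = (\<Sum>k<N. (1 / real N) * G (real N *\<^sub>R (Y (int k + 1) - Y (int k))))"
      by (simp add: energy_def sum_divide_distrib)
    also have "\<dots> \<le> (\<Sum>k<N. integral (I k) (\<lambda>t. G (v t)))"
    proof (rule sum_mono)
      fix k assume "k \<in> {..<N}"
      then have k: "k < N" by simp
      have "((real k + 1) / real N - real k / real N) * G ((1 / ((real k + 1) / real N - real k / real N)) *\<^sub>R (Y (int k + 1) - Y (int k)))
          \<le> integral {real k / real N..(real k + 1) / real N} (\<lambda>t. G (v t))"
        using vI[OF k] sub[OF Gint' k] unfolding I_def by (intro jensen_interval klt)
      then show "(1 / real N) * G (real N *\<^sub>R (Y (int k + 1) - Y (int k))) \<le> integral (I k) (\<lambda>t. G (v t))"
        unfolding len I_def by simp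
    qed
    also have "\<dots> = integral {0..1} (\<lambda>t. G (v t))"
      unfolding I_def by (rule integral_cells[OF N Gint', symmetric])
    also have "\<dots> = (LINT t|?M. G (dot u t))"
      using HK(2)[OF Gint] by (simp add: v_def)
    finally have energy: "energy N Y \<le> (LINT t|?M. G (dot u t))" .
    have vJ': "(\<lambda>t. v t \<bullet> symp_J (u t)) integrable_on {0..1}" by (rule HK(1)[OF vJint])
    have "A - action N Y = (\<Sum>k<N. integral (I k) (\<lambda>t. v t \<bullet> symp_J (u t)) - (Y (int k + 1) - Y (int k)) \<bullet> symp_J (Y (int k)))"
      unfolding A_def action_def integral_cells[OF N vJ'] I_def
      by (simp add: sum_subtractf inner_diff_left)
    also have "\<dots> \<le> (\<Sum>k<N. e * integral (I k) (\<lambda>t. norm (v t)))"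
    proof (rule sum_mono)
      fix k assume "k \<in> {..<N}"
      then have k: "k < N" by simp
      have Ykk: "Y (int k) = u (real k / real N)" using Yk k by simp
      have "((\<lambda>t. v t \<bullet> symp_J (Y (int k))) has_integral (Y (int k + 1) - Y (int k)) \<bullet> symp_J (Y (int k))) (I k)"
        using has_integral_linear[OF vI[OF k] bounded_linear_inner_left[of "symp_J (Y (int k))"]] by (simp add: o_def)
      from has_integral_diff[OF integrable_integral[OF sub[OF vJ' k]] this]
      have diff: "((\<lambda>t. v t \<bullet> symp_J (u t) - v t \<bullet> symp_J (Y (int k))) has_integral
          (integral (I k) (\<lambda>t. v t \<bullet> symp_J (u t)) - (Y (int k + 1) - Y (int k)) \<bullet> symp_J (Y (int k)))) (I k)" .
      have nrm: "((\<lambda>t. e * norm (v t)) has_integral e * integral (I k) (\<lambda>t. norm (v t))) (I k)"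
        using integrable_integral[OF sub[OF normint k]] by (rule has_integral_mult_right)
      show "integral (I k) (\<lambda>t. v t \<bullet> symp_J (u t)) - (Y (int k + 1) - Y (int k)) \<bullet> symp_J (Y (int k))
          \<le> e * integral (I k) (\<lambda>t. norm (v t))"
      proof (rule has_integral_le[OF diff nrm])
        fix t assume t: "t \<in> I k"
        have "dist (u t) (u (real k / real N)) < e"
        proof (rule d)
          have "real k / real N \<in> I k" using klt[of k] by (simp add: I_def)
          then show "real k / real N \<in> {0..1}" by (rule subsetD[OF Isub[OF k]])
          show "t \<in> {0..1}" by (rule subsetD[OF Isub[OF k] t])
          show "dist t (real k / real N) < d" using t len[of k] Nd by (auto simp: I_def dist_real_def)
        qed
        then have ne: "norm (u t - Y (int k)) \<le> e" by (simp add: Ykk dist_norm)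
        have "v t \<bullet> symp_J (u t) - v t \<bullet> symp_J (Y (int k)) = v t \<bullet> symp_J (u t - Y (int k))"
          by (simp add: inner_diff_right)
        also have "\<dots> \<le> norm (v t) * norm (symp_J (u t - Y (int k)))" by (rule norm_cauchy_schwarz)
        also have "\<dots> \<le> norm (v t) * e" unfolding norm_symp_J using ne by (rule mult_left_mono) simp
        finally show "v t \<bullet> symp_J (u t) - v t \<bullet> symp_J (Y (int k)) \<le> e * norm (v t)" by (simp only: mult.commute)
      qed
    qed
    also have "\<dots> = e * W"
      unfolding W_def integral_cells[OF N normint] I_def by (simp add: sum_distrib_left)
    finally have "a \<le> action N Y" using eW by linarith
    with perY energy show "\<exists>Y. periodic_seq N Y \<and> energy N Y \<le> (LINT t|?M. G (dot u t)) \<and> a \<le> action N Y"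
      by blast
  qed
qed

end

section \<open>From discrete maximisers to periodic solutions\<close>

context symplectic_G_function
begin

text \<open>Discrete action and energy are Riemann sums in slope and position, for the integrands
  \<open>v \<bullet> symp_J x\<close> and \<open>G v\<close>. The two inequalities pass to the limit
  and suffice; maximality is not carried along.\<close>

lemma exists_C1_extremal:
  assumes C: "0 < C" "\<And>u. G (2 *\<^sub>R u) \<le> C * G u + 1" and sa: "0 < s" "0 < a"
    and Y: "\<And>N. N0 \<le> N \<Longrightarrow> 0 < N \<Longrightarrow> \<exists>Y. periodic_seq N Y \<and> energy N Y \<le> s \<and> a \<le> action N Y"
  shows "\<exists>u m. 0 < m \<and> (\<forall>t. (u has_vector_derivative symp_J (g (m *\<^sub>R u t))) (at t)) \<and> (\<forall>t. u (t + 1) = u t) \<and>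
    a \<le> integral {0..1} (\<lambda>t. g (m *\<^sub>R u t) \<bullet> u t) \<and> integral {0..1} (\<lambda>t. G (symp_J (g (m *\<^sub>R u t)))) \<le> s"
proof -
  obtain l\<^sub>1 l\<^sub>2 B where l1: "0 < l\<^sub>1" and D: "\<forall>N Y. 0 < N \<longrightarrow> periodic_seq N Y \<longrightarrow> energy N Y \<le> s \<longrightarrow> a \<le> action N Y \<longrightarrow>
    (\<exists>X l. periodic_seq N X \<and> energy N X \<le> s \<and> a \<le> action N X \<and> l\<^sub>1 \<le> l \<and> l \<le> l\<^sub>2 \<and>
      (\<forall>i. real N *\<^sub>R (X (i + 1) - X i) = symp_J (g ((1 / l) *\<^sub>R (X i + X (i + 1))))) \<and>
      (\<forall>i. norm (X i) \<le> B))"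
    using discrete_solution[OF C sa] by (elim exE conjE)
  define N where "N n = N0 + n + 1" for n
  define P where "P n X l \<longleftrightarrow> periodic_seq (N n) X \<and> energy (N n) X \<le> s \<and> a \<le> action (N n) X \<and> l\<^sub>1 \<le> l \<and> l \<le> l\<^sub>2 \<and>
      (\<forall>i. real (N n) *\<^sub>R (X (i + 1) - X i) = symp_J (g ((1 / l) *\<^sub>R (X i + X (i + 1))))) \<and>
      (\<forall>i. norm (X i) \<le> B)" for n X l
  have "\<exists>X l. P n X l" for n
  proof -
    obtain Y where Y1: "periodic_seq (N n) Y" "energy (N n) Y \<le> s" "a \<le> action (N n) Y"
      using Y[of "N n"] by (auto simp: N_def)
    have "0 < N n" by (simp add: N_def)
    then show ?thesis unfolding P_def using D Y1 by blast
  qed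
  then have "\<forall>n. \<exists>X l. P n X l" by blast
  then obtain X where "\<forall>n. \<exists>l. P n (X n) l" by (rule choice[THEN exE])
  then obtain l where P: "\<forall>n. P n (X n) (l n)" by (rule choice[THEN exE])
  have Nn: "n < N n" for n by (simp add: N_def)
  have 1: "periodic_seq (N n) (X n)" "l\<^sub>1 \<le> l n" "l n \<le> l\<^sub>2" "energy (N n) (X n) \<le> s" "a \<le> action (N n) (X n)"
    "norm (X n i) \<le> B" "real (N n) *\<^sub>R (X n (i + 1) - X n i) = symp_J (g ((1 / l n) *\<^sub>R (X n i + X n (i + 1))))" for n i
    using P[rule_format, of n] unfolding P_def by blast+
  obtain u m r where m: "0 < m" and u: "\<forall>t. (u has_vector_derivative symp_J (g (m *\<^sub>R u t))) (at t)"
    "\<forall>t. u (t + 1) = u t"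
    and H: "\<forall>H. continuous_on UNIV H \<longrightarrow>
      (\<lambda>n. (\<Sum>k<N (r n). H (real (N (r n)) *\<^sub>R (X (r n) (int k + 1) - X (r n) (int k)), X (r n) (int k))) / real (N (r n)))
        \<longlonglongrightarrow> (integral {0..1} (\<lambda>t. H (symp_J (g (m *\<^sub>R u t)), u t)) :: real)"
    using midpoint_rule_limit[OF Nn 1(1) l1 1(2,3) 1(7,6)] by (elim exE conjE)
  have Npos: "0 < N n" for n by (simp add: N_def)
  have "continuous_on UNIV (\<lambda>p::((real^'n) \<times> (real^'n)) \<times> ((real^'n) \<times> (real^'n)). fst p \<bullet> symp_J (snd p))"
    by (intro continuous_intros bounded_linear.continuous_on[OF bounded_linear_symp_J])
  from H[rule_format, OF this]
  have "(\<lambda>n. (\<Sum>k<N (r n). (real (N (r n)) *\<^sub>R (X (r n) (int k + 1) - X (r n) (int k))) \<bullet> symp_J (X (r n) (int k))) / real (N (r n)))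
      \<longlonglongrightarrow> integral {0..1} (\<lambda>t. symp_J (g (m *\<^sub>R u t)) \<bullet> symp_J (u t))"
    by (simp only: fst_conv snd_conv)
  moreover have "(\<Sum>k<N n. (real (N n) *\<^sub>R (X n (int k + 1) - X n (int k))) \<bullet> symp_J (X n (int k))) / real (N n)
      = action (N n) (X n)" for n
    using Npos[of n] by (simp add: action_def inner_diff_left flip: sum_distrib_left)
  ultimately have "(\<lambda>n. action (N (r n)) (X (r n))) \<longlonglongrightarrow> integral {0..1} (\<lambda>t. g (m *\<^sub>R u t) \<bullet> u t)"
    by (simp only: symp_J_inner_symp_J)
  then have "a \<le> integral {0..1} (\<lambda>t. g (m *\<^sub>R u t) \<bullet> u t)"
    by (rule LIMSEQ_le_const) (use 1(5) in blast)
  moreover have "continuous_on UNIV (\<lambda>p::((real^'n) \<times> (real^'n)) \<times> ((real^'n) \<times> (real^'n)). G (fst p))"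
    by (intro continuous_on_compose2[OF continuous[of UNIV]] continuous_intros) auto
  from H[rule_format, OF this]
  have "(\<lambda>n. energy (N (r n)) (X (r n))) \<longlonglongrightarrow> integral {0..1} (\<lambda>t. G (symp_J (g (m *\<^sub>R u t))))"
    by (simp add: energy_def)
  then have "integral {0..1} (\<lambda>t. G (symp_J (g (m *\<^sub>R u t)))) \<le> s"
    by (rule LIMSEQ_le_const2) (use 1(4) in blast)
  ultimately show ?thesis using m u by blast
qed

lemma Hamiltonian_solution_iff:
  "Hamiltonian_solution G y \<longleftrightarrow> (\<forall>t. (y has_vector_derivative symp_J (g (y t))) (at t))"
proof -
  have *: "symp_J u' = - g z \<longleftrightarrow> u' = symp_J (g z)" for u' z
  proof
    assume "symp_J u' = - g z"
    then have "symp_J (symp_J u') = symp_J (- g z)" by simp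
    then show "u' = symp_J (g z)" by simp
  qed simp
  show ?thesis unfolding Hamiltonian_solution_def * by blast
qed

text \<open>The conversion \<open>real_of_ereal\<close> loses nothing, since the conjugate is finite
  at every gradient.\<close>

definition orbit_ratio :: "(real \<Rightarrow> (real^'n) \<times> (real^'n)) \<Rightarrow> real \<Rightarrow> real" where
  "orbit_ratio y T = 1 / T *
     ((LINT t|lebesgue_on {0..T}. g (y t) \<bullet> y t) /
      (LINT t|lebesgue_on {0..T}. real_of_ereal (convex_conjugate G (g (y t)))))"

lemma lebesgue_integral_rescale:
  fixes f :: "real \<Rightarrow> real"
  assumes f: "continuous_on UNIV f" and "0 < T"
  shows "(LINT t|lebesgue_on {0..T}. f t) = T * integral {0..1} (\<lambda>t. f (T * t))"
proof -
  have f': "continuous_on {0..T} f" using f by (rule continuous_on_subset) simp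
  then have "(f has_integral integral {0..T} f) (cbox 0 T)"
    by (simp add: integrable_continuous_interval integrable_integral)
  from has_integral_affinity'[OF this \<open>0 < T\<close>, of 0]
  have "((\<lambda>t. f (T * t)) has_integral (integral {0..T} f / T)) {0..1}"
    using \<open>0 < T\<close> by (simp add: divide_inverse mult.commute)
  then have "integral {0..1} (\<lambda>t. f (T * t)) = integral {0..T} f / T" by (rule integral_unique)
  then show ?thesis
    using \<open>0 < T\<close> lebesgue_integral_continuous_interval[OF f'] by simp
qed

text \<open>The numerator carries \<open>T\<close> twice, from the change of time and from
  \<open>y = T u\<close>, the denominator only once; this explains the prefactor
  \<open>1 / T\<close> of the quotient.\<close>

lemma orbit_rescale:
  assumes y: "\<And>t. (y has_vector_derivative symp_J (g (y t))) (at t)" and T: "0 < T" "\<And>t. y (t + T) = y t"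
  defines "u \<equiv> \<lambda>t. (1 / T) *\<^sub>R y (T * t)"
  shows "u \<in> W1T G"
    and "orbit_ratio y T = integral {0..1} (\<lambda>t. g (y (T * t)) \<bullet> u t) / integral {0..1} (\<lambda>t. G (symp_J (g (y (T * t)))))"
    and "orbit_ratio y T = - ((LINT t|lebesgue_on {0..1}. symp_J (dot u t) \<bullet> u t) / (LINT t|lebesgue_on {0..1}. G (dot u t)))"
proof -
  have conty: "continuous_on A y" for A
    using y by (meson continuous_at_imp_continuous_on has_vector_derivative_continuous)
  have contg: "continuous_on A (\<lambda>t. g (y t))" for A
    by (intro continuous_on_compose2[OF continuous_gradient] conty) auto
  have contJ: "continuous_on A (\<lambda>t. symp_J (g (y t)))" for A
    by (intro bounded_linear.continuous_on[OF bounded_linear_symp_J] contg)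
  have contG: "continuous_on A (\<lambda>t. G (symp_J (g (y t))))" for A
    by (intro continuous_on_compose2[OF continuous[of UNIV]] contJ) auto
  have scale: "continuous_on A (\<lambda>t. f (T * t))" if "continuous_on UNIV f" for f :: "real \<Rightarrow> 'b::topological_space" and A
    by (intro continuous_on_compose2[OF that] continuous_intros) auto
  have deriv: "(u has_vector_derivative symp_J (g (y (T * t)))) (at t)" for t
  proof -
    have "((\<lambda>t. T * t) has_vector_derivative T) (at t)"
      by (auto intro!: derivative_eq_intros simp: has_real_derivative_iff_has_vector_derivative[symmetric])
    from vector_diff_chain_at[OF this y]
    have "((\<lambda>t. y (T * t)) has_vector_derivative T *\<^sub>R symp_J (g (y (T * t)))) (at t)" by (simp add: o_def)
    from has_vector_derivative_scaleR[OF DERIV_const this, of "1 / T"]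
    show ?thesis unfolding u_def using T(1) by simp
  qed
  have "u 0 = u 1" using T(2)[of 0] by (simp add: u_def)
  note W = C1_W1T[OF deriv scale[OF contJ] this]
  show "u \<in> W1T G" by (rule W(1))
  define I where "I = integral {0..1} (\<lambda>t. g (y (T * t)) \<bullet> u t)"
  define E where "E = integral {0..1} (\<lambda>t. G (symp_J (g (y (T * t)))))"
  have "(LINT t|lebesgue_on {0..T}. g (y t) \<bullet> y t) = T * integral {0..1} (\<lambda>t. g (y (T * t)) \<bullet> y (T * t))"
    by (intro lebesgue_integral_rescale continuous_intros contg conty T(1))
  also have "(\<lambda>t. g (y (T * t)) \<bullet> y (T * t)) = (\<lambda>t. T * (g (y (T * t)) \<bullet> u t))"
    using T(1) by (simp add: u_def)
  also have "integral {0..1} \<dots> = T * I" unfolding I_def by (rule integral_mult_right)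
  finally have num: "(LINT t|lebesgue_on {0..T}. g (y t) \<bullet> y t) = T * (T * I)" .
  have "real_of_ereal (convex_conjugate G (g z)) = G (symp_J (g z))" for z
    using even[of "symp_J (g z)"] by (simp add: convex_conjugate_gradient_symp)
  then have "(LINT t|lebesgue_on {0..T}. real_of_ereal (convex_conjugate G (g (y t)))) = T * E"
    unfolding E_def using lebesgue_integral_rescale[OF contG T(1)] by simp
  with num show ratio: "orbit_ratio y T = I / E"
    using T(1) by (simp add: orbit_ratio_def)
  have contu: "continuous_on A u" for A
    using deriv by (meson continuous_at_imp_continuous_on has_vector_derivative_continuous)
  have "(LINT t|lebesgue_on {0..1}. symp_J (dot u t) \<bullet> u t) = (LINT t|lebesgue_on {0..1}. - (g (y (T * t)) \<bullet> u t))"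
    by (intro Bochner_Integration.integral_cong) (auto simp: W(2))
  also have "\<dots> = - I"
    unfolding I_def by (simp add: lebesgue_integral_continuous_interval continuous_on_inner scale[OF contg] contu)
  finally have 1: "(LINT t|lebesgue_on {0..1}. symp_J (dot u t) \<bullet> u t) = - I" .
  have "(LINT t|lebesgue_on {0..1}. G (dot u t)) = (LINT t|lebesgue_on {0..1}. G (symp_J (g (y (T * t)))))"
    by (intro Bochner_Integration.integral_cong) (auto simp: W(2))
  also have "\<dots> = E" unfolding E_def by (intro lebesgue_integral_continuous_interval scale contG)
  finally have 2: "(LINT t|lebesgue_on {0..1}. G (dot u t)) = E" .
  show "orbit_ratio y T = - ((LINT t|lebesgue_on {0..1}. symp_J (dot u t) \<bullet> u t) / (LINT t|lebesgue_on {0..1}. G (dot u t)))"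
    unfolding ratio 1 2 by simp
qed

lemma orbit_rescale_nonconstant:
  fixes y :: "real \<Rightarrow> 'v::real_vector"
  assumes T: "0 < T" "\<And>t. y (t + T) = y t" and "\<not> y constant_on UNIV"
  shows "\<not> (\<lambda>t. (1 / T) *\<^sub>R y (T * t)) constant_on {0..1::real}"
proof
  interpret periodic_fun_simple y T by standard (rule T(2))
  assume "(\<lambda>t. (1 / T) *\<^sub>R y (T * t)) constant_on {0..1}"
  then obtain c where c: "\<And>t. t \<in> {0..1} \<Longrightarrow> (1 / T) *\<^sub>R y (T * t) = c" by (auto simp: constant_on_def)
  have "y s = T *\<^sub>R c" for s
  proof -
    have "T * frac (s / T) + of_int \<lfloor>s / T\<rfloor> * T = s" using T(1) by (simp add: frac_def algebra_simps)
    then have "y s = y (T * frac (s / T))" using plus_of_int[of "T * frac (s / T)" "\<lfloor>s / T\<rfloor>"] by simp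
    also have "\<dots> = T *\<^sub>R ((1 / T) *\<^sub>R y (T * frac (s / T)))" using T(1) by simp
    also have "(1 / T) *\<^sub>R y (T * frac (s / T)) = c"
      using frac_ge_0[of "s / T"] frac_lt_1[of "s / T"] by (intro c) simp
    finally show ?thesis .
  qed
  with assms(3) show False by (auto simp: constant_on_def)
qed

text \<open>A positive action forces the gradient to be nonzero somewhere along the extremal. This
  excludes constant solutions, where it vanishes, and makes the denominator positive.\<close>

lemma exists_periodic_solution:
  assumes C: "0 < C" "\<And>u. G (2 *\<^sub>R u) \<le> C * G u + 1" and sa: "0 < s" "0 < a"
    and Y: "\<And>N. N0 \<le> N \<Longrightarrow> 0 < N \<Longrightarrow> \<exists>Y. periodic_seq N Y \<and> energy N Y \<le> s \<and> a \<le> action N Y"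
  shows "\<exists>y T. (y, T) \<in> periodic_solutions G \<and> a / s \<le> orbit_ratio y T"
proof -
  have "\<exists>u m. 0 < m \<and> (\<forall>t. (u has_vector_derivative symp_J (g (m *\<^sub>R u t))) (at t)) \<and> (\<forall>t. u (t + 1) = u t) \<and>
    a \<le> integral {0..1} (\<lambda>t. g (m *\<^sub>R u t) \<bullet> u t) \<and> integral {0..1} (\<lambda>t. G (symp_J (g (m *\<^sub>R u t)))) \<le> s"
    by (rule exists_C1_extremal[OF C sa]) (rule Y)
  then obtain u m where m: "0 < m" and u: "\<And>t. (u has_vector_derivative symp_J (g (m *\<^sub>R u t))) (at t)"
    and per: "\<And>t. u (t + 1) = u t"
    and I: "a \<le> integral {0..1} (\<lambda>t. g (m *\<^sub>R u t) \<bullet> u t)"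
    and E: "integral {0..1} (\<lambda>t. G (symp_J (g (m *\<^sub>R u t)))) \<le> s"
    by blast
  \<comment> \<open>Stretching space and time by \<open>m\<close> removes the multiplier from the
    equation and turns period 1 into period \<open>m\<close>.\<close>
  define y where "y t = m *\<^sub>R u (t / m)" for t
  have y: "(y has_vector_derivative symp_J (g (y t))) (at t)" for t
  proof -
    have "((\<lambda>t. t / m) has_vector_derivative 1 / m) (at t)"
      using m by (auto intro!: derivative_eq_intros simp: has_real_derivative_iff_has_vector_derivative[symmetric])
    from vector_diff_chain_at[OF this u]
    have "((\<lambda>t. u (t / m)) has_vector_derivative (1 / m) *\<^sub>R symp_J (g (m *\<^sub>R u (t / m)))) (at t)" by (simp add: o_def)
    from has_vector_derivative_scaleR[OF DERIV_const this, of m]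
    show ?thesis unfolding y_def using m by simp
  qed
  have yper: "y (t + m) = y t" for t
    using per[of "t / m"] m by (simp add: y_def add_divide_distrib)
  have ym: "y (m * t) = m *\<^sub>R u t" "(1 / m) *\<^sub>R m *\<^sub>R u t = u t" for t using m by (simp_all add: y_def)
  have Ipos: "integral {0..1} (\<lambda>t. g (m *\<^sub>R u t) \<bullet> u t) > 0" using I sa by simp
  have nonzero: "\<exists>t\<in>{0..1}. g (m *\<^sub>R u t) \<noteq> 0"
  proof (rule ccontr)
    assume "\<not> ?thesis"
    then have "g (m *\<^sub>R u t) \<bullet> u t = 0" if "t \<in> {0..1}" for t using that by simp
    then have "integral {0..1} (\<lambda>t. g (m *\<^sub>R u t) \<bullet> u t) = integral {0..1::real} (\<lambda>t. 0)"
      by (rule Henstock_Kurzweil_Integration.integral_cong)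
    then show False using Ipos by simp
  qed
  have "\<not> y constant_on UNIV"
  proof
    assume "y constant_on UNIV"
    then obtain c where "y = (\<lambda>_. c)" by (auto simp: constant_on_def fun_eq_iff)
    then have "(y has_vector_derivative 0) (at t)" for t by simp
    then have "symp_J (g (y t)) = 0" for t using vector_derivative_unique_at[OF y] by blast
    then have "g (y t) = 0" for t by (simp add: symp_J_eq_0_iff)
    then have "g (m *\<^sub>R u t) = 0" for t using ym(1)[of t] by metis
    then show False using nonzero by blast
  qed
  then have "(y, m) \<in> periodic_solutions G"
    using m y yper by (simp add: periodic_solutions_def Hamiltonian_solution_iff)
  moreover have "a / s \<le> orbit_ratio y m"
  proof -
    have contu: "continuous_on {0..1} u"
      using u by (meson continuous_at_imp_continuous_on has_vector_derivative_continuous)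
    have cont: "continuous_on {0..1} (\<lambda>t. G (symp_J (g (m *\<^sub>R u t))))"
      by (intro continuous_on_compose2[OF continuous[of UNIV]] bounded_linear.continuous_on[OF bounded_linear_symp_J]
          continuous_on_compose2[OF continuous_gradient] continuous_intros contu) auto
    have "0 \<le> integral {0..1} (\<lambda>t. G (symp_J (g (m *\<^sub>R u t))))"
      by (intro integral_nonneg integrable_continuous_interval cont nonneg)
    moreover have "integral {0..1} (\<lambda>t. G (symp_J (g (m *\<^sub>R u t)))) \<noteq> 0"
    proof
      assume "integral {0..1} (\<lambda>t. G (symp_J (g (m *\<^sub>R u t)))) = 0"
      then have "\<forall>t\<in>{0..1}. G (symp_J (g (m *\<^sub>R u t))) = 0"
        by (subst (asm) integral_eq_0_iff[OF cont]) (auto simp: nonneg)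
      then have "\<forall>t\<in>{0..1}. g (m *\<^sub>R u t) = 0" by (simp add: G_eq_0_iff symp_J_eq_0_iff)
      then show False using nonzero by blast
    qed
    ultimately have Epos: "0 < integral {0..1} (\<lambda>t. G (symp_J (g (m *\<^sub>R u t))))" by simp
    show ?thesis
      unfolding orbit_rescale(2)[OF y m yper] ym
      by (rule frac_le[OF less_imp_le[OF Ipos] I Epos E])
  qed
  ultimately show ?thesis by blast
qed

lemma exists_periodic_solution_of_W1T:
  assumes C: "0 < C" "\<And>u. G (2 *\<^sub>R u) \<le> C * G u + 1"
    and u: "u \<in> W1T G" "integrable (lebesgue_on {0..1}) (\<lambda>t. G (dot u t))"
    and a: "0 < a" "a < - (LINT t|lebesgue_on {0..1}. symp_J (dot u t) \<bullet> u t)"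
    and s: "0 < s" "(LINT t|lebesgue_on {0..1}. G (dot u t)) \<le> s"
  shows "\<exists>y T. (y, T) \<in> periodic_solutions G \<and> a / s \<le> orbit_ratio y T"
proof -
  obtain N0 where N0: "\<forall>N\<ge>N0. 0 < N \<longrightarrow> (\<exists>Y. periodic_seq N Y \<and>
    energy N Y \<le> (LINT t|lebesgue_on {0..1}. G (dot u t)) \<and> a \<le> action N Y)"
    using W1T_sampling[OF u a(2)] by blast
  show ?thesis
  proof (rule exists_periodic_solution[OF C s(1) a(1)])
    fix N assume "N0 \<le> N" "0 < N"
    then show "\<exists>Y. periodic_seq N Y \<and> energy N Y \<le> s \<and> a \<le> action N Y"
      using N0 s(2) by (meson order_trans)
  qed
qed

text \<open>A circle in a coordinate plane, oriented to have action \<open>2 * pi\<close>, is a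
  competitor of positive action; it guarantees that the supremum is nonnegative.\<close>

lemma exists_periodic_solution_nonneg:
  assumes C: "0 < C" "\<And>u. G (2 *\<^sub>R u) \<le> C * G u + 1"
  shows "\<exists>y T. (y, T) \<in> periodic_solutions G \<and> 0 \<le> orbit_ratio y T"
proof -
  define e :: "real^'n" where "e = (SOME b. b \<in> Basis)"
  have ee: "e \<bullet> e = 1" unfolding e_def using SOME_Basis norm_Basis by (simp add: norm_eq_1)
  define u where "u t = (cos (2 * pi * t) *\<^sub>R e, - sin (2 * pi * t) *\<^sub>R e)" for t
  define u' where "u' t = ((- (2 * pi) * sin (2 * pi * t)) *\<^sub>R e, (- (2 * pi) * cos (2 * pi * t)) *\<^sub>R e)" for t
  have deriv: "(u has_vector_derivative u' t) (at t)" for t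
    unfolding u_def u'_def
    by (intro has_vector_derivative_Pair)
      (auto intro!: derivative_eq_intros simp: has_vector_derivative_def)
  have contu': "continuous_on A u'" for A unfolding u'_def by (intro continuous_intros)
  have "u 0 = u 1" by (simp add: u_def)
  note W = C1_W1T[OF deriv contu' this]
  have Gint: "integrable (lebesgue_on {0..1}) (\<lambda>t. G (dot u t))"
  proof (intro continuous_imp_integrable_real)
    have "continuous_on {0..1} (\<lambda>t. G (u' t))"
      by (intro continuous_on_compose2[OF continuous[of UNIV]] contu') auto
    then show "continuous_on {0..1} (\<lambda>t. G (dot u t))" by (rule continuous_on_eq) (simp add: W(2))
  qed
  have "symp_J (u' t) \<bullet> u t = - (2 * pi)" for t
  proof -
    define p q where "p = cos (2 * pi * t)" and "q = sin (2 * pi * t)"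
    have u: "u t = (p *\<^sub>R e, - q *\<^sub>R e)" "u' t = ((- (2 * pi) * q) *\<^sub>R e, (- (2 * pi) * p) *\<^sub>R e)"
      by (simp_all add: u_def u'_def p_def q_def)
    have "symp_J (u' t) \<bullet> u t = - (2 * pi) * (p * p + q * q)"
      unfolding u by (simp add: symp_J_def inner_prod_def ee algebra_simps)
    also have "p * p + q * q = 1" unfolding p_def q_def by (rule sin_cos_squared_add3)
    finally show ?thesis by simp
  qed
  then have "(LINT t|lebesgue_on {0..1}. symp_J (dot u t) \<bullet> u t) = (LINT t|lebesgue_on {0..1::real}. - (2 * pi))"
    by (intro Bochner_Integration.integral_cong) (auto simp: W(2))
  also have "\<dots> = - (2 * pi)"
    by (subst lebesgue_integral_continuous_interval) (auto simp: continuous_on_const)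
  finally have A: "1 < - (LINT t|lebesgue_on {0..1}. symp_J (dot u t) \<bullet> u t)" using pi_gt3 by simp
  define E where "E = (LINT t|lebesgue_on {0..1}. G (dot u t))"
  have "0 \<le> E" unfolding E_def by (intro Bochner_Integration.integral_nonneg nonneg)
  \<comment> \<open>The level \<open>E + 1\<close> is positive and admits the circle without a proof
    that \<open>E\<close> is.\<close>
  then obtain y T where "(y, T) \<in> periodic_solutions G" "1 / (E + 1) \<le> orbit_ratio y T"
    using exists_periodic_solution_of_W1T[OF C W(1) Gint zero_less_one A, of "E + 1"] by (auto simp: E_def)
  moreover have "0 \<le> 1 / (E + 1)" using \<open>0 \<le> E\<close> by simp
  ultimately show ?thesis by (meson order_trans)
qed

end

theorem theorem3p9:
  fixes G :: "(real^'n) \<times> (real^'n) \<Rightarrow> real"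
  assumes "G_function G"
    and "symplectic G"
    and "Delta2 G"
    and "\<And>x. G differentiable (at x)"
    and "strictly_convex G"
  shows "C_const G =
    (SUP (u, T) \<in> periodic_solutions G.
       ereal (1 / T *
         ((LINT t|lebesgue_on {0..T}. gradient G (u t) \<bullet> u t) /
          (LINT t|lebesgue_on {0..T}. real_of_ereal (convex_conjugate G (gradient G (u t)))))))"
proof -
  interpret symplectic_G_function G
    using assms by unfold_locales
  obtain C where C: "0 < C" "\<And>u. G (2 *\<^sub>R u) \<le> C * G u + 1"
    using assms(3) by (auto simp: Delta2_def)
  define q where "q u = (LINT t|lebesgue_on {0..1}. symp_J (dot u t) \<bullet> u t) / (LINT t|lebesgue_on {0..1}. G (dot u t))" for u
  define W where "W = {u \<in> W1T G. \<not> u constant_on {0..1}}"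
  define S where "S = (SUP (u, T) \<in> periodic_solutions G. ereal (orbit_ratio u T))"
  have S_upper: "ereal (orbit_ratio y T) \<le> S" if "(y, T) \<in> periodic_solutions G" for y T
    unfolding S_def using that by (intro SUP_upper2[of "(y, T)"]) auto
  have "0 \<le> S"
    using exists_periodic_solution_nonneg[OF C] S_upper by (meson ereal_less_eq(5) order_trans)
  have "- S \<le> ereal (q u)" if u: "u \<in> W1T G" for u
  proof (rule ccontr)
    assume "\<not> - S \<le> ereal (q u)"
    then have "S < ereal (- q u)"
      using ereal_less_uminus_reorder[of "ereal (q u)" S] by (simp add: not_le)
    \<comment> \<open>A value strictly between leaves the gap \<open>r * E < A\<close> that sampling
      by polygons consumes; \<open>0 \<le> S\<close> makes \<open>r\<close> positive.\<close>
    then obtain r where r: "S < ereal r" "r < - q u" using ereal_dense2[of S "ereal (- q u)"] by auto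
    have "0 < r" using \<open>0 \<le> S\<close> r(1) by (metis ereal_less(2) order_le_less_trans)
    define A where "A = - (LINT t|lebesgue_on {0..1}. symp_J (dot u t) \<bullet> u t)"
    define E where "E = (LINT t|lebesgue_on {0..1}. G (dot u t))"
    have "r < A / E" using r(2) by (simp add: q_def A_def E_def)
    have "0 \<le> E" unfolding E_def by (intro Bochner_Integration.integral_nonneg nonneg)
    \<comment> \<open>Division by 0 gives 0, which contradicts \<open>0 < r < A / E\<close>.\<close>
    moreover have "E \<noteq> 0" using \<open>0 < r\<close> \<open>r < A / E\<close> by auto
    ultimately have "0 < E" by simp
    \<comment> \<open>A non-integrable integrand would have Bochner integral 0, contrary to
      \<open>E \<noteq> 0\<close>.\<close>
    have "integrable (lebesgue_on {0..1}) (\<lambda>t. G (dot u t))"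
      using \<open>E \<noteq> 0\<close> not_integrable_integral_eq unfolding E_def by blast
    moreover have "0 < r * E" "r * E < A" using \<open>0 < r\<close> \<open>0 < E\<close> \<open>r < A / E\<close> by (simp_all add: pos_less_divide_eq)
    ultimately obtain y T where yT: "(y, T) \<in> periodic_solutions G" "r * E / E \<le> orbit_ratio y T"
      using exists_periodic_solution_of_W1T[OF C u, of "r * E" E] \<open>0 < E\<close> by (auto simp: A_def E_def)
    then have "ereal r \<le> ereal (orbit_ratio y T)" using \<open>0 < E\<close> by simp
    also have "\<dots> \<le> S" by (rule S_upper[OF yT(1)])
    finally have "ereal r \<le> S" .
    then show False using r(1) by simp
  qed
  then have "- S \<le> (INF u \<in> W. ereal (q u))" unfolding W_def by (intro INF_greatest) auto
  moreover have "(INF u \<in> W. ereal (q u)) \<le> - S"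
  proof -
    have "ereal (orbit_ratio y T) \<le> - (INF u \<in> W. ereal (q u))" if yT: "(y, T) \<in> periodic_solutions G" for y T
    proof -
      have y: "\<And>t. (y has_vector_derivative symp_J (g (y t))) (at t)" "0 < T" "\<And>t. y (t + T) = y t" "\<not> y constant_on UNIV"
        using yT by (auto simp: periodic_solutions_def Hamiltonian_solution_iff)
      define u where "u t = (1 / T) *\<^sub>R y (T * t)" for t
      have eq: "u = (\<lambda>t. (1 / T) *\<^sub>R y (T * t))" by (simp add: u_def fun_eq_iff)
      have "u \<in> W"
        unfolding W_def eq using orbit_rescale(1)[OF y(1-3)] orbit_rescale_nonconstant[OF y(2-4)] by simp
      then have "(INF u \<in> W. ereal (q u)) \<le> ereal (q u)" by (rule INF_lower)
      moreover have "orbit_ratio y T = - q u"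
        unfolding q_def eq by (rule orbit_rescale(3)[OF y(1-3)])
      ultimately show ?thesis by (simp flip: uminus_ereal.simps(1))
    qed
    then have "S \<le> - (INF u \<in> W. ereal (q u))" unfolding S_def by (intro SUP_least) auto
    then have "- (- (INF u \<in> W. ereal (q u))) \<le> - S" by (simp only: ereal_minus_le_minus)
    then show ?thesis by simp
  qed
  ultimately have "(INF u \<in> W. ereal (q u)) = - S" by (rule antisym[rotated])
  then have "C_const G = S" by (simp add: C_const_def W_def q_def)
  then show ?thesis by (simp add: S_def orbit_ratio_def)
qed

end
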